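(* Let $a(t)$ be a real analytic quasi-periodic function on $D_\rho$ (for some $\rho>0$) with frequencies $\omega=(\omega_1,\dots,\omega_r)$ and with average $\bar a>0$. Suppose that $\omega$ satisfies the Diophantine condition $$\big|\langle k,\omega\rangle\big|\ge\frac{\alpha}{|k|^\tau}\qquad\text{for all }k\in\mathbb{Z}^r\setminus\{0\},$$ where $\alpha>0$ is a small constant and $\tau>r-1$. Then, for most sufficiently small $\varepsilon>0$, the equilibrium $x=\dot x=0$ of the quasi-periodic Hill's equation $$\ddot x+\varepsilon a(t)x=0$$ is stable in the sense of Lyapunov.
   Context: For $\rho>0$, $D_\rho=\{\theta\in\mathbb{C}^r:|\mathrm{Im}\,\theta_j|\le\rho,\ j=1,\dots,r\}$. A function $f(t)$ is quasi-periodic with basic frequencies $\omega=(\omega_1,\dots,\omega_r)$ if $f(t)=F(\omega_1t,\dots,\omega_rt)$ where $F(\theta_1,\dots,\theta_r)$ is $2\pi$-periodic in each argument; it is analytic quasi-periodic on $D_\rho$ if moreover $F$ is analytic on $D_\rho$. The average of $a$ is $\bar a=\lim_{T\to\infty}\frac1{2T}\int_{-T}^Ta(t)\,dt$. For $k\in\mathbb{Z}^r$, $|k|=|k_1|+\dots+|k_r|$ and $\langle k,\omega\rangle=\sum_jk_j\omega_j$. A property holds "for most sufficiently small $\varepsilon>0$" if for every sufficiently small $\varepsilon_0>0$ there is a set $E_{\varepsilon_0}\subset(0,\varepsilon_0)$ of positive Lebesgue measure such that the property holds for all $\varepsilon\in E_{\varepsilon_0}$, and $\operatorname{meas}(E_{\varepsilon_0})/\varepsilon_0\to1$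 as $\varepsilon_0\to0$. *)

theory Defs
  imports "HOL-Analysis.Analysis"
begin

definition strip :: "real \<Rightarrow> (complex ^ 'r::finite) set" where
  "strip \<rho> = {\<theta>. \<forall>j. \<bar>Im (\<theta> $ j)\<bar> \<le> \<rho>}"

text \<open>
  The counterpart in several variables of the library's \<open>analytic_on\<close>: near every point of \<open>S\<close>
  the function has a complex-linear Frechet derivative.  In particular, analyticity on a closed
  set such as \<open>strip \<rho>\<close> means analyticity on some open neighbourhood of it.
\<close>

definition multi_analytic_on :: "(complex ^ 'r::finite \<Rightarrow> complex) \<Rightarrow> (complex ^ 'r) set \<Rightarrow> bool" where
  "multi_analytic_on F S \<longleftrightarrow>
     (\<forall>z\<in>S. \<exists>e>0. \<forall>w\<in>ball z e. \<exists>F'. (F has_derivative F') (at w) \<and> (\<forall>c v. F' (c *s v) = c * F' v))"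

definition real_analytic_quasi_periodic ::
    "real \<Rightarrow> real ^ 'r::finite \<Rightarrow> (real \<Rightarrow> real) \<Rightarrow> bool" where
  "real_analytic_quasi_periodic \<rho> \<omega> a \<longleftrightarrow>
     (\<exists>F :: complex ^ 'r \<Rightarrow> complex.
        multi_analytic_on F (strip \<rho>) \<and>
        (\<forall>\<theta>\<in>strip \<rho>. \<forall>j. F (\<theta> + axis j (2 * of_real pi)) = F \<theta>) \<and>
        (\<forall>x :: real ^ 'r. F (\<chi> j. of_real (x $ j)) \<in> \<real>) \<and>
        (\<forall>t. of_real (a t) = F (\<chi> j. of_real (\<omega> $ j * t))))"

definition has_average :: "(real \<Rightarrow> real) \<Rightarrow> real \<Rightarrow> bool" where
  "has_average a m \<longleftrightarrow> ((\<lambda>T. 1 / (2 * T) * integral {-T..T} a) \<longlongrightarrow> m) at_top"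

definition diophantine :: "real \<Rightarrow> real \<Rightarrow> real ^ 'r::finite \<Rightarrow> bool" where
  "diophantine \<alpha> \<tau> \<omega> \<longleftrightarrow>
     (\<forall>k :: int ^ 'r. k \<noteq> 0 \<longrightarrow>
        \<bar>\<Sum>j\<in>UNIV. of_int (k $ j) * \<omega> $ j\<bar> \<ge> \<alpha> / of_int (\<Sum>j\<in>UNIV. \<bar>k $ j\<bar>) powr \<tau>)"

text \<open>
  Lyapunov stability of the equilibrium \<open>p\<close> of \<open>y' = f t y\<close>.  Solutions on all intervals
  \<open>{t0..T}\<close> are considered (with \<open>\<delta>\<close> independent of \<open>T\<close>), so that solutions which cannot be
  continued to all later times are not left out.
\<close>

definition lyapunov_stable :: "(real \<Rightarrow> 'a \<Rightarrow> 'a::real_normed_vector) \<Rightarrow> 'a \<Rightarrow> bool" where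
  "lyapunov_stable f p \<longleftrightarrow>
     (\<forall>t. f t p = 0) \<and>
     (\<forall>t0. \<forall>\<eta>>0. \<exists>\<delta>>0. \<forall>T\<ge>t0. \<forall>y.
        (\<forall>t\<in>{t0..T}. (y has_vector_derivative f t (y t)) (at t within {t0..T})) \<longrightarrow>
        dist (y t0) p < \<delta> \<longrightarrow> (\<forall>t\<in>{t0..T}. dist (y t) p < \<eta>))"

text \<open>Hill's equation \<open>x'' + \<epsilon> a(t) x = 0\<close> as a first-order system in \<open>(x, x')\<close>.\<close>

definition hill_field :: "real \<Rightarrow> (real \<Rightarrow> real) \<Rightarrow> real \<Rightarrow> real \<times> real \<Rightarrow> real \<times> real" where
  "hill_field \<epsilon> a t = (\<lambda>(x, v). (v, - (\<epsilon> * a t * x)))"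

definition for_most_small :: "(real \<Rightarrow> bool) \<Rightarrow> bool" where
  "for_most_small P \<longleftrightarrow>
     (\<exists>E :: real \<Rightarrow> real set.
        (\<forall>\<^sub>F \<epsilon>0 in at_right 0.
           E \<epsilon>0 \<in> sets lebesgue \<and> E \<epsilon>0 \<subseteq> {0<..<\<epsilon>0} \<and> measure lebesgue (E \<epsilon>0) > 0 \<and>
           (\<forall>\<epsilon>\<in>E \<epsilon>0. P \<epsilon>)) \<and>
        ((\<lambda>\<epsilon>0. measure lebesgue (E \<epsilon>0) / \<epsilon>0) \<longlongrightarrow> 1) (at_right 0))"

end

theory Submission
  imports Defs "HOL-Complex_Analysis.Complex_Analysis" "HOL-Real_Asymp.Real_Asymp"
begin

text \<open>
  Instead of solving for the rotation number at a given \<open>\<epsilon>\<close>, fix the rotation number \<open>\<Omega>\<close> and look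
  for \<open>\<epsilon>\<close> together with a quasi-periodic solution \<open>z = i\<Omega> + w\<close>, \<open>w\<close> of mean zero, of the Riccati
  equation \<open>z' + z\<^sup>2 + \<epsilon>a = 0\<close>.  Its linearization is a scalar first-order equation, which an
  integrating factor reduces to the constant-coefficient operators \<open>d/dt\<close> and \<open>d/dt + 2i\<Omega>\<close>.  Hence
  Newton's method converges as soon as \<open>\<Omega>\<close> is small and \<open>\<bar>\<langle>k,\<omega>\<rangle> + 2\<Omega>\<bar> \<ge> c / \<bar>k\<bar>\<^sup>N\<close> for all \<open>k \<noteq> 0\<close>.
  The set of admissible \<open>\<Omega>\<close> is thus fixed in advance and no parameter is excluded during the iteration.

  Taking the time average of \<open>(ln (z\<^sub>2 - cnj z\<^sub>1))'\<close> for two such solutions gives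
  \<open>\<Omega>\<^sub>2\<^sup>2 - \<Omega>\<^sub>1\<^sup>2 = (\<epsilon>\<^sub>2 - cnj \<epsilon>\<^sub>1) (abar + O (\<Omega>\<^sub>1 + \<Omega>\<^sub>2))\<close>.  For \<open>z\<^sub>1 = z\<^sub>2\<close> this says that \<open>\<epsilon>\<close> is real; for
  distinct solutions it says that \<open>\<Omega>\<^sup>2 \<mapsto> \<epsilon>\<close> is bi-Lipschitz, so the exceptional \<open>\<epsilon>\<close> have small
  measure because the exceptional \<open>\<Omega>\<close> do.  Stability follows since \<open>Im z\<close> is bounded below by a
  positive constant.
\<close>

subsection \<open>Exponential series\<close>

text \<open>The obstacle is that inverting d/dt + 2i\<Omega> on constants costs 1/(2\<Omega>), which
  blows up in the very limit of interest. The constant mode is therefore never divided by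
  2i\<Omega>. All other modes have divisors bounded below independently of \<Omega>, and each Newton
  step keeps two unknowns: an additive constant and the correction of \<epsilon>. Two scalar
  equations determine them, the balance of the constant mode and the vanishing mean of the
  correction of w. Up to sign their determinant stays close to abar, so abar > 0 is the
  nondegeneracy condition and the bounds are uniform in \<Omega>. The vanishing mean also keeps a
  quasi-periodic primitive U of w available, hence the integrating factor exp (2U). Few \<Omega> are
  lost because a resonance at small \<Omega> needs a small \<langle>k,\<omega>\<rangle>, hence by
  the Diophantine condition a large |k|, where the excluded zone is thin. With N large enough, the
  values of \<open>\<Omega>\<^sup>2\<close> lost below s0 have total length
  O(\<open>s0 * sqrt s0\<close>), a vanishing fraction of s0.\<close>

locale frequency_module =
  fixes \<phi> :: "'k::ab_group_add \<Rightarrow> real" and \<l> :: "'k \<Rightarrow> real"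
  assumes freq_add: "\<phi> (k + l) = \<phi> k + \<phi> l"
    and weight_triangle: "\<l> (k + l) \<le> \<l> k + \<l> l"
    and weight_zero [simp]: "\<l> 0 = 0"
    and weight_ge_1: "k \<noteq> 0 \<Longrightarrow> \<l> k \<ge> 1"
begin

lemma freq_zero [simp]: "\<phi> 0 = 0"
  using freq_add[of 0 0] by simp

lemma weight_nonneg [simp]: "\<l> k \<ge> 0"
  using weight_ge_1[of k] by (cases "k = 0") auto

text \<open>The exponents \<open>\<kappa> n\<close> need not be distinct, so products and countable sums
  of such series require no regrouping of terms.\<close>

definition qp :: "real \<Rightarrow> real \<Rightarrow> (real \<Rightarrow> complex) \<Rightarrow> bool" where
  "qp \<sigma> B f \<longleftrightarrow> (\<exists>c \<kappa> b.
     ((\<lambda>n::nat. norm (c n) * exp (\<sigma> * \<l> (\<kappa> n))) has_sum b) UNIV \<and> b \<le> B \<and>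
     (\<forall>t. ((\<lambda>n. c n * cis (\<phi> (\<kappa> n) * t)) has_sum f t) UNIV))"

lemma qpI:
  assumes "((\<lambda>n::nat. norm (c n) * exp (\<sigma> * \<l> (\<kappa> n))) has_sum b) UNIV" "b \<le> B"
    "\<And>t. ((\<lambda>n. c n * cis (\<phi> (\<kappa> n) * t)) has_sum f t) UNIV"
  shows "qp \<sigma> B f"
  unfolding qp_def using assms by blast

lemma qp_mono:
  assumes "qp \<sigma> B f" "\<sigma>' \<le> \<sigma>" "B \<le> B'"
  shows "qp \<sigma>' B' f"
proof -
  from assms(1) obtain c \<kappa> b where
    1: "((\<lambda>n::nat. norm (c n) * exp (\<sigma> * \<l> (\<kappa> n))) has_sum b) UNIV" and b: "b \<le> B" and
    2: "\<And>t. ((\<lambda>n. c n * cis (\<phi> (\<kappa> n) * t)) has_sum f t) UNIV"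
    unfolding qp_def by blast
  have le: "norm (c n) * exp (\<sigma>' * \<l> (\<kappa> n)) \<le> norm (c n) * exp (\<sigma> * \<l> (\<kappa> n))" for n
    using assms(2) by (auto intro!: mult_left_mono mult_right_mono)
  have s: "(\<lambda>n. norm (c n) * exp (\<sigma>' * \<l> (\<kappa> n))) summable_on UNIV"
    by (rule summable_on_comparison_test[OF has_sum_imp_summable[OF 1]]) (use le in auto)
  then obtain b' where b': "((\<lambda>n. norm (c n) * exp (\<sigma>' * \<l> (\<kappa> n))) has_sum b') UNIV"
    by (auto simp: summable_on_def)
  have "b' \<le> b"
    by (rule has_sum_mono[OF b' 1]) (use le in auto)
  then show ?thesis
    using b' b 2 assms(3) by (intro qpI[of c \<sigma>' \<kappa> b']) auto
qed

lemma qp_nonneg: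
  assumes "qp \<sigma> B f"
  shows "0 \<le> B"
proof -
  from assms obtain c :: "nat \<Rightarrow> complex" and \<kappa> b where
    1: "((\<lambda>n::nat. norm (c n) * exp (\<sigma> * \<l> (\<kappa> n))) has_sum b) UNIV" and b: "b \<le> B"
    unfolding qp_def by blast
  have "0 \<le> b" by (rule has_sum_nonneg[OF 1]) auto
  with b show ?thesis by simp
qed

lemma qp_norm_le:
  assumes "qp \<sigma> B f" "0 \<le> \<sigma>"
  shows "norm (f t) \<le> B"
proof -
  from qp_mono[OF assms(1,2) order_refl] obtain c \<kappa> b where
    1: "((\<lambda>n::nat. norm (c n)) has_sum b) UNIV" and b: "b \<le> B" and
    2: "\<And>t. ((\<lambda>n. c n * cis (\<phi> (\<kappa> n) * t)) has_sum f t) UNIV"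
    unfolding qp_def by auto
  have "norm (f t) \<le> b"
    by (rule norm_has_sum_bound[OF _ 2]) (use 1 in \<open>simp add: norm_mult\<close>)
  with b show ?thesis by simp
qed

text \<open>The source of the closure properties: sums, products and the exponential are all
  countable sums of simpler series. Weighted absolute convergence allows the double family of terms
  to be enumerated by \<open>prod_decode\<close>.\<close>

lemma qp_sums:
  assumes f: "\<And>n::nat. qp \<sigma> (B n) (f n)" and B: "B sums S"
    and g: "\<And>t. (\<lambda>n. f n t) sums g t" and \<sigma>: "\<sigma> \<ge> 0"
  shows "qp \<sigma> S g"
proof -
  have "\<forall>n. \<exists>c \<kappa> b.
     ((\<lambda>n::nat. norm (c n) * exp (\<sigma> * \<l> (\<kappa> n))) has_sum b) UNIV \<and> b \<le> B n \<and>
     (\<forall>t. ((\<lambda>n. c n * cis (\<phi> (\<kappa> n) * t)) has_sum f n t) UNIV)"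
    using f unfolding qp_def by blast
  then obtain c \<kappa> b where
    1: "\<And>n. ((\<lambda>i::nat. norm (c n i) * exp (\<sigma> * \<l> (\<kappa> n i))) has_sum b n) UNIV" and
    b: "\<And>n. b n \<le> B n" and
    2: "\<And>n t. ((\<lambda>i. c n i * cis (\<phi> (\<kappa> n i) * t)) has_sum f n t) UNIV"
    unfolding choice_iff by blast
  have b0: "0 \<le> b n" for n by (rule has_sum_nonneg[OF 1]) auto
  have sb: "summable b"
    by (rule summable_comparison_test'[OF sums_summable[OF B], of 0]) (use b b0 in auto)
  have sb': "b summable_on UNIV"
    using sb b0 by (intro summable_nonneg_imp_summable_on) auto
  have sB: "suminf b \<le> S"
    using suminf_le[OF b sb sums_summable[OF B]] B by (simp add: sums_iff)
  have hb: "(b has_sum suminf b) UNIV"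
    using sb b0 by (intro sums_nonneg_imp_has_sum) (auto simp: summable_sums)
  have sSig: "(\<lambda>(n,i). norm (c n i) * exp (\<sigma> * \<l> (\<kappa> n i))) summable_on (UNIV \<times> UNIV)"
    by (rule summable_on_SigmaI[where g = b]) (use 1 sb' in auto)
  have A: "((\<lambda>(n,i). norm (c n i) * exp (\<sigma> * \<l> (\<kappa> n i))) has_sum suminf b) (UNIV \<times> UNIV)"
    by (rule has_sum_SigmaI[where g = b]) (use 1 hb sSig in auto)
  have C: "((\<lambda>(n,i). c n i * cis (\<phi> (\<kappa> n i) * t)) has_sum g t) (UNIV \<times> UNIV)" for t
  proof (rule has_sum_SigmaI[where g = "\<lambda>n. f n t"])
    have "norm (f n t) \<le> B n" for n using qp_norm_le[OF f \<sigma>] .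
    then have "summable (\<lambda>n. norm (f n t))"
      by (intro summable_comparison_test'[OF sums_summable[OF B], of 0]) auto
    then show "((\<lambda>n. f n t) has_sum g t) UNIV"
      using g by (intro norm_summable_imp_has_sum) auto
    have "(\<lambda>x. norm (case x of (n,i) \<Rightarrow> c n i * cis (\<phi> (\<kappa> n i) * t))) summable_on (UNIV \<times> UNIV)"
    proof (rule summable_on_comparison_test[OF sSig])
      fix x :: "nat \<times> nat"
      obtain n i where x: "x = (n, i)" by fastforce
      have "norm (c n i) * 1 \<le> norm (c n i) * exp (\<sigma> * \<l> (\<kappa> n i))"
        using \<sigma> by (intro mult_left_mono) auto
      then show "norm (case x of (n,i) \<Rightarrow> c n i * cis (\<phi> (\<kappa> n i) * t))
          \<le> (case x of (n,i) \<Rightarrow> norm (c n i) * exp (\<sigma> * \<l> (\<kappa> n i)))"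
        by (simp add: x norm_mult)
    qed auto
    then show "(\<lambda>(n,i). c n i * cis (\<phi> (\<kappa> n i) * t)) summable_on (UNIV \<times> UNIV)"
      by (rule abs_summable_summable)
  qed (use 2 in auto)
  have bij: "bij_betw prod_decode UNIV (UNIV \<times> UNIV)"
    using bij_prod_decode by simp
  show ?thesis
  proof (rule qpI)
    show "((\<lambda>m. norm (case prod_decode m of (n,i) \<Rightarrow> c n i) *
        exp (\<sigma> * \<l> (case prod_decode m of (n,i) \<Rightarrow> \<kappa> n i))) has_sum suminf b) UNIV"
      using A unfolding has_sum_reindex_bij_betw[OF bij, symmetric] by (simp add: case_prod_unfold)
    show "((\<lambda>m. (case prod_decode m of (n,i) \<Rightarrow> c n i) *
        cis (\<phi> (case prod_decode m of (n,i) \<Rightarrow> \<kappa> n i) * t)) has_sum g t) UNIV" for t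
      using C[of t] unfolding has_sum_reindex_bij_betw[OF bij, symmetric] by (simp add: case_prod_unfold)
  qed (rule sB)
qed

lemma qp_monom: "qp \<sigma> (norm z * exp (\<sigma> * \<l> k)) (\<lambda>t. z * cis (\<phi> k * t))"
proof (rule qpI)
  show "((\<lambda>n::nat. norm (if n = 0 then z else 0) * exp (\<sigma> * \<l> k)) has_sum norm z * exp (\<sigma> * \<l> k)) UNIV"
    by (rule has_sum_finite_neutralI[of "{0}"]) auto
  show "((\<lambda>n::nat. (if n = 0 then z else 0) * cis (\<phi> k * t)) has_sum z * cis (\<phi> k * t)) UNIV" for t
    by (rule has_sum_finite_neutralI[of "{0}"]) auto
qed auto

lemma qp_const: "qp \<sigma> (norm z) (\<lambda>t. z)"
  using qp_monom[of \<sigma> z 0] by simp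

text \<open>The triangle inequality for \<open>\<l>\<close> makes the weight
  \<open>exp (\<sigma> * \<l> k)\<close> submultiplicative; the product bound of
  \<open>qp_mult\<close> rests on this.\<close>

lemma qp_monom_mult:
  assumes "qp \<sigma> B f" "\<sigma> \<ge> 0"
  shows "qp \<sigma> (norm z * exp (\<sigma> * \<l> k) * B) (\<lambda>t. z * cis (\<phi> k * t) * f t)"
proof -
  from assms(1) obtain c \<kappa> b where
    1: "((\<lambda>n::nat. norm (c n) * exp (\<sigma> * \<l> (\<kappa> n))) has_sum b) UNIV" and b: "b \<le> B" and
    2: "\<And>t. ((\<lambda>n. c n * cis (\<phi> (\<kappa> n) * t)) has_sum f t) UNIV"
    unfolding qp_def by blast
  define w where "w = norm z * exp (\<sigma> * \<l> k)"
  have w0: "w \<ge> 0" by (simp add: w_def)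
  have hs: "((\<lambda>n. w * (norm (c n) * exp (\<sigma> * \<l> (\<kappa> n)))) has_sum w * b) UNIV"
    by (rule has_sum_cmult_right[OF 1])
  have le: "norm (z * c n) * exp (\<sigma> * \<l> (k + \<kappa> n)) \<le> w * (norm (c n) * exp (\<sigma> * \<l> (\<kappa> n)))" for n
  proof -
    have "\<sigma> * \<l> (k + \<kappa> n) \<le> \<sigma> * \<l> k + \<sigma> * \<l> (\<kappa> n)"
      using mult_left_mono[OF weight_triangle assms(2)] by (simp add: distrib_left)
    then have "exp (\<sigma> * \<l> (k + \<kappa> n)) \<le> exp (\<sigma> * \<l> k) * exp (\<sigma> * \<l> (\<kappa> n))"
      by (simp flip: exp_add)
    from mult_left_mono[OF this, of "norm z * norm (c n)"] show ?thesis
      by (simp add: w_def norm_mult mult_ac)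
  qed
  have s: "(\<lambda>n. norm (z * c n) * exp (\<sigma> * \<l> (k + \<kappa> n))) summable_on UNIV"
    by (rule summable_on_comparison_test[OF has_sum_imp_summable[OF hs]]) (use le in auto)
  then obtain b' where b': "((\<lambda>n. norm (z * c n) * exp (\<sigma> * \<l> (k + \<kappa> n))) has_sum b') UNIV"
    by (auto simp: summable_on_def)
  have "b' \<le> w * b"
    by (rule has_sum_mono[OF b' hs]) (use le in auto)
  also have "\<dots> \<le> w * B" using b w0 by (rule mult_left_mono)
  finally have "b' \<le> w * B" .
  moreover have "((\<lambda>n. (z * c n) * cis (\<phi> (k + \<kappa> n) * t)) has_sum z * cis (\<phi> k * t) * f t) UNIV" for t
  proof -
    have "(z * c n) * cis (\<phi> (k + \<kappa> n) * t) = z * cis (\<phi> k * t) * (c n * cis (\<phi> (\<kappa> n) * t))" for n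
    proof -
      have "cis (\<phi> (k + \<kappa> n) * t) = cis (\<phi> k * t) * cis (\<phi> (\<kappa> n) * t)"
        by (simp add: freq_add distrib_right cis_mult)
      then show ?thesis by simp
    qed
    then show ?thesis
      using has_sum_cmult_right[OF 2[of t], of "z * cis (\<phi> k * t)"] by (simp only:)
  qed
  ultimately show ?thesis
    using b' unfolding w_def by (intro qpI[of "\<lambda>n. z * c n" \<sigma> "\<lambda>n. k + \<kappa> n" b']) auto
qed

lemma qp_scale:
  assumes "qp \<sigma> B f" "\<sigma> \<ge> 0"
  shows "qp \<sigma> (norm z * B) (\<lambda>t. z * f t)"
  using qp_monom_mult[OF assms, of z 0] by simp

lemma qp_uminus:
  assumes "qp \<sigma> B f" "\<sigma> \<ge> 0"
  shows "qp \<sigma> B (\<lambda>t. - f t)"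
  using qp_scale[OF assms, of "-1"] by simp

lemma qp_add:
  assumes "qp \<sigma> B f" "qp \<sigma> C g" "\<sigma> \<ge> 0"
  shows "qp \<sigma> (B + C) (\<lambda>t. f t + g t)"
proof (rule qp_sums[where f = "\<lambda>n. if n = 0 then f else if n = 1 then g else (\<lambda>t. 0)"
        and B = "\<lambda>n. if n = 0 then B else if n = 1 then C else 0"])
  show "qp \<sigma> (if n = 0 then B else if n = 1 then C else 0)
     (if n = 0 then f else if n = 1 then g else (\<lambda>t. 0))" for n :: nat
    using assms qp_const[of \<sigma> 0] by auto
  have "(\<lambda>n::nat. if n = 0 then B else if n = 1 then C else 0) sums
      (\<Sum>n\<in>{0,1::nat}. if n = 0 then B else if n = 1 then C else 0)"
    by (rule sums_finite) auto
  then show "(\<lambda>n::nat. if n = 0 then B else if n = 1 then C else 0) sums (B + C)" by simp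
  fix t
  have "(\<lambda>n::nat. (if n = 0 then f else if n = 1 then g else (\<lambda>t. 0)) t) sums
      (\<Sum>n\<in>{0,1::nat}. (if n = 0 then f else if n = 1 then g else (\<lambda>t. 0)) t)"
    by (rule sums_finite) auto
  then show "(\<lambda>n::nat. (if n = 0 then f else if n = 1 then g else (\<lambda>t. 0)) t) sums (f t + g t)" by simp
qed (rule assms)

lemma qp_diff:
  assumes "qp \<sigma> B f" "qp \<sigma> C g" "\<sigma> \<ge> 0"
  shows "qp \<sigma> (B + C) (\<lambda>t. f t - g t)"
  using qp_add[OF assms(1) qp_uminus[OF assms(2,3)] assms(3)] by simp

lemma qp_mult:
  assumes "qp \<sigma> B f" "qp \<sigma> C g" "\<sigma> \<ge> 0"
  shows "qp \<sigma> (B * C) (\<lambda>t. f t * g t)"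
proof -
  from assms(1) obtain c \<kappa> b where
    1: "((\<lambda>n::nat. norm (c n) * exp (\<sigma> * \<l> (\<kappa> n))) has_sum b) UNIV" and b: "b \<le> B" and
    2: "\<And>t. ((\<lambda>n. c n * cis (\<phi> (\<kappa> n) * t)) has_sum f t) UNIV"
    unfolding qp_def by blast
  have C: "C \<ge> 0" using assms(2) by (rule qp_nonneg)
  have "qp \<sigma> (b * C) (\<lambda>t. f t * g t)"
  proof (rule qp_sums)
    show "qp \<sigma> (norm (c n) * exp (\<sigma> * \<l> (\<kappa> n)) * C) (\<lambda>t. c n * cis (\<phi> (\<kappa> n) * t) * g t)" for n
      by (rule qp_monom_mult[OF assms(2,3)])
    show "(\<lambda>n. norm (c n) * exp (\<sigma> * \<l> (\<kappa> n)) * C) sums (b * C)"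
      by (rule sums_mult2[OF has_sum_imp_sums[OF 1]])
    show "(\<lambda>n. c n * cis (\<phi> (\<kappa> n) * t) * g t) sums (f t * g t)" for t
      by (rule sums_mult2[OF has_sum_imp_sums[OF 2]])
  qed (rule assms)
  then show ?thesis
    by (rule qp_mono) (use b C in \<open>auto intro: mult_right_mono\<close>)
qed

lemma qp_power:
  assumes "qp \<sigma> B f" "\<sigma> \<ge> 0"
  shows "qp \<sigma> (B ^ n) (\<lambda>t. f t ^ n)"
proof (induction n)
  case 0
  show ?case using qp_const[of \<sigma> 1] by simp
next
  case (Suc n)
  show ?case using qp_mult[OF assms(1) Suc assms(2)] by simp
qed

text \<open>The constant 1 is split off so that the bound tends to 0 with \<open>B\<close>: the
  Newton step needs an integrating factor close to 1, not merely a bounded one.\<close>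

lemma qp_exp_minus_1:
  assumes "qp \<sigma> B f" "\<sigma> \<ge> 0"
  shows "qp \<sigma> (exp B - 1) (\<lambda>t. exp (f t) - 1)"
proof (rule qp_sums)
  show "qp \<sigma> (norm (inverse (fact (Suc n)) :: complex) * B ^ Suc n)
      (\<lambda>t. inverse (fact (Suc n)) * f t ^ Suc n)" for n
    by (intro qp_scale qp_power assms)
  show "(\<lambda>n. inverse (fact (Suc n)) * f t ^ Suc n) sums (exp (f t) - 1)" for t
    using exp_converges[of "f t"] by (subst sums_Suc_iff) (simp add: scaleR_conv_of_real)
  show "(\<lambda>n. norm (inverse (fact (Suc n)) :: complex) * B ^ Suc n) sums (exp B - 1)"
  proof -
    have "(\<lambda>n. inverse (fact n) * B ^ n) sums exp B"
      using exp_converges[of B] by (simp add: scaleR_conv_of_real)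
    then have "(\<lambda>n. inverse (fact (Suc n)) * B ^ Suc n) sums (exp B - 1)"
      by (subst sums_Suc_iff) simp
    moreover have "norm (inverse (fact (Suc n)) :: complex) = inverse (fact (Suc n))" for n
      by (metis norm_fact norm_inverse)
    ultimately show ?thesis by (simp only:)
  qed
qed (rule assms)

end

subsection \<open>Small divisors and time averages\<close>

lemma uniform_limit_has_vector_derivative:
  fixes f f' :: "nat \<Rightarrow> real \<Rightarrow> 'a::banach"
  assumes f': "\<And>n t. (f n has_vector_derivative f' n t) (at t)"
    and lim: "\<And>t. (\<lambda>n. f n t) \<longlonglongrightarrow> F t" and ul: "uniform_limit UNIV f' G sequentially"
  shows "(F has_vector_derivative G t) (at t)"
proof -
  have "\<exists>g. \<forall>x\<in>UNIV. (\<lambda>n. f n x) \<longlonglongrightarrow> g x \<and> (g has_derivative (\<lambda>h. h *\<^sub>R G x)) (at x within UNIV)"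
  proof (rule has_derivative_sequence[where f' = "\<lambda>n x h. h *\<^sub>R f' n x"])
    show "(f n has_derivative (\<lambda>h. h *\<^sub>R f' n x)) (at x within UNIV)" for n x
      using f' by (simp add: has_vector_derivative_def)
    show "\<forall>\<^sub>F n in sequentially. \<forall>x\<in>UNIV. \<forall>h. norm (h *\<^sub>R f' n x - h *\<^sub>R G x) \<le> e * norm h"
      if "e > 0" for e
      using uniform_limitD[OF ul that]
    proof eventually_elim
      case (elim n)
      show ?case
      proof (intro ballI allI)
        fix x h :: real
        have "norm (f' n x - G x) \<le> e"
          using elim by (auto simp: dist_norm intro: less_imp_le)
        then have "\<bar>h\<bar> * norm (f' n x - G x) \<le> \<bar>h\<bar> * e"
          by (intro mult_left_mono) auto
        then show "norm (h *\<^sub>R f' n x - h *\<^sub>R G x) \<le> e * norm h"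
          by (simp add: mult.commute flip: scaleR_diff_right)
      qed
    qed
  qed (auto intro: lim)
  then obtain g where g: "\<And>x. (\<lambda>n. f n x) \<longlonglongrightarrow> g x" "\<And>x. (g has_derivative (\<lambda>h. h *\<^sub>R G x)) (at x)"
    by auto
  have "g = F" using LIMSEQ_unique[OF g(1) lim] by auto
  with g(2) show ?thesis by (auto simp: has_vector_derivative_def)
qed

lemma series_has_vector_derivative:
  fixes f f' :: "nat \<Rightarrow> real \<Rightarrow> 'a::banach"
  assumes f': "\<And>n t. (f n has_vector_derivative f' n t) (at t)"
    and M: "\<And>n t. norm (f' n t) \<le> M n" "summable M"
    and F: "\<And>t. (\<lambda>n. f n t) sums F t" and G: "\<And>t. (\<lambda>n. f' n t) sums G t"
  shows "(F has_vector_derivative G t) (at t)"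
proof (rule uniform_limit_has_vector_derivative)
  have "uniform_limit UNIV (\<lambda>n t. \<Sum>i<n. f' i t) (\<lambda>t. \<Sum>i. f' i t) sequentially"
    by (rule Weierstrass_m_test) (use M in auto)
  moreover have "(\<lambda>t. \<Sum>i. f' i t) = G" using G by (auto simp: sums_iff)
  ultimately show "uniform_limit UNIV (\<lambda>n t. \<Sum>i<n. f' i t) G sequentially" by simp
  show "((\<lambda>t. \<Sum>i<n. f i t) has_vector_derivative (\<Sum>i<n. f' i t)) (at t)" for n t
    by (auto intro!: derivative_eq_intros f')
  show "(\<lambda>n. \<Sum>i<n. f i t) \<longlonglongrightarrow> F t" for t
    using F by (simp add: sums_def)
qed

text \<open>One term of the exponential series is at most the whole. With
  \<open>x = d * \<l> k\<close> this pays for a small divisor \<open>c / \<l> k ^ N\<close> by a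
  loss \<open>d\<close> of strip width, at the price \<open>fact N / c / d ^ N\<close>.\<close>

lemma power_le_fact_mult_exp:
  fixes x :: real
  assumes "x \<ge> 0"
  shows "x ^ n \<le> fact n * exp x"
proof -
  have s: "(\<lambda>n. inverse (fact n) * x ^ n) sums exp x"
    using exp_converges[of x] by (simp add: scaleR_conv_of_real)
  have "(\<Sum>i\<in>{n}. inverse (fact i) * x ^ i) \<le> (\<Sum>i. inverse (fact i) * x ^ i)"
    by (rule sum_le_suminf) (use s assms in \<open>auto simp: sums_iff\<close>)
  then have "inverse (fact n) * x ^ n \<le> exp x" using s by (simp add: sums_iff)
  then show ?thesis by (simp add: field_simps)
qed

text \<open>A bounded primitive of \<open>f - m\<close> forces \<open>m\<close> to be the time average of \<open>f\<close>.\<close>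

definition mean :: "(real \<Rightarrow> complex) \<Rightarrow> complex \<Rightarrow> bool" where
  "mean f m \<longleftrightarrow> (\<exists>q. bounded (range q) \<and> (\<forall>t. (q has_vector_derivative f t - m) (at t)))"

text \<open>If the derivative stays within \<open>e\<close> of \<open>c\<close>, then
  \<open>Y\<close> drifts by at least \<open>norm c - e\<close> per unit of time, which a bounded
  function cannot sustain unless this rate is nonpositive.\<close>

lemma bounded_primitive_norm_le:
  fixes Y :: "real \<Rightarrow> complex"
  assumes "bounded (range Y)" "\<And>t. (Y has_vector_derivative Y' t) (at t)"
    and "\<And>t. norm (Y' t - c) \<le> e"
  shows "norm c \<le> e"
proof (rule ccontr)
  assume "\<not> norm c \<le> e"
  then have ce: "norm c - e > 0" by simp
  obtain B where B: "\<And>t. norm (Y t) \<le> B"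
    using assms(1) by (auto simp: bounded_iff)
  \<comment> \<open>Chosen so that the drift over \<open>{0..T}\<close> is \<open>2 * B + 1\<close>,
    more than the variation \<open>2 * B\<close> that the bound allows.\<close>
  define T where "T = (2 * B + 1) / (norm c - e)"
  have "B \<ge> 0" using order_trans[OF norm_ge_zero B[of 0]] .
  then have T: "T > 0" using ce by (simp add: T_def)
  have d: "((\<lambda>t. Y t - t *\<^sub>R c) has_vector_derivative (Y' t - c)) (at t within {0..T})" for t
    by (auto intro!: derivative_eq_intros has_vector_derivative_at_within[OF assms(2)])
  have "norm ((Y T - T *\<^sub>R c) - (Y 0 - 0 *\<^sub>R c)) \<le> e * norm (T - 0)"
  proof (rule differentiable_bound[where S = "{0..T}" and f' = "\<lambda>t h. h *\<^sub>R (Y' t - c)"])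
    show "((\<lambda>t. Y t - t *\<^sub>R c) has_derivative (\<lambda>h. h *\<^sub>R (Y' t - c))) (at t within {0..T})" for t
      using d by (simp add: has_vector_derivative_def)
    show "onorm (\<lambda>h. h *\<^sub>R (Y' t - c)) \<le> e" for t
    proof (rule onorm_le)
      show "norm (h *\<^sub>R (Y' t - c)) \<le> e * norm h" for h
        using mult_left_mono[OF assms(3)[of t], of "\<bar>h\<bar>"] by (simp add: mult.commute)
    qed
  qed (use T in auto)
  then have 1: "norm (Y T - T *\<^sub>R c - Y 0) \<le> e * T" using T by simp
  have "T * norm c = norm ((Y T - Y 0) - (Y T - T *\<^sub>R c - Y 0))" using T by simp
  also have "\<dots> \<le> norm (Y T) + norm (Y 0) + norm (Y T - T *\<^sub>R c - Y 0)"
    using norm_triangle_ineq4[of "Y T - Y 0" "Y T - T *\<^sub>R c - Y 0"] norm_triangle_ineq4[of "Y T" "Y 0"]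
    by linarith
  also have "\<dots> \<le> 2 * B + e * T" using B[of T] B[of 0] 1 by linarith
  finally have "T * (norm c - e) \<le> 2 * B" by (simp add: algebra_simps)
  moreover have "T * (norm c - e) = 2 * B + 1" using ce by (simp add: T_def)
  ultimately show False by linarith
qed

lemma mean_norm_le:
  assumes "mean f m" "\<And>t. norm (f t) \<le> B"
  shows "norm m \<le> B"
proof -
  from assms(1) obtain q where q: "bounded (range q)" "\<And>t. (q has_vector_derivative f t - m) (at t)"
    by (auto simp: mean_def)
  have "norm (-m) \<le> B"
    by (rule bounded_primitive_norm_le[OF q]) (use assms(2) in auto)
  then show ?thesis by simp
qed

lemma bounded_range_cmult:
  fixes f :: "'b \<Rightarrow> 'a::real_normed_algebra"
  assumes "bounded (range f)"
  shows "bounded (range (\<lambda>x. c * f x))"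
proof -
  obtain B where "\<And>x. norm (f x) \<le> B" using assms by (auto simp: bounded_iff)
  then have "norm (c * f x) \<le> norm c * B" for x
    by (intro order_trans[OF norm_mult_ineq] mult_left_mono) auto
  then show ?thesis by (auto simp: bounded_iff)
qed

lemma mean_add:
  assumes "mean f m" "mean g n"
  shows "mean (\<lambda>t. f t + g t) (m + n)"
proof -
  from assms obtain p q where
    p: "bounded (range p)" "\<And>t. (p has_vector_derivative f t - m) (at t)" and
    q: "bounded (range q)" "\<And>t. (q has_vector_derivative g t - n) (at t)"
    unfolding mean_def by blast
  have "((\<lambda>t. p t + q t) has_vector_derivative (f t + g t) - (m + n)) (at t)" for t
    by (auto intro!: derivative_eq_intros p q)
  with bounded_plus_comp[OF p(1) q(1)] show ?thesis
    unfolding mean_def by blast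
qed

lemma mean_cmult:
  assumes "mean f m"
  shows "mean (\<lambda>t. c * f t) (c * m)"
proof -
  from assms obtain p where
    p: "bounded (range p)" "\<And>t. (p has_vector_derivative f t - m) (at t)"
    unfolding mean_def by blast
  have "((\<lambda>t. c * p t) has_vector_derivative c * f t - c * m) (at t)" for t
    by (auto intro!: derivative_eq_intros p simp: algebra_simps)
  with bounded_range_cmult[OF p(1)] show ?thesis
    unfolding mean_def by blast
qed

lemma mean_const: "mean (\<lambda>t. c) c"
  unfolding mean_def by (rule exI[of _ "\<lambda>t. 0"]) auto

context frequency_module
begin

text \<open>The equation is solved mode by mode, leaving the constant mode \<open>m\<close> on the
  right-hand side. The value \<open>m\<close> is fixed before \<open>\<mu>\<close> and depends only
  on the chosen expansion of \<open>f\<close>, so the solutions for different \<open>\<mu>\<close>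
  share it. One \<open>g\<close> serves every loss \<open>d\<close>, which permits a fine bound for
  the iteration and a coarse one for sup norms.\<close>

lemma qp_solve:
  assumes f: "qp \<sigma> B f" and \<sigma>: "\<sigma> > 0" and c: "c > 0"
  obtains m where "norm m \<le> B"
    and "\<And>\<mu>. (\<And>k. k \<noteq> 0 \<Longrightarrow> \<bar>\<phi> k + \<mu>\<bar> \<ge> c / \<l> k ^ N) \<Longrightarrow>
      \<exists>g. (\<forall>t. (g has_vector_derivative f t - m - \<i> * of_real \<mu> * g t) (at t)) \<and>
          (\<forall>d. 0 < d \<longrightarrow> d \<le> \<sigma> \<longrightarrow> qp (\<sigma> - d) (fact N / c / d ^ N * B) g)"
proof -
  from f obtain a \<kappa> b where
    1: "((\<lambda>n::nat. norm (a n) * exp (\<sigma> * \<l> (\<kappa> n))) has_sum b) UNIV" and b: "b \<le> B" and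
    2: "\<And>t. ((\<lambda>n. a n * cis (\<phi> (\<kappa> n) * t)) has_sum f t) UNIV"
    unfolding qp_def by blast
  have sa: "(\<lambda>n. norm (a n)) summable_on UNIV"
  proof (rule summable_on_comparison_test[OF has_sum_imp_summable[OF 1]])
    show "norm (a n) \<le> norm (a n) * exp (\<sigma> * \<l> (\<kappa> n))" for n
      using mult_left_mono[of 1 "exp (\<sigma> * \<l> (\<kappa> n))" "norm (a n)"] \<sigma> by simp
  qed auto
  \<comment> \<open>Several indices may carry the exponent 0, so the constant mode is itself a
    sum.\<close>
  define a0 where "a0 n = (if \<kappa> n = 0 then a n else 0)" for n
  have le0: "norm (a0 n) \<le> norm (a n)" for n by (simp add: a0_def)
  have sa0: "(\<lambda>n. norm (a0 n)) summable_on UNIV"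
    by (rule summable_on_comparison_test[OF sa]) (use le0 in auto)
  define m where "m = infsum a0 UNIV"
  have m: "(a0 has_sum m) UNIV"
    unfolding m_def using abs_summable_summable[OF sa0] by simp
  have "norm m \<le> b"
  proof (rule order_trans)
    show "norm m \<le> infsum (\<lambda>n. norm (a0 n)) UNIV"
      by (rule norm_has_sum_bound[OF _ m]) (use sa0 in simp)
    have "norm (a0 n) \<le> norm (a n) * exp (\<sigma> * \<l> (\<kappa> n))" for n
      using mult_left_mono[of 1 "exp (\<sigma> * \<l> (\<kappa> n))" "norm (a n)"] \<sigma> le0[of n] by simp
    then show "infsum (\<lambda>n. norm (a0 n)) UNIV \<le> b"
      by (intro has_sum_mono[OF has_sum_infsum[OF sa0] 1])
  qed
  with b have mB: "norm m \<le> B" by simp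
  show ?thesis
  proof (rule that[OF mB])
    fix \<mu> :: real
    assume sd: "\<And>k. k \<noteq> 0 \<Longrightarrow> \<bar>\<phi> k + \<mu>\<bar> \<ge> c / \<l> k ^ N"
    define g0 where "g0 n = (if \<kappa> n = 0 then 0 else a n / (\<i> * of_real (\<phi> (\<kappa> n) + \<mu>)))" for n
    have nz: "\<phi> k + \<mu> \<noteq> 0" if "k \<noteq> 0" for k
    proof -
      have "c / \<l> k ^ N > 0" using c weight_ge_1[OF that] by simp
      with sd[OF that] show ?thesis by auto
    qed
    have g0_le: "norm (g0 n) \<le> norm (a n) * (\<l> (\<kappa> n) ^ N / c)" for n
    proof (cases "\<kappa> n = 0")
      case False
      have "inverse \<bar>\<phi> (\<kappa> n) + \<mu>\<bar> \<le> inverse (c / \<l> (\<kappa> n) ^ N)"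
        using c weight_ge_1[OF False] by (intro le_imp_inverse_le sd False) auto
      then have "norm (a n) * inverse \<bar>\<phi> (\<kappa> n) + \<mu>\<bar> \<le> norm (a n) * (\<l> (\<kappa> n) ^ N / c)"
        by (intro mult_left_mono) auto
      moreover have "norm (g0 n) = norm (a n) * inverse \<bar>\<phi> (\<kappa> n) + \<mu>\<bar>"
        unfolding divide_inverse[symmetric]
        using False by (simp add: g0_def norm_divide norm_mult del: of_real_add)
      ultimately show ?thesis by simp
    qed (use c in \<open>auto simp: g0_def\<close>)
    have loss: "norm (g0 n) * exp ((\<sigma> - d) * \<l> (\<kappa> n)) \<le> (fact N / c / d ^ N) * (norm (a n) * exp (\<sigma> * \<l> (\<kappa> n)))"
      if d: "0 < d" for d n
    proof -
      have "(d * \<l> (\<kappa> n)) ^ N \<le> fact N * exp (d * \<l> (\<kappa> n))"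
        by (rule power_le_fact_mult_exp) (use d in auto)
      then have "\<l> (\<kappa> n) ^ N \<le> fact N / d ^ N * exp (d * \<l> (\<kappa> n))"
        using d by (simp add: power_mult_distrib field_simps)
      then have "\<l> (\<kappa> n) ^ N * exp ((\<sigma> - d) * \<l> (\<kappa> n)) \<le> fact N / d ^ N * exp (d * \<l> (\<kappa> n)) * exp ((\<sigma> - d) * \<l> (\<kappa> n))"
        by (intro mult_right_mono) auto
      also have "\<dots> = fact N / d ^ N * exp (\<sigma> * \<l> (\<kappa> n))"
      proof -
        have "exp (d * \<l> (\<kappa> n)) * exp ((\<sigma> - d) * \<l> (\<kappa> n)) = exp (\<sigma> * \<l> (\<kappa> n))"
          unfolding exp_add[symmetric] by (simp add: algebra_simps)
        then show ?thesis by (simp only: mult.assoc)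
      qed
      finally have *: "\<l> (\<kappa> n) ^ N * exp ((\<sigma> - d) * \<l> (\<kappa> n)) \<le> fact N / d ^ N * exp (\<sigma> * \<l> (\<kappa> n))" .
      have "norm (g0 n) * exp ((\<sigma> - d) * \<l> (\<kappa> n)) \<le> norm (a n) * (\<l> (\<kappa> n) ^ N / c) * exp ((\<sigma> - d) * \<l> (\<kappa> n))"
        using g0_le by (rule mult_right_mono) auto
      also have "\<dots> = norm (a n) / c * (\<l> (\<kappa> n) ^ N * exp ((\<sigma> - d) * \<l> (\<kappa> n)))" by simp
      also have "\<dots> \<le> norm (a n) / c * (fact N / d ^ N * exp (\<sigma> * \<l> (\<kappa> n)))"
        using * c by (intro mult_left_mono) auto
      finally show ?thesis by (simp add: mult_ac)
    qed
    \<comment> \<open>Spending the whole width, \<open>d = \<sigma>\<close>, reduces the weight on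
      the left of \<open>loss\<close> to 1.\<close>
    have sg: "(\<lambda>n. norm (g0 n)) summable_on UNIV"
    proof (rule summable_on_comparison_test)
      show "(\<lambda>n. (fact N / c / \<sigma> ^ N) * (norm (a n) * exp (\<sigma> * \<l> (\<kappa> n)))) summable_on UNIV"
        by (intro summable_on_cmult_right has_sum_imp_summable[OF 1])
      show "norm (g0 n) \<le> (fact N / c / \<sigma> ^ N) * (norm (a n) * exp (\<sigma> * \<l> (\<kappa> n)))" for n
        using loss[OF \<sigma>, of n] by simp
    qed auto
    define g where "g t = infsum (\<lambda>n. g0 n * cis (\<phi> (\<kappa> n) * t)) UNIV" for t
    have g: "((\<lambda>n. g0 n * cis (\<phi> (\<kappa> n) * t)) has_sum g t) UNIV" for t
      unfolding g_def by (rule has_sum_infsum, rule abs_summable_summable) (simp add: norm_mult sg)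
    have qg: "qp (\<sigma> - d) (fact N / c / d ^ N * B) g" if d: "0 < d" "d \<le> \<sigma>" for d
    proof -
      let ?C = "fact N / c / d ^ N"
      have C: "?C \<ge> 0" using c d by auto
      have hs: "((\<lambda>n. ?C * (norm (a n) * exp (\<sigma> * \<l> (\<kappa> n)))) has_sum ?C * b) UNIV"
        by (rule has_sum_cmult_right[OF 1])
      have "(\<lambda>n. norm (g0 n) * exp ((\<sigma> - d) * \<l> (\<kappa> n))) summable_on UNIV"
        by (rule summable_on_comparison_test[OF has_sum_imp_summable[OF hs]]) (use loss[OF d(1)] in auto)
      then obtain b' where b': "((\<lambda>n. norm (g0 n) * exp ((\<sigma> - d) * \<l> (\<kappa> n))) has_sum b') UNIV"
        by (auto simp: summable_on_def)
      have "b' \<le> ?C * b" by (rule has_sum_mono[OF b' hs]) (rule loss[OF d(1)])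
      also have "\<dots> \<le> ?C * B" using b C by (rule mult_left_mono)
      finally show ?thesis using b' g by (intro qpI)
    qed
    have "(g has_vector_derivative f t - m - \<i> * of_real \<mu> * g t) (at t)" for t
    proof (rule series_has_vector_derivative)
      show "((\<lambda>t. g0 n * cis (\<phi> (\<kappa> n) * t)) has_vector_derivative
          (a n * cis (\<phi> (\<kappa> n) * t) - a0 n - \<i> * of_real \<mu> * (g0 n * cis (\<phi> (\<kappa> n) * t)))) (at t)" for n t
      proof (cases "\<kappa> n = 0")
        case False
        have "((\<lambda>t. cis (\<phi> (\<kappa> n) * t)) has_vector_derivative \<i> * of_real (\<phi> (\<kappa> n)) * cis (\<phi> (\<kappa> n) * t)) (at t)"
          unfolding cis_conv_exp
          by (rule derivative_eq_intros field_vector_diff_chain_at[where g = exp, unfolded o_def] | simp)+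
        then have "((\<lambda>t. g0 n * cis (\<phi> (\<kappa> n) * t)) has_vector_derivative g0 n * (\<i> * of_real (\<phi> (\<kappa> n)) * cis (\<phi> (\<kappa> n) * t))) (at t)"
          by (auto intro!: derivative_eq_intros)
        moreover have "a n = \<i> * of_real (\<phi> (\<kappa> n) + \<mu>) * g0 n"
          using False nz[OF False] by (simp add: g0_def del: of_real_add)
        ultimately show ?thesis using False by (simp add: a0_def algebra_simps)
      qed (simp add: g0_def a0_def)
      show "summable (\<lambda>n. norm (a n) + norm (a0 n) + \<bar>\<mu>\<bar> * norm (g0 n))"
        by (rule summable_add[OF summable_add[OF sa[THEN summable_on_imp_summable] sa0[THEN summable_on_imp_summable]]
            summable_mult[OF sg[THEN summable_on_imp_summable]]])
      show "norm (a n * cis (\<phi> (\<kappa> n) * t) - a0 n - \<i> * of_real \<mu> * (g0 n * cis (\<phi> (\<kappa> n) * t)))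
         \<le> norm (a n) + norm (a0 n) + \<bar>\<mu>\<bar> * norm (g0 n)" for n t
      proof -
        have "norm (a n * cis (\<phi> (\<kappa> n) * t) - a0 n - \<i> * of_real \<mu> * (g0 n * cis (\<phi> (\<kappa> n) * t)))
          \<le> norm (a n * cis (\<phi> (\<kappa> n) * t)) + norm (a0 n) + norm (\<i> * of_real \<mu> * (g0 n * cis (\<phi> (\<kappa> n) * t)))"
          using norm_triangle_ineq4[of "a n * cis (\<phi> (\<kappa> n) * t) - a0 n"] norm_triangle_ineq4[of _ "a0 n"]
          by (rule order_trans[OF _ add_right_mono])
        then show ?thesis by (simp add: norm_mult)
      qed
      show "(\<lambda>n. g0 n * cis (\<phi> (\<kappa> n) * t)) sums g t" for t
        by (rule has_sum_imp_sums[OF g])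
      show "(\<lambda>n. a n * cis (\<phi> (\<kappa> n) * t) - a0 n - \<i> * of_real \<mu> * (g0 n * cis (\<phi> (\<kappa> n) * t)))
         sums (f t - m - \<i> * of_real \<mu> * g t)" for t
        by (rule sums_diff[OF sums_diff[OF has_sum_imp_sums[OF 2] has_sum_imp_sums[OF m]]
            sums_mult[OF has_sum_imp_sums[OF g]]])
    qed
    with qg show "\<exists>g. (\<forall>t. (g has_vector_derivative f t - m - \<i> * of_real \<mu> * g t) (at t)) \<and>
          (\<forall>d. 0 < d \<longrightarrow> d \<le> \<sigma> \<longrightarrow> qp (\<sigma> - d) (fact N / c / d ^ N * B) g)"
      by blast
  qed
qed

subsection \<open>The Newton step\<close>

text \<open>The case \<open>\<mu> = 0\<close> of \<open>qp_solve\<close> produces a bounded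
  primitive of \<open>f - m\<close>, which identifies \<open>m\<close> as the time average of
  \<open>f\<close>; the twisted equation is then solved with the same \<open>m\<close>.\<close>

lemma qp_twisted_primitive:
  assumes f: "qp \<sigma> B f" and \<sigma>: "\<sigma> > 0" and c: "c > 0"
    and sd: "\<And>k. k \<noteq> 0 \<Longrightarrow> \<bar>\<phi> k\<bar> \<ge> c / \<l> k ^ N"
      "\<And>k. k \<noteq> 0 \<Longrightarrow> \<bar>\<phi> k + \<mu>\<bar> \<ge> c / \<l> k ^ N"
  obtains m g where "norm m \<le> B" "mean f m"
    "\<And>t. (g has_vector_derivative f t - m - \<i> * of_real \<mu> * g t) (at t)"
    "\<And>d. 0 < d \<Longrightarrow> d \<le> \<sigma> \<Longrightarrow> qp (\<sigma> - d) (fact N / c / d ^ N * B) g"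
proof -
  from qp_solve[OF f \<sigma> c, of N] obtain m where m: "norm m \<le> B"
    and ex: "\<And>\<mu>. (\<And>k. k \<noteq> 0 \<Longrightarrow> \<bar>\<phi> k + \<mu>\<bar> \<ge> c / \<l> k ^ N) \<Longrightarrow>
      \<exists>g. (\<forall>t. (g has_vector_derivative f t - m - \<i> * of_real \<mu> * g t) (at t)) \<and>
          (\<forall>d. 0 < d \<longrightarrow> d \<le> \<sigma> \<longrightarrow> qp (\<sigma> - d) (fact N / c / d ^ N * B) g)"
    by metis
  from ex[of 0] sd obtain g where g: "\<And>t. (g has_vector_derivative f t - m) (at t)"
    and q: "\<And>d. 0 < d \<Longrightarrow> d \<le> \<sigma> \<Longrightarrow> qp (\<sigma> - d) (fact N / c / d ^ N * B) g"
    by auto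
  have "norm (g t) \<le> fact N / c / \<sigma> ^ N * B" for t
    using q[of \<sigma>] \<sigma> by (intro qp_norm_le) auto
  then have "bounded (range g)" by (auto simp: bounded_iff)
  with g have "mean f m" by (auto simp: mean_def)
  with ex[OF sd(2)] that m show ?thesis by blast
qed

lemma qp_primitive:
  assumes f: "qp \<sigma> B f" and \<sigma>: "\<sigma> > 0" and c: "c > 0"
    and sd: "\<And>k. k \<noteq> 0 \<Longrightarrow> \<bar>\<phi> k\<bar> \<ge> c / \<l> k ^ N"
  obtains m g where "norm m \<le> B" "mean f m" "\<And>t. (g has_vector_derivative f t - m) (at t)"
    "\<And>d. 0 < d \<Longrightarrow> d \<le> \<sigma> \<Longrightarrow> qp (\<sigma> - d) (fact N / c / d ^ N * B) g"
proof -
  have sd': "\<bar>\<phi> k + 0\<bar> \<ge> c / \<l> k ^ N" if "k \<noteq> 0" for k using sd[OF that] by simp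
  show ?thesis
    by (rule qp_twisted_primitive[OF f \<sigma> c sd sd', unfolded of_real_0 mult_zero_right mult_zero_left diff_zero]) (assumption | rule that)+
qed

text \<open>With \<open>E = exp (2 * U)\<close> the linearized equation reads
  \<open>(E h)' + 2i\<Omega> E h = - E (\<rho> + \<eta> a)\<close>. Solving for
  \<open>E \<rho>\<close> and \<open>E a\<close> up to their constant modes \<open>m1\<close>,
  \<open>m2\<close> gives \<open>E h = g0 - g1 - \<eta> g2\<close> with \<open>g0\<close> and
  \<open>\<eta>\<close> still free. They are fixed by
  \<open>2i\<Omega> g0 + m1 + \<eta> m2 = 0\<close>, the constant mode, and by
  \<open>g0 n0 - n1 - \<eta> n2 = 0\<close>, the vanishing mean of \<open>h\<close>, which makes
  \<open>u\<close> a primitive of \<open>h\<close> without secular term.\<close>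

lemma newton_step:
  fixes \<Omega> abar :: real and \<epsilon> :: complex
  assumes c: "c > 0"
    and sd: "\<And>k. k \<noteq> 0 \<Longrightarrow> \<bar>\<phi> k\<bar> \<ge> c / \<l> k ^ N"
      "\<And>k. k \<noteq> 0 \<Longrightarrow> \<bar>\<phi> k + 2 * \<Omega>\<bar> \<ge> c / \<l> k ^ N"
    and a: "qp \<sigma> A a" "mean a (of_real abar)" "abar > 0"
    and U: "qp \<sigma> v U" "\<And>t. (U has_vector_derivative w t) (at t)"
    and \<rho>: "qp \<sigma> r \<rho>"
      "\<And>t. (w has_vector_derivative \<rho> t - (2 * \<i> * \<Omega> * w t + (w t)\<^sup>2 + \<epsilon> * a t - \<Omega>\<^sup>2)) (at t)"
    and \<Omega>: "0 < \<Omega>" "\<Omega> \<le> 1"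
    and \<sigma>: "0 < \<sigma>'" "\<sigma>' \<le> \<sigma> - 2 * d" "0 < d"
    and D: "D = fact N / c / d ^ N" "D \<ge> 1"
    and C2: "C2 = fact N / c / \<sigma>' ^ N * (4 * A)"
    and q: "exp (2 * v) - 1 \<le> q" "q \<le> 1/2" "3 * q * A + 2 * \<Omega> * C2 \<le> abar / 2"
    and M: "e1 = 24 / abar" "M = 20 + 4 * C2 * e1 + 4 * A * e1 + e1"
  shows "\<exists>u h \<eta>. qp (\<sigma> - 2 * d) (M * D ^ 3 * r) u \<and> qp (\<sigma> - 2 * d) (M * D ^ 3 * r) h \<and>
     norm \<eta> \<le> M * D ^ 3 * r \<and> (\<forall>t. (u has_vector_derivative h t) (at t)) \<and>
     (\<forall>t. (h has_vector_derivative - (2 * \<i> * \<Omega> * h t + 2 * w t * h t + \<rho> t + \<eta> * a t)) (at t))"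
proof -
  have \<sigma>0: "\<sigma> > 0" "\<sigma> \<ge> 0" "\<sigma> - d > 0" "\<sigma> - d \<ge> 0" "\<sigma> - 2 * d \<ge> 0" "d \<le> \<sigma>" "\<sigma>' \<le> \<sigma>" "\<sigma> - \<sigma>' \<ge> 0"
    using \<sigma> by auto
  have r: "r \<ge> 0" using \<rho>(1) by (rule qp_nonneg)
  have A: "A \<ge> 0" using a(1) by (rule qp_nonneg)
  have "v \<ge> 0" using U(1) by (rule qp_nonneg)
  then have q0: "q \<ge> 0" using q(1) by (smt (verit) one_le_exp_iff)
  have a_le: "norm (a t) \<le> A" for t using qp_norm_le[OF a(1) \<sigma>0(2)] .
  have abar_le: "abar \<le> A"
    using mean_norm_le[OF a(2) a_le] by simp
  define E Em where "E t = exp (2 * U t)" and "Em t = exp (- (2 * U t))" for t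
  have EEm: "E t * Em t = 1" for t by (simp add: E_def Em_def flip: exp_add)
  have U2: "qp \<sigma> (2 * v) (\<lambda>t. 2 * U t)"
    using qp_scale[OF U(1) \<sigma>0(2), of 2] by simp
  have E1: "qp \<sigma> q (\<lambda>t. E t - 1)"
    unfolding E_def by (rule qp_mono[OF qp_exp_minus_1[OF U2 \<sigma>0(2)] order_refl q(1)])
  have Em1: "qp \<sigma> q (\<lambda>t. Em t - 1)"
    unfolding Em_def by (rule qp_mono[OF qp_exp_minus_1[OF qp_uminus[OF U2 \<sigma>0(2)] \<sigma>0(2)] order_refl q(1)])
  have qE: "qp \<sigma> 2 E"
    by (rule qp_mono[OF qp_add[OF E1 qp_const[of \<sigma> 1] \<sigma>0(2), simplified] order_refl]) (use q in simp)
  have qEm: "qp \<sigma> 2 Em"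
    by (rule qp_mono[OF qp_add[OF Em1 qp_const[of \<sigma> 1] \<sigma>0(2), simplified] order_refl]) (use q in simp)
  have E'1: "norm (E t - 1) \<le> q" for t using qp_norm_le[OF E1 \<sigma>0(2)] .
  have Em'1: "norm (Em t - 1) \<le> q" for t using qp_norm_le[OF Em1 \<sigma>0(2)] .
  have Em2: "norm (Em t) \<le> 2" for t using qp_norm_le[OF qEm \<sigma>0(2)] .
  have mu: "\<i> * of_real (2 * \<Omega>) = 2 * \<i> * \<Omega>" by simp
  obtain m1 g1 where m1: "norm m1 \<le> 2 * r" and "mean (\<lambda>t. E t * \<rho> t) m1"
    and g1: "\<And>t. (g1 has_vector_derivative E t * \<rho> t - m1 - 2 * \<i> * \<Omega> * g1 t) (at t)"
    and qg1: "\<And>d. 0 < d \<Longrightarrow> d \<le> \<sigma> \<Longrightarrow> qp (\<sigma> - d) (fact N / c / d ^ N * (2 * r)) g1"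
    by (rule qp_twisted_primitive[OF qp_mult[OF qE \<rho>(1) \<sigma>0(2)] \<sigma>0(1) c sd, unfolded mu]) (assumption | rule that)+
  obtain m2 g2 where "norm m2 \<le> 2 * A" and mean2: "mean (\<lambda>t. E t * a t) m2"
    and g2: "\<And>t. (g2 has_vector_derivative E t * a t - m2 - 2 * \<i> * \<Omega> * g2 t) (at t)"
    and qg2: "\<And>d. 0 < d \<Longrightarrow> d \<le> \<sigma> \<Longrightarrow> qp (\<sigma> - d) (fact N / c / d ^ N * (2 * A)) g2"
    by (rule qp_twisted_primitive[OF qp_mult[OF qE a(1) \<sigma>0(2)] \<sigma>0(1) c sd, unfolded mu]) (assumption | rule that)+
  have qg1d: "qp (\<sigma> - d) (D * (2 * r)) g1" and qg2d: "qp (\<sigma> - d) (D * (2 * A)) g2"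
    using qg1[OF \<sigma>(3) \<sigma>0(6)] qg2[OF \<sigma>(3) \<sigma>0(6)] by (simp_all add: D)
  have qEmd: "qp (\<sigma> - d) 2 Em" using qEm by (rule qp_mono) (use \<sigma> in auto)
  obtain n0 p0 where "norm n0 \<le> 2" and mean0: "mean Em n0"
    and p0: "\<And>t. (p0 has_vector_derivative Em t - n0) (at t)"
    and qp0': "\<And>d. 0 < d \<Longrightarrow> d \<le> \<sigma> \<Longrightarrow> qp (\<sigma> - d) (fact N / c / d ^ N * 2) p0"
    by (rule qp_primitive[OF qEm \<sigma>0(1) c sd(1)]) (assumption | rule that)+
  have qp0: "qp (\<sigma> - 2 * d) (D * 2) p0"
    by (rule qp_mono[OF qp0'[OF \<sigma>(3) \<sigma>0(6)]]) (use \<sigma> D in auto)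
  obtain n1 p1 where n1: "norm n1 \<le> 2 * (D * (2 * r))" and "mean (\<lambda>t. Em t * g1 t) n1"
    and p1: "\<And>t. (p1 has_vector_derivative Em t * g1 t - n1) (at t)"
    and qp1': "\<And>d'. 0 < d' \<Longrightarrow> d' \<le> \<sigma> - d \<Longrightarrow> qp (\<sigma> - d - d') (fact N / c / d' ^ N * (2 * (D * (2 * r)))) p1"
    by (rule qp_primitive[OF qp_mult[OF qEmd qg1d \<sigma>0(4)] \<sigma>0(3) c sd(1)]) (assumption | rule that)+
  have dd: "\<sigma> - d - d = \<sigma> - 2 * d" "d \<le> \<sigma> - d" using \<sigma> by auto
  have qp1: "qp (\<sigma> - 2 * d) (D * (2 * (D * (2 * r)))) p1"
    using qp1'[OF \<sigma>(3) dd(2)] by (simp add: D dd(1))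
  obtain n2 p2 where "norm n2 \<le> 2 * (D * (2 * A))" and mean_n2: "mean (\<lambda>t. Em t * g2 t) n2"
    and p2: "\<And>t. (p2 has_vector_derivative Em t * g2 t - n2) (at t)"
    and qp2': "\<And>d'. 0 < d' \<Longrightarrow> d' \<le> \<sigma> - d \<Longrightarrow> qp (\<sigma> - d - d') (fact N / c / d' ^ N * (2 * (D * (2 * A)))) p2"
    by (rule qp_primitive[OF qp_mult[OF qEmd qg2d \<sigma>0(4)] \<sigma>0(3) c sd(1)]) (assumption | rule that)+
  have qp2: "qp (\<sigma> - 2 * d) (D * (2 * (D * (2 * A)))) p2"
    using qp2'[OF \<sigma>(3) dd(2)] by (simp add: D dd(1))
  \<comment> \<open>Only the sup norm of \<open>g2\<close> matters for its mean, so the loss may be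
    \<open>\<sigma>'\<close> instead of \<open>d\<close>. Hence \<open>C2\<close> does not
    deteriorate as \<open>d\<close> shrinks along the iteration.\<close>
  have n2: "norm n2 \<le> C2"
  proof (rule mean_norm_le[OF mean_n2])
    fix t
    have "norm (g2 t) \<le> fact N / c / \<sigma>' ^ N * (2 * A)"
      by (rule qp_norm_le[OF qg2[OF \<sigma>(1) \<sigma>0(7)] \<sigma>0(8)])
    then have "norm (Em t) * norm (g2 t) \<le> 2 * (fact N / c / \<sigma>' ^ N * (2 * A))"
      using Em2 by (intro mult_mono) auto
    then show "norm (Em t * g2 t) \<le> C2" by (simp add: norm_mult C2 mult_ac)
  qed
  have n01: "norm (n0 - 1) \<le> q"
  proof -
    have "mean (\<lambda>t. Em t + (-1)) (n0 + (-1))" by (intro mean_add mean0 mean_const)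
    then have "norm (n0 + (-1)) \<le> q" by (rule mean_norm_le) (use Em'1 in simp)
    then show ?thesis by simp
  qed
  have m2a: "norm (m2 - of_real abar) \<le> q * A"
  proof -
    have "mean (\<lambda>t. E t * a t + (-1) * a t) (m2 + (-1) * of_real abar)"
      by (intro mean_add mean2 mean_cmult a)
    moreover have "norm (E t * a t + (-1) * a t) \<le> q * A" for t
    proof -
      have "E t * a t + (-1) * a t = (E t - 1) * a t" by (simp add: algebra_simps)
      then show ?thesis using E'1 a_le q0 by (auto simp: norm_mult intro: mult_mono)
    qed
    ultimately have "norm (m2 + (-1) * of_real abar) \<le> q * A" by (rule mean_norm_le)
    then show ?thesis by simp
  qed
  have n0_le: "norm n0 \<le> 2" "norm n0 \<ge> 1/2"
    using n01 q(2) norm_triangle_ineq2[of n0 1] norm_triangle_ineq2[of 1 n0] by (auto simp: norm_minus_commute)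
  then have n0nz: "n0 \<noteq> 0" by auto
  \<comment> \<open>The determinant, up to sign, of the two equations for \<open>g0\<close> and
    \<open>\<eta>\<close>. It is close to \<open>abar\<close> because \<open>m2\<close> is close to
    \<open>abar\<close>, \<open>n0\<close> is close to 1, and \<open>\<Omega> * C2\<close> is small;
    no division by \<Omega> occurs.\<close>
  define X where "X = m2 * n0 + 2 * \<i> * \<Omega> * n2"
  have "norm (X - of_real abar) \<le> abar / 2"
  proof -
    have "X - of_real abar = (m2 - of_real abar) * n0 + of_real abar * (n0 - 1) + 2 * \<i> * \<Omega> * n2"
      by (simp add: X_def algebra_simps)
    also have "norm \<dots> \<le> norm ((m2 - of_real abar) * n0) + norm (of_real abar * (n0 - 1)) + norm (2 * \<i> * \<Omega> * n2)"
      by (intro order_trans[OF norm_triangle_ineq] add_mono order_refl norm_triangle_ineq)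
    also have "\<dots> = norm (m2 - of_real abar) * norm n0 + abar * norm (n0 - 1) + 2 * \<Omega> * norm n2"
      using \<Omega> a(3) by (simp add: norm_mult)
    also have "\<dots> \<le> (q * A) * 2 + A * q + 2 * \<Omega> * C2"
      using m2a n0_le n01 n2 \<Omega> a(3) abar_le q0 A by (intro add_mono mult_mono) auto
    also have "\<dots> \<le> abar / 2" using q(3) by (simp add: algebra_simps)
    finally show ?thesis .
  qed
  then have X: "norm X \<ge> abar / 2"
    using norm_triangle_ineq2[of "of_real abar" X] a(3) by (simp add: norm_minus_commute)
  then have Xnz: "X \<noteq> 0" using a(3) by auto
  define \<eta> where "\<eta> = - (m1 * n0 + 2 * \<i> * \<Omega> * n1) / X"
  define g0 where "g0 = (n1 + \<eta> * n2) / n0"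
  have D0: "D > 0" using D by simp
  have rD: "r \<le> D * r" "0 \<le> D * r" using mult_right_mono[OF D(2) r] r D0 by simp_all
  have e1: "e1 > 0" using a(3) M by simp
  have C20: "C2 \<ge> 0" using A c \<sigma> by (simp add: C2)
  have \<eta>: "norm \<eta> \<le> e1 * (D * r)"
  proof -
    have "norm (m1 * n0 + 2 * \<i> * \<Omega> * n1) \<le> norm m1 * norm n0 + 2 * \<Omega> * norm n1"
      using \<Omega> by (intro order_trans[OF norm_triangle_ineq]) (simp add: norm_mult)
    also have "\<dots> \<le> (2 * r) * 2 + 2 * 1 * (2 * (D * (2 * r)))"
      using m1 n0_le n1 \<Omega> r by (intro add_mono mult_mono) auto
    also have "\<dots> \<le> 12 * (D * r)" using rD by simp
    \<comment> \<open>The origin of \<open>e1 = 24 / abar\<close>: a numerator of at most 12 units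
      over a determinant of at least \<open>abar / 2\<close>.\<close>
    finally have "norm \<eta> \<le> 12 * (D * r) / (abar / 2)"
      unfolding \<eta>_def norm_divide norm_minus_cancel using X a(3) rD by (intro frac_le) auto
    then show ?thesis by (simp add: M)
  qed
  have g0: "norm g0 \<le> (8 + 2 * C2 * e1) * (D * r)"
  proof -
    have "norm (n1 + \<eta> * n2) \<le> norm n1 + norm \<eta> * norm n2"
      by (intro order_trans[OF norm_triangle_ineq]) (simp add: norm_mult)
    also have "\<dots> \<le> 2 * (D * (2 * r)) + (e1 * (D * r)) * C2"
      using n1 n2 \<eta> e1 rD by (intro add_mono mult_mono) auto
    finally have "norm (n1 + \<eta> * n2) / norm n0 \<le> (2 * (D * (2 * r)) + (e1 * (D * r)) * C2) / (1/2)"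
      using n0_le rD e1 C20 D0 r by (intro frac_le) auto
    then show ?thesis by (simp add: g0_def norm_divide algebra_simps)
  qed
  have bal1: "2 * \<i> * \<Omega> * g0 + m1 + \<eta> * m2 = 0"
  proof -
    have "\<eta> * X = - (m1 * n0 + 2 * \<i> * \<Omega> * n1)" using Xnz by (simp add: \<eta>_def)
    moreover have "g0 * n0 = n1 + \<eta> * n2" using n0nz by (simp add: g0_def)
    ultimately have "(2 * \<i> * \<Omega> * g0 + m1 + \<eta> * m2) * n0 = 0"
      unfolding X_def by algebra
    with n0nz show ?thesis by simp
  qed
  have bal2: "g0 * n0 - n1 - \<eta> * n2 = 0" using n0nz by (simp add: g0_def)
  define h where "h t = Em t * (g0 - g1 t - \<eta> * g2 t)" for t
  define u where "u t = g0 * p0 t - p1 t - \<eta> * p2 t" for t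
  have u': "(u has_vector_derivative h t) (at t)" for t
  proof -
    have "(u has_vector_derivative g0 * (Em t - n0) - (Em t * g1 t - n1) - \<eta> * (Em t * g2 t - n2)) (at t)"
      unfolding u_def by (auto intro!: derivative_eq_intros p0 p1 p2)
    moreover have "g0 * (Em t - n0) - (Em t * g1 t - n1) - \<eta> * (Em t * g2 t - n2) = h t"
      unfolding h_def using bal2 by algebra
    ultimately show ?thesis by simp
  qed
  have Em': "(Em has_vector_derivative - (2 * w t) * Em t) (at t)" for t
  proof -
    have "((\<lambda>t. - (2 * U t)) has_vector_derivative - (2 * w t)) (at t)"
      by (auto intro!: derivative_eq_intros U(2))
    from field_vector_diff_chain_at[OF this DERIV_exp] show ?thesis
      by (simp add: Em_def[abs_def] o_def)
  qed
  have h': "(h has_vector_derivative - (2 * \<i> * \<Omega> * h t + 2 * w t * h t + \<rho> t + \<eta> * a t)) (at t)" for t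
  proof -
    have "(h has_vector_derivative
        Em t * (0 - (E t * \<rho> t - m1 - 2 * \<i> * \<Omega> * g1 t) - \<eta> * (E t * a t - m2 - 2 * \<i> * \<Omega> * g2 t)) +
        - (2 * w t) * Em t * (g0 - g1 t - \<eta> * g2 t)) (at t)"
      unfolding h_def by (intro has_vector_derivative_mult has_vector_derivative_diff has_vector_derivative_const
          has_vector_derivative_mult_right Em' g1 g2)
    moreover have "Em t * (0 - (E t * \<rho> t - m1 - 2 * \<i> * \<Omega> * g1 t) - \<eta> * (E t * a t - m2 - 2 * \<i> * \<Omega> * g2 t)) +
        - (2 * w t) * Em t * (g0 - g1 t - \<eta> * g2 t) = - (2 * \<i> * \<Omega> * h t + 2 * w t * h t + \<rho> t + \<eta> * a t)"
      unfolding h_def using bal1 EEm[of t] by algebra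
    ultimately show ?thesis by simp
  qed
  have DD: "D * r \<le> D ^ 3 * r" "D * D * r \<le> D ^ 3 * r"
  proof -
    have "D * 1 \<le> D * (D * D)" "D * D * 1 \<le> D * D * D"
      using D(2) mult_mono[of 1 D 1 D] by (auto intro!: mult_left_mono)
    from this[THEN mult_right_mono, OF r] show "D * r \<le> D ^ 3 * r" "D * D * r \<le> D ^ 3 * r"
      by (simp_all add: power3_eq_cube mult.assoc)
  qed
  have D3r: "0 \<le> D ^ 3 * r" using D0 r by simp
  have M_nn: "0 \<le> C2 * e1" "0 \<le> A * e1" using C20 A e1 by auto
  have "qp (\<sigma> - d) (2 * (norm g0 + D * (2 * r) + norm \<eta> * (D * (2 * A)))) h"
    unfolding h_def by (intro qp_mult qp_diff qp_scale qp_const qEmd qg1d qg2d \<sigma>0)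
  then have qh: "qp (\<sigma> - 2 * d) (M * D ^ 3 * r) h"
  proof (rule qp_mono)
    have "norm \<eta> * (D * (2 * A)) \<le> (e1 * (D * r)) * (D * (2 * A))"
      using \<eta> D0 A by (intro mult_right_mono) auto
    also have "\<dots> = 2 * (A * e1) * (D * D * r)" by simp
    also have "\<dots> \<le> 2 * (A * e1) * (D ^ 3 * r)" using DD M_nn by (intro mult_left_mono) auto
    finally have 1: "norm \<eta> * (D * (2 * A)) \<le> 2 * (A * e1) * (D ^ 3 * r)" .
    have 2: "norm g0 \<le> (8 + 2 * C2 * e1) * (D ^ 3 * r)"
      by (rule order_trans[OF g0]) (use DD M_nn in \<open>auto intro!: mult_left_mono\<close>)
    have "2 * (norm g0 + D * (2 * r) + norm \<eta> * (D * (2 * A))) \<le>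
       2 * ((8 + 2 * C2 * e1) * (D ^ 3 * r) + 2 * (D ^ 3 * r) + 2 * (A * e1) * (D ^ 3 * r))"
      using 1 2 DD(1) by simp
    also have "\<dots> = (20 + 4 * C2 * e1 + 4 * A * e1) * (D ^ 3 * r)" by (simp add: algebra_simps)
    also have "\<dots> \<le> M * (D ^ 3 * r)" using M e1 D3r by (intro mult_right_mono) auto
    finally show "2 * (norm g0 + D * (2 * r) + norm \<eta> * (D * (2 * A))) \<le> M * D ^ 3 * r"
      by (simp add: mult.assoc)
  qed (use \<sigma> in auto)
  have "qp (\<sigma> - 2 * d) (norm g0 * (D * 2) + D * (2 * (D * (2 * r))) + norm \<eta> * (D * (2 * (D * (2 * A))))) u"
    unfolding u_def by (intro qp_diff qp_scale qp0 qp1 qp2 \<sigma>0)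
  then have qu: "qp (\<sigma> - 2 * d) (M * D ^ 3 * r) u"
  proof (rule qp_mono[OF _ order_refl])
    \<comment> \<open>The cube of \<open>D\<close> arises here: one factor from
      \<open>\<eta>\<close>, one from \<open>g2\<close>, and one from integrating
      \<open>Em * g2\<close>.\<close>
    have "norm \<eta> * (D * (2 * (D * (2 * A)))) \<le> (e1 * (D * r)) * (D * (2 * (D * (2 * A))))"
      using \<eta> D0 A by (intro mult_right_mono) auto
    also have "\<dots> = 4 * (A * e1) * (D ^ 3 * r)" by (simp add: power3_eq_cube)
    finally have 1: "norm \<eta> * (D * (2 * (D * (2 * A)))) \<le> 4 * (A * e1) * (D ^ 3 * r)" .
    have "norm g0 * (D * 2) \<le> (8 + 2 * C2 * e1) * (D * r) * (D * 2)"
      using g0 D0 by (intro mult_right_mono) auto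
    also have "\<dots> = (16 + 4 * C2 * e1) * (D * D * r)" by (simp add: algebra_simps)
    also have "\<dots> \<le> (16 + 4 * C2 * e1) * (D ^ 3 * r)"
      using DD M_nn by (intro mult_left_mono) auto
    finally have "norm g0 * (D * 2) + D * (2 * (D * (2 * r))) + norm \<eta> * (D * (2 * (D * (2 * A)))) \<le>
       (16 + 4 * C2 * e1) * (D ^ 3 * r) + 4 * (D ^ 3 * r) + 4 * (A * e1) * (D ^ 3 * r)"
      using 1 DD(2) by simp
    also have "\<dots> = (20 + 4 * C2 * e1 + 4 * A * e1) * (D ^ 3 * r)" by (simp add: algebra_simps)
    also have "\<dots> \<le> M * (D ^ 3 * r)" using M e1 D3r by (intro mult_right_mono) auto
    finally show "norm g0 * (D * 2) + D * (2 * (D * (2 * r))) + norm \<eta> * (D * (2 * (D * (2 * A)))) \<le> M * D ^ 3 * r"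
      by (simp add: mult.assoc)
  qed
  have "norm \<eta> \<le> M * D ^ 3 * r"
  proof -
    have "norm \<eta> \<le> e1 * (D ^ 3 * r)"
      by (rule order_trans[OF \<eta>]) (use e1 DD in \<open>auto intro!: mult_left_mono\<close>)
    also have "\<dots> \<le> M * (D ^ 3 * r)" using M M_nn D3r by (intro mult_right_mono) auto
    finally show ?thesis by (simp add: mult.assoc)
  qed
  with qu qh u' h' show ?thesis by blast
qed

end

subsection \<open>The Newton iteration\<close>

lemma uniform_limit_telescope:
  fixes f :: "nat \<Rightarrow> 'b \<Rightarrow> 'a::banach"
  assumes f: "\<And>n x. norm (f (Suc n) x - f n x) \<le> \<tau> n" and \<tau>: "\<tau> sums S"
  obtains g where "uniform_limit UNIV f g sequentially" "\<And>x. norm (g x - f 0 x) \<le> S"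
proof -
  define h where "h x = (\<Sum>n. f (Suc n) x - f n x)" for x
  have "uniform_limit UNIV (\<lambda>n x. \<Sum>i<n. f (Suc i) x - f i x) h sequentially"
    unfolding h_def by (rule Weierstrass_m_test) (use f \<tau> in \<open>auto simp: sums_iff\<close>)
  then have "uniform_limit UNIV (\<lambda>n x. f n x - f 0 x) h sequentially"
    using sum_lessThan_telescope[of "\<lambda>n. f n x" for x] by simp
  from uniform_limit_add[OF this uniform_limit_const[where c = "f 0"]]
  have 1: "uniform_limit UNIV f (\<lambda>x. h x + f 0 x) sequentially" by simp
  have 2: "norm (h x) \<le> S" for x
  proof -
    have s: "summable (\<lambda>n. norm (f (Suc n) x - f n x))"
      by (rule summable_comparison_test'[OF sums_summable[OF \<tau>], of 0]) (use f in auto)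
    have "norm (h x) \<le> (\<Sum>n. norm (f (Suc n) x - f n x))"
      unfolding h_def by (rule summable_norm[OF s])
    also have "\<dots> \<le> suminf \<tau>" by (rule suminf_le[OF f s sums_summable[OF \<tau>]])
    finally show ?thesis using \<tau> by (simp add: sums_iff)
  qed
  show ?thesis by (rule that[OF 1]) (use 2 in simp)
qed

text \<open>\<open>z = i\<Omega> + w\<close> is a bounded solution of the Riccati equation \<open>z' + z\<^sup>2 + \<epsilon>a = 0\<close>
  whose time average is \<open>i\<Omega>\<close>, because \<open>w\<close> has a bounded primitive.\<close>

definition floquet :: "real \<Rightarrow> (real \<Rightarrow> complex) \<Rightarrow> real \<Rightarrow> complex \<Rightarrow> bool" where
  "floquet C a \<Omega> \<epsilon> \<longleftrightarrow> (\<exists>U w. bounded (range U) \<and>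
     (\<forall>t. (U has_vector_derivative w t) (at t)) \<and> (\<forall>t. norm (w t) \<le> C * \<Omega>\<^sup>2) \<and>
     (\<forall>t. (w has_vector_derivative - (2 * \<i> * \<Omega> * w t + (w t)\<^sup>2 + \<epsilon> * a t - \<Omega>\<^sup>2)) (at t)))"

context frequency_module
begin

text \<open>Geometric decay of the residual is enough as an invariant. Halving the width loss at
  each step makes \<open>D ^ 3\<close> grow like \<open>b ^ n\<close>, so residuals
  \<open>r0 / b ^ (2 * n)\<close> yield corrections \<open>M0 * r0 / b ^ n\<close>. Their squares
  are at most the next residual precisely when \<open>r0 * M0\<^sup>2 * b\<^sup>2 \<le> 1\<close>,
  provided \<open>r0 > 0\<close>. Since \<open>r0\<close> is of order
  \<open>\<Omega>\<^sup>2\<close>, a small \<Omega> ensures this.\<close>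

lemma newton_iteration:
  fixes \<Omega> abar :: real
  assumes c: "c > 0" "c \<le> 1" and s: "s > 0" "s \<le> 1" and N: "N \<ge> 1"
    and sd: "\<And>k. k \<noteq> 0 \<Longrightarrow> \<bar>\<phi> k\<bar> \<ge> c / \<l> k ^ N"
      "\<And>k. k \<noteq> 0 \<Longrightarrow> \<bar>\<phi> k + 2 * \<Omega>\<bar> \<ge> c / \<l> k ^ N"
    and a: "qp s A a" "mean a (of_real abar)" "abar > 0"
    and \<Omega>: "0 < \<Omega>" "\<Omega> \<le> 1"
    and C2: "C2 = fact N / c / (s / 2) ^ N * (4 * A)"
    and q: "exp (2 * v) - 1 \<le> q" "q \<le> 1/2" "3 * q * A + 2 * \<Omega> * C2 \<le> abar / 2"
    and M: "e1 = 24 / abar" "M = 20 + 4 * C2 * e1 + 4 * A * e1 + e1"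
    and M0: "M0 = M * (fact N / c / (s / 8) ^ N) ^ 3"
    and b: "b = 8 ^ N"
    and r0: "r0 = (A / abar + 1) * \<Omega>\<^sup>2" "r0 * M0\<^sup>2 * b\<^sup>2 \<le> 1" "2 * M0 * r0 \<le> v"
  shows "\<exists>\<epsilon>. floquet (2 * M0 * (A / abar + 1)) a \<Omega> \<epsilon>"
proof -
  \<comment> \<open>The widths shrink from \<open>s\<close> towards \<open>s / 2\<close>, and
    \<open>d\<close> is chosen so that one step costs exactly \<open>2 * d n\<close>.\<close>
  define \<sigma> where "\<sigma> n = s / 2 + s / 2 / 2 ^ n" for n :: nat
  define d where "d n = s / 8 / 2 ^ n" for n :: nat
  define \<tau> where "\<tau> n = M0 * r0 / b ^ n" for n
  define r where "r n = r0 / b ^ (2 * n)" for n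
  define V where "V n = (\<Sum>i<n. \<tau> i)" for n
  have A: "A \<ge> 0" using qp_nonneg[OF a(1)] .
  have C20: "C2 \<ge> 0" unfolding C2 using A c s by simp
  have M1: "M > 0" using A C20 a(3) unfolding M by (auto intro!: add_pos_nonneg)
  have M00: "M0 > 0" unfolding M0 using M1 c s by simp
  have r00: "r0 \<ge> 0" unfolding r0(1) using A a(3) by simp
  have b2: "b \<ge> 2"
  proof -
    have "(8::real) ^ 1 \<le> 8 ^ N" using N by (intro power_increasing) auto
    then show ?thesis by (simp add: b)
  qed
  have \<tau>0: "\<tau> n \<ge> 0" for n using M00 r00 b2 by (simp add: \<tau>_def)
  have \<tau>_le: "\<tau> n \<le> M0 * r0 * (1/2) ^ n" for n
  proof -
    have "(1 / b) ^ n \<le> (1/2) ^ n" using b2 by (intro power_mono) (auto simp: field_simps)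
    then have "M0 * r0 * (1 / b) ^ n \<le> M0 * r0 * (1/2) ^ n" using M00 r00 by (intro mult_left_mono) auto
    then show ?thesis by (simp add: \<tau>_def power_one_over field_simps)
  qed
  have geo: "(\<lambda>n. M0 * r0 * (1/2) ^ n) sums (2 * M0 * r0)"
    using sums_mult[OF geometric_sums[of "1/2 :: real"], of "M0 * r0"] by (simp add: mult_ac)
  have \<tau>s: "summable \<tau>"
    by (rule summable_comparison_test'[OF sums_summable[OF geo], of 0]) (use \<tau>_le \<tau>0 in auto)
  have S: "suminf \<tau> \<le> 2 * M0 * r0"
    using suminf_le[OF \<tau>_le \<tau>s sums_summable[OF geo]] geo by (simp add: sums_iff)
  have V_le: "V n \<le> v" for n
  proof -
    have "V n \<le> suminf \<tau>" unfolding V_def by (rule sum_le_suminf) (use \<tau>s \<tau>0 in auto)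
    with S r0(3) show ?thesis by simp
  qed
  have \<sigma>_bds: "\<sigma> n \<le> s" "s / 2 \<le> \<sigma> n - 2 * d n" "0 < d n" "\<sigma> n \<ge> 0" "\<sigma> (Suc n) = \<sigma> n - 2 * d n" "d n \<le> 1" for n
  proof -
    have "(1/2::real) ^ n \<le> 1" "(1/2::real) ^ n > 0" by (auto intro: power_le_one)
    then have "s * (1/2) ^ n \<le> s" "0 < s * (1/2) ^ n" using s by (auto simp: mult_le_cancel_left1)
    moreover define x where "x = s * (1/2) ^ n"
    ultimately have x: "x \<le> s" "0 < x" by simp_all
    have \<sigma>: "\<sigma> n = s / 2 + x / 2" and d: "d n = x / 8"
      by (simp_all add: \<sigma>_def d_def x_def power_one_over)
    show "\<sigma> n \<le> s" using x s unfolding \<sigma> d by linarith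
    show "s / 2 \<le> \<sigma> n - 2 * d n" using x s unfolding \<sigma> d by linarith
    show "0 < d n" using x s unfolding \<sigma> d by linarith
    show "\<sigma> n \<ge> 0" using x s unfolding \<sigma> d by linarith
    show "d n \<le> 1" using x s unfolding \<sigma> d by linarith
    show "\<sigma> (Suc n) = \<sigma> n - 2 * d n" unfolding \<sigma> d by (simp add: \<sigma>_def x_def power_one_over)
  qed
  define K where "K = fact N / c"
  define Dn where "Dn n = K / d n ^ N" for n
  have Dn_eq: "Dn n = fact N / c / d n ^ N" for n by (simp add: Dn_def K_def)
  have K1: "K \<ge> 1" using c(1) order_trans[OF c(2) fact_ge_1[of N]] by (simp add: K_def)
  have Dn1: "Dn n \<ge> 1" for n
  proof -
    have "d n ^ N \<le> 1" using \<sigma>_bds(3,6)[of n] by (intro power_le_one) auto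
    then show ?thesis using \<sigma>_bds(3)[of n] K1 by (simp add: Dn_def le_divide_eq)
  qed
  have MD: "M * Dn n ^ 3 * r n = \<tau> n" for n
  proof -
    have "Dn n = K / (s / 8) ^ N * (2 ^ n) ^ N" by (simp add: Dn_def d_def power_divide field_simps)
    then have "Dn n ^ 3 = (K / (s / 8) ^ N) ^ 3 * ((2 ^ n) ^ N) ^ 3" by (simp only: power_mult_distrib)
    moreover have "(((2::real) ^ n) ^ N) ^ 3 = b ^ n"
    proof -
      have "(((2::real) ^ n) ^ N) ^ 3 = (2 ^ 3) ^ (N * n)" by (simp only: power_mult[symmetric] mult_ac)
      also have "\<dots> = b ^ n" by (simp add: b power_mult)
      finally show ?thesis .
    qed
    ultimately have "M * Dn n ^ 3 = M0 * b ^ n" by (simp add: M0 K_def)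
    then show ?thesis using b2 by (simp add: r_def \<tau>_def power_mult power2_eq_square field_simps)
  qed
  have \<tau>r: "\<tau> n * \<tau> n \<le> r (Suc n)" for n
  proof -
    have "\<tau> n * \<tau> n = r0 * (r0 * M0\<^sup>2 * b\<^sup>2) / b ^ (2 * Suc n)"
      using b2 by (simp add: \<tau>_def field_simps power_mult power2_eq_square)
    also have "\<dots> \<le> r0 * 1 / b ^ (2 * Suc n)"
      using r0(2) r00 b2 by (intro divide_right_mono mult_left_mono) auto
    finally show ?thesis by (simp add: r_def)
  qed
  define P where "P n = (\<lambda>(U, w, \<epsilon>, \<rho>). qp (\<sigma> n) (V n) U \<and> (\<forall>t. (U has_vector_derivative w t) (at t)) \<and>
      qp (\<sigma> n) (r n) \<rho> \<and>
      (\<forall>t. (w has_vector_derivative \<rho> t - (2 * \<i> * \<Omega> * w t + (w t)\<^sup>2 + \<epsilon> * a t - \<Omega>\<^sup>2)) (at t)))" for n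
  define Q where "Q n = (\<lambda>(U, w, \<epsilon>::complex, \<rho>::real\<Rightarrow>complex) (U', w', \<epsilon>', \<rho>'::real\<Rightarrow>complex).
      (\<forall>t::real. norm (U' t - U t :: complex) \<le> \<tau> n) \<and> (\<forall>t::real. norm (w' t - w t :: complex) \<le> \<tau> n) \<and> norm (\<epsilon>' - \<epsilon>) \<le> \<tau> n)" for n
  have "\<exists>f. \<forall>n. P n (f n) \<and> Q n (f n) (f (Suc n))"
  proof (rule dependent_nat_choice)
    \<comment> \<open>The start is \<open>w = 0\<close> with the value of \<epsilon> for which the
      residual \<open>\<epsilon> * a - \<Omega>\<^sup>2\<close> has mean zero; its bound is
      \<open>r 0\<close>.\<close>
    have "qp s (norm (of_real (\<Omega>\<^sup>2 / abar) :: complex) * A + norm (of_real (\<Omega>\<^sup>2) :: complex))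
       (\<lambda>t. of_real (\<Omega>\<^sup>2 / abar) * a t - of_real (\<Omega>\<^sup>2))"
      by (intro qp_diff qp_scale qp_const a) (use s in auto)
    moreover have "norm (of_real (\<Omega>\<^sup>2 / abar) :: complex) * A + norm (of_real (\<Omega>\<^sup>2) :: complex) = r 0"
      using a(3) unfolding norm_of_real by (simp add: r_def r0 field_simps)
    ultimately have q0: "qp (\<sigma> 0) (r 0) (\<lambda>t. of_real (\<Omega>\<^sup>2 / abar) * a t - of_real (\<Omega>\<^sup>2))"
      by (simp add: \<sigma>_def)
    have "P 0 ((\<lambda>t. 0), (\<lambda>t. 0), of_real (\<Omega>\<^sup>2 / abar), (\<lambda>t. of_real (\<Omega>\<^sup>2 / abar) * a t - of_real (\<Omega>\<^sup>2)))"
      unfolding P_def using q0 qp_const[of "\<sigma> 0" 0] by (simp add: V_def)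
    then show "\<exists>x. P 0 x" by blast
  next
    fix x n
    assume "P n x"
    moreover obtain U w \<epsilon> \<rho> where x: "x = (U, w, \<epsilon>, \<rho>)" by (cases x)
    ultimately have U: "qp (\<sigma> n) (V n) U" "\<And>t. (U has_vector_derivative w t) (at t)"
      and \<rho>: "qp (\<sigma> n) (r n) \<rho>"
        "\<And>t. (w has_vector_derivative \<rho> t - (2 * \<i> * \<Omega> * w t + (w t)\<^sup>2 + \<epsilon> * a t - \<Omega>\<^sup>2)) (at t)"
      by (auto simp: P_def)
    have "exp (2 * V n) - 1 \<le> q" using V_le[of n] q(1) by (smt (verit) exp_le_cancel_iff)
    then have "\<exists>u h \<eta>. qp (\<sigma> n - 2 * d n) (M * Dn n ^ 3 * r n) u \<and> qp (\<sigma> n - 2 * d n) (M * Dn n ^ 3 * r n) h \<and>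
     norm \<eta> \<le> M * Dn n ^ 3 * r n \<and> (\<forall>t. (u has_vector_derivative h t) (at t)) \<and>
     (\<forall>t. (h has_vector_derivative - (2 * \<i> * \<Omega> * h t + 2 * w t * h t + \<rho> t + \<eta> * a t)) (at t))"
      using s by (intro newton_step[OF c(1) sd qp_mono[OF a(1) \<sigma>_bds(1) order_refl] a(2,3) U \<rho> \<Omega> _ \<sigma>_bds(2,3)
            Dn_eq Dn1 C2 _ q(2,3) M]) auto
    then obtain u h \<eta> where u: "qp (\<sigma> (Suc n)) (\<tau> n) u" and h: "qp (\<sigma> (Suc n)) (\<tau> n) h" and \<eta>: "norm \<eta> \<le> \<tau> n"
      and u': "\<And>t. (u has_vector_derivative h t) (at t)"
      and h': "\<And>t. (h has_vector_derivative - (2 * \<i> * \<Omega> * h t + 2 * w t * h t + \<rho> t + \<eta> * a t)) (at t)"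
      unfolding MD \<sigma>_bds(5)[symmetric] by blast
    have \<sigma>S: "\<sigma> (Suc n) \<ge> 0" "\<sigma> (Suc n) \<le> \<sigma> n" using \<sigma>_bds(4)[of "Suc n"] \<sigma>_bds(3,5)[of n] by auto
    have 1: "qp (\<sigma> (Suc n)) (V (Suc n)) (\<lambda>t. U t + u t)"
      using qp_add[OF qp_mono[OF U(1) \<sigma>S(2) order_refl] u \<sigma>S(1)] by (simp add: V_def)
    have 2: "((\<lambda>t. U t + u t) has_vector_derivative w t + h t) (at t)" for t
      by (intro has_vector_derivative_add U u')
    \<comment> \<open>The linearized equation is solved exactly and \<epsilon> enters linearly, so
      the quadratic term \<open>h * h\<close> is the whole new residual.\<close>
    have 3: "qp (\<sigma> (Suc n)) (r (Suc n)) (\<lambda>t. h t * h t)"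
      by (rule qp_mono[OF qp_mult[OF h h \<sigma>S(1)] order_refl \<tau>r])
    have 4: "((\<lambda>t. w t + h t) has_vector_derivative
        h t * h t - (2 * \<i> * \<Omega> * (w t + h t) + (w t + h t)\<^sup>2 + (\<epsilon> + \<eta>) * a t - \<Omega>\<^sup>2)) (at t)" for t
    proof -
      have "((\<lambda>t. w t + h t) has_vector_derivative
        (\<rho> t - (2 * \<i> * \<Omega> * w t + (w t)\<^sup>2 + \<epsilon> * a t - \<Omega>\<^sup>2)) + - (2 * \<i> * \<Omega> * h t + 2 * w t * h t + \<rho> t + \<eta> * a t)) (at t)"
        by (rule has_vector_derivative_add[OF \<rho>(2) h'])
      moreover have "(\<rho> t - (2 * \<i> * \<Omega> * w t + (w t)\<^sup>2 + \<epsilon> * a t - \<Omega>\<^sup>2)) + - (2 * \<i> * \<Omega> * h t + 2 * w t * h t + \<rho> t + \<eta> * a t)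
        = h t * h t - (2 * \<i> * \<Omega> * (w t + h t) + (w t + h t)\<^sup>2 + (\<epsilon> + \<eta>) * a t - \<Omega>\<^sup>2)"
        by (simp add: algebra_simps power2_eq_square)
      ultimately show ?thesis by (simp only:)
    qed
    have "P (Suc n) ((\<lambda>t. U t + u t), (\<lambda>t. w t + h t), \<epsilon> + \<eta>, (\<lambda>t. h t * h t))"
      unfolding P_def using 1 2 3 4 by blast
    moreover have "Q n x ((\<lambda>t. U t + u t), (\<lambda>t. w t + h t), \<epsilon> + \<eta>, (\<lambda>t. h t * h t))"
      unfolding Q_def x using qp_norm_le[OF u \<sigma>S(1)] qp_norm_le[OF h \<sigma>S(1)] \<eta> by simp
    ultimately show "\<exists>y. P (Suc n) y \<and> Q n x y" by blast
  qed
  then obtain f where f: "\<And>n. P n (f n)" "\<And>n. Q n (f n) (f (Suc n))" by blast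
  define U where "U n = fst (f n)" for n
  define w where "w n = fst (snd (f n))" for n
  define \<epsilon> where "\<epsilon> n = fst (snd (snd (f n)))" for n
  define \<rho> where "\<rho> n = snd (snd (snd (f n)))" for n
  have fn: "f n = (U n, w n, \<epsilon> n, \<rho> n)" for n by (simp add: U_def w_def \<epsilon>_def \<rho>_def)
  have U: "qp (\<sigma> n) (V n) (U n)" "\<And>t. (U n has_vector_derivative w n t) (at t)"
      and \<rho>: "qp (\<sigma> n) (r n) (\<rho> n)"
        "\<And>t. (w n has_vector_derivative \<rho> n t - (2 * \<i> * \<Omega> * w n t + (w n t)\<^sup>2 + \<epsilon> n * a t - \<Omega>\<^sup>2)) (at t)"
    for n
    using f(1)[of n] by (auto simp: P_def fn)
  have dist: "norm (U (Suc n) t - U n t) \<le> \<tau> n" "norm (w (Suc n) t - w n t) \<le> \<tau> n" "norm (\<epsilon> (Suc n) - \<epsilon> n) \<le> \<tau> n"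
    for n t using f(2)[of n] by (auto simp: Q_def fn)
  have a_le: "norm (a t) \<le> A" for t using qp_norm_le[OF a(1)] s by simp
  obtain U' where U': "uniform_limit UNIV U U' sequentially" and U'0: "\<And>x. norm (U' x - U 0 x) \<le> suminf \<tau>"
    by (rule uniform_limit_telescope[where f = U, OF dist(1) summable_sums[OF \<tau>s]]) (rule that)
  obtain w' where w': "uniform_limit UNIV w w' sequentially" and w'0: "\<And>x. norm (w' x - w 0 x) \<le> suminf \<tau>"
    by (rule uniform_limit_telescope[where f = w, OF dist(2) summable_sums[OF \<tau>s]]) (rule that)
  \<comment> \<open>The numbers \<open>\<epsilon> n\<close> are treated as constant functions of
    time, so that they enter the uniform limit of the right-hand side on the same footing as
    \<open>w n\<close>; \<open>e'\<close> records that the limit is constant.\<close>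
  obtain \<epsilon>' where \<epsilon>': "uniform_limit UNIV (\<lambda>n (t::real). \<epsilon> n) \<epsilon>' sequentially"
    by (rule uniform_limit_telescope[where f = "\<lambda>n (t::real). \<epsilon> n", OF dist(3) summable_sums[OF \<tau>s]])
  have e': "\<epsilon>' = (\<lambda>t. \<epsilon>' 0)"
    using LIMSEQ_unique[OF tendsto_uniform_limitI[OF \<epsilon>' UNIV_I] tendsto_uniform_limitI[OF \<epsilon>' UNIV_I]] by blast
  \<comment> \<open>The sequence obtained by dependent choice does not remember its starting tuple.
    It is recovered from \<open>V 0 = 0\<close>, which forces \<open>U 0 = 0\<close> and then
    \<open>w 0 = 0\<close>, so the telescoped estimates bound the limits themselves.\<close>
  have U00: "U 0 = (\<lambda>t. 0)"
    using qp_norm_le[OF U(1)[of 0] \<sigma>_bds(4)] by (auto simp: V_def)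
  have w00: "w 0 t = 0" for t
    using vector_derivative_unique_at[OF U(2)[of 0 t]] by (simp add: U00)
  have bU: "bounded (range U')"
    using U'0 by (auto simp: bounded_iff U00)
  have w'_le: "norm (w' t) \<le> 2 * M0 * (A / abar + 1) * \<Omega>\<^sup>2" for t
    using w'0[of t] S by (simp add: w00 r0(1) mult.assoc)
  then have bw: "bounded (range w')" by (auto simp: bounded_iff)
  have ba: "bounded (range a)" using a_le by (auto simp: bounded_iff)
  have r_lim: "r \<longlonglongrightarrow> 0"
  proof -
    have "(\<lambda>n. r0 * (1 / b\<^sup>2) ^ n) \<longlonglongrightarrow> r0 * 0"
      using b2 by (intro tendsto_mult tendsto_const LIMSEQ_power_zero) (auto simp: power2_eq_square field_simps intro: less_1_mult)
    then show ?thesis by (simp add: r_def[abs_def] power_mult power_one_over divide_inverse power_inverse)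
  qed
  have \<rho>_lim: "uniform_limit UNIV \<rho> (\<lambda>t. 0) sequentially"
  proof (rule uniform_limit_null_comparison)
    show "\<forall>\<^sub>F n in sequentially. \<forall>t\<in>UNIV. norm (\<rho> n t) \<le> r n"
      using qp_norm_le[OF \<rho>(1) \<sigma>_bds(4)] by auto
    show "uniform_limit UNIV (\<lambda>n (t::real). r n) (\<lambda>t. 0) sequentially"
      using r_lim by (auto simp: uniform_limit_iff tendsto_iff)
  qed
  have "(U' has_vector_derivative w' t) (at t)" for t
    by (rule uniform_limit_has_vector_derivative[OF U(2) tendsto_uniform_limitI[OF U' UNIV_I] w'])
  moreover have "(w' has_vector_derivative - (2 * \<i> * \<Omega> * w' t + (w' t)\<^sup>2 + \<epsilon>' 0 * a t - \<Omega>\<^sup>2)) (at t)" for t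
  proof (rule uniform_limit_has_vector_derivative[OF \<rho>(2) tendsto_uniform_limitI[OF w' UNIV_I]])
    have bc: "bounded (range (\<lambda>t::real. c))" for c :: complex by (auto simp: bounded_iff)
    have "uniform_limit UNIV (\<lambda>n t. \<rho> n t - (2 * \<i> * \<Omega> * w n t + w n t * w n t + \<epsilon> n * a t - \<Omega>\<^sup>2))
       (\<lambda>t. 0 - (2 * \<i> * \<Omega> * w' t + w' t * w' t + \<epsilon>' t * a t - \<Omega>\<^sup>2)) sequentially"
      by (intro uniform_limit_minus uniform_limit_add uniform_lim_mult uniform_limit_const \<rho>_lim w' \<epsilon>' bw ba bc)
         (subst e', rule bc)
    then show "uniform_limit UNIV (\<lambda>n t. \<rho> n t - (2 * \<i> * \<Omega> * w n t + (w n t)\<^sup>2 + \<epsilon> n * a t - \<Omega>\<^sup>2))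
       (\<lambda>t. - (2 * \<i> * \<Omega> * w' t + (w' t)\<^sup>2 + \<epsilon>' 0 * a t - \<Omega>\<^sup>2)) sequentially"
      by (subst (asm) e') (simp add: power2_eq_square)
  qed
  ultimately have "floquet (2 * M0 * (A / abar + 1)) a \<Omega> (\<epsilon>' 0)"
    unfolding floquet_def using bU w'_le by blast
  then show ?thesis by blast
qed

text \<open>Collects the smallness conditions of the iteration into one threshold. Both
  \<open>C\<close> and \<open>\<Omega>0\<close> are independent of \<Omega>, as the later comparison
  of solutions with different \<Omega> requires.\<close>

theorem floquet_exists:
  fixes abar :: real
  assumes c: "c > 0" and s: "s > 0" and N: "N \<ge> 1"
    and sd: "\<And>k. k \<noteq> 0 \<Longrightarrow> \<bar>\<phi> k\<bar> \<ge> c / \<l> k ^ N"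
    and a: "qp s A a" "mean a (of_real abar)" "abar > 0"
  obtains C \<Omega>0 where "C \<ge> 0" "\<Omega>0 > 0"
    "\<forall>\<Omega>. 0 < \<Omega> \<and> \<Omega> \<le> \<Omega>0 \<and> (\<forall>k. k \<noteq> 0 \<longrightarrow> \<bar>\<phi> k + 2 * \<Omega>\<bar> \<ge> c / \<l> k ^ N) \<longrightarrow>
      (\<exists>\<epsilon>. floquet C a \<Omega> \<epsilon>)"
proof -
  define c' s' where "c' = min c 1" and "s' = min s 1"
  have c': "c' > 0" "c' \<le> 1" and s': "s' > 0" "s' \<le> 1" using c s by (auto simp: c'_def s'_def)
  have cc: "c' / \<l> k ^ N \<le> c / \<l> k ^ N" for k by (intro divide_right_mono) (auto simp: c'_def)
  have a': "qp s' A a" using a(1) by (rule qp_mono) (auto simp: s'_def)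
  have "norm (of_real abar :: complex) \<le> A"
    by (rule mean_norm_le[OF a(2)]) (rule qp_norm_le[OF a'], use s' in simp)
  then have A: "A \<ge> abar" "A > 0" using a(3) by auto
  \<comment> \<open>This gives \<open>3 * q * A \<le> abar / 4\<close>, half of what the determinant
    estimate tolerates; the other half is left to \<open>2 * \<Omega> * C2\<close>. The next line
    solves \<open>exp (2 * v) - 1 = q\<close>.\<close>
  define q where "q = min (1/2) (abar / (12 * A))"
  define v where "v = ln (1 + q) / 2"
  define C2 where "C2 = fact N / c' / (s' / 2) ^ N * (4 * A)"
  define e1 where "e1 = 24 / abar"
  define M where "M = 20 + 4 * C2 * e1 + 4 * A * e1 + e1"
  define M0 where "M0 = M * (fact N / c' / (s' / 8) ^ N) ^ 3"
  define b where "b = (8::real) ^ N"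
  define R where "R = A / abar + 1"
  have q: "q > 0" "q \<le> 1/2" "q \<le> abar / (12 * A)" using A a(3) by (auto simp: q_def)
  have v: "v > 0" "exp (2 * v) - 1 \<le> q" using q by (auto simp: v_def)
  have C2: "C2 > 0" using c' s' A by (simp add: C2_def)
  have M: "M > 0" unfolding M_def e1_def using C2 A a(3) by (auto intro!: add_pos_pos)
  have M0: "M0 > 0" using M c' s' by (simp add: M0_def)
  have b: "b > 0" by (simp add: b_def)
  have R: "R > 0" using A a(3) by (simp add: R_def add_pos_pos)
  \<comment> \<open>After the bound 1, the entries secure in turn the determinant condition, the
    condition for geometric decay, and \<open>2 * M0 * r0 \<le> v\<close>. The last two use
    \<open>r0 = R * \<Omega>\<^sup>2\<close> and
    \<open>\<Omega>\<^sup>2 \<le> \<Omega>0\<close>.\<close>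
  define \<Omega>0 where "\<Omega>0 = Min {1, abar / (8 * C2), 1 / (R * M0\<^sup>2 * b\<^sup>2), v / (2 * M0 * R)}"
  have \<Omega>0: "\<Omega>0 > 0" unfolding \<Omega>0_def using C2 R M0 b v a(3) by simp
  have \<Omega>0_le: "\<Omega>0 \<le> 1" "\<Omega>0 \<le> abar / (8 * C2)" "\<Omega>0 \<le> 1 / (R * M0\<^sup>2 * b\<^sup>2)" "\<Omega>0 \<le> v / (2 * M0 * R)"
    unfolding \<Omega>0_def by (auto intro!: Min_le)
  show ?thesis
  proof (rule that[of "2 * M0 * R" \<Omega>0])
    show "2 * M0 * R \<ge> 0" using M0 R by simp
    show "\<forall>\<Omega>. 0 < \<Omega> \<and> \<Omega> \<le> \<Omega>0 \<and> (\<forall>k. k \<noteq> 0 \<longrightarrow> \<bar>\<phi> k + 2 * \<Omega>\<bar> \<ge> c / \<l> k ^ N) \<longrightarrow>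
      (\<exists>\<epsilon>. floquet (2 * M0 * R) a \<Omega> \<epsilon>)"
    proof (intro allI impI)
      fix \<Omega> :: real
      assume "0 < \<Omega> \<and> \<Omega> \<le> \<Omega>0 \<and> (\<forall>k. k \<noteq> 0 \<longrightarrow> \<bar>\<phi> k + 2 * \<Omega>\<bar> \<ge> c / \<l> k ^ N)"
      then have \<Omega>: "0 < \<Omega>" "\<Omega> \<le> \<Omega>0"
        and sd': "\<And>k. k \<noteq> 0 \<Longrightarrow> \<bar>\<phi> k + 2 * \<Omega>\<bar> \<ge> c / \<l> k ^ N" by auto
      have \<Omega>1: "\<Omega> \<le> 1" using \<Omega> \<Omega>0_le by simp
      have sq: "\<Omega>\<^sup>2 \<le> \<Omega>0"
      proof -
        have "\<Omega> * \<Omega> \<le> \<Omega> * 1" using \<Omega> \<Omega>1 by (intro mult_left_mono) auto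
        with \<Omega>(2) show ?thesis by (simp add: power2_eq_square)
      qed
      show "\<exists>\<epsilon>. floquet (2 * M0 * R) a \<Omega> \<epsilon>"
        unfolding R_def
      proof (rule newton_iteration[OF c' s' N _ _ a' a(2,3) \<Omega>(1) \<Omega>1 C2_def v(2) q(2) _ e1_def M_def M0_def b_def refl])
        show "\<bar>\<phi> k\<bar> \<ge> c' / \<l> k ^ N" if "k \<noteq> 0" for k using sd[OF that] cc[of k] by simp
        show "\<bar>\<phi> k + 2 * \<Omega>\<bar> \<ge> c' / \<l> k ^ N" if "k \<noteq> 0" for k using sd'[OF that] cc[of k] by simp
        have "3 * q * A \<le> abar / 4" using q(3) A by (simp add: field_simps)
        moreover have "2 * \<Omega> * C2 \<le> abar / 4"
          using order_trans[OF \<Omega>(2) \<Omega>0_le(2)] C2 by (simp add: field_simps)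
        ultimately show "3 * q * A + 2 * \<Omega> * C2 \<le> abar / 2" by simp
        have "\<Omega>\<^sup>2 * (R * M0\<^sup>2 * b\<^sup>2) \<le> \<Omega>0 * (R * M0\<^sup>2 * b\<^sup>2)" using sq R by (intro mult_right_mono) auto
        also have "\<dots> \<le> 1" using \<Omega>0_le(3) R M0 b by (simp add: le_divide_eq)
        finally show "(A / abar + 1) * \<Omega>\<^sup>2 * M0\<^sup>2 * b\<^sup>2 \<le> 1" by (simp add: R_def mult_ac)
        have "\<Omega>\<^sup>2 * (2 * M0 * R) \<le> \<Omega>0 * (2 * M0 * R)" using sq R M0 by (intro mult_right_mono) auto
        also have "\<dots> \<le> v" using \<Omega>0_le(4) R M0 by (simp add: le_divide_eq)
        finally show "2 * M0 * ((A / abar + 1) * \<Omega>\<^sup>2) \<le> v"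
          unfolding R_def[symmetric] by (simp add: mult_ac)
      qed
    qed
  qed (rule \<Omega>0)
qed

end

subsection \<open>Consequences of a Floquet solution\<close>

text \<open>With \<open>z\<^sub>j = i\<Omega>\<^sub>j + w\<^sub>j\<close>, the difference \<open>d = z\<^sub>2 - cnj z\<^sub>1\<close> satisfies
  \<open>(Ln d)' = - (z\<^sub>2 + cnj z\<^sub>1) - (\<epsilon>\<^sub>2 - cnj \<epsilon>\<^sub>1) a / d\<close>; take time averages.\<close>

lemma floquet_compare:
  fixes abar :: real
  assumes F: "floquet C a \<Omega>1 \<epsilon>1" "floquet C a \<Omega>2 \<epsilon>2"
    and a: "\<And>t. norm (a t) \<le> A" "\<And>t. cnj (a t) = a t" "mean a (of_real abar)"
    and \<Omega>: "0 \<le> \<Omega>1" "0 \<le> \<Omega>2" "S = \<Omega>1 + \<Omega>2" "S > 0" and C: "C \<ge> 0" "C * S \<le> 1/2"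
  shows "norm (of_real (\<Omega>2\<^sup>2 - \<Omega>1\<^sup>2) - (\<epsilon>2 - cnj \<epsilon>1) * of_real abar) \<le> 2 * A * C * S * norm (\<epsilon>2 - cnj \<epsilon>1)"
proof -
  from F(1) obtain U1 w1 where 1: "bounded (range U1)" "\<And>t. (U1 has_vector_derivative w1 t) (at t)"
    "\<And>t. norm (w1 t) \<le> C * \<Omega>1\<^sup>2"
    "\<And>t. (w1 has_vector_derivative - (2 * \<i> * \<Omega>1 * w1 t + (w1 t)\<^sup>2 + \<epsilon>1 * a t - \<Omega>1\<^sup>2)) (at t)"
    unfolding floquet_def by blast
  from F(2) obtain U2 w2 where 2: "bounded (range U2)" "\<And>t. (U2 has_vector_derivative w2 t) (at t)"
    "\<And>t. norm (w2 t) \<le> C * \<Omega>2\<^sup>2"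
    "\<And>t. (w2 has_vector_derivative - (2 * \<i> * \<Omega>2 * w2 t + (w2 t)\<^sup>2 + \<epsilon>2 * a t - \<Omega>2\<^sup>2)) (at t)"
    unfolding floquet_def by blast
  from a(3) obtain p where p: "bounded (range p)" "\<And>t. (p has_vector_derivative a t - of_real abar) (at t)"
    unfolding mean_def by blast
  define e where "e t = w2 t - cnj (w1 t)" for t
  define d where "d t = \<i> * of_real S + e t" for t
  define \<Delta> where "\<Delta> = \<epsilon>2 - cnj \<epsilon>1"
  have e: "norm (e t) \<le> C * S\<^sup>2" for t
  proof -
    have "norm (e t) \<le> C * \<Omega>2\<^sup>2 + C * \<Omega>1\<^sup>2"
      unfolding e_def using norm_triangle_ineq4[of "w2 t" "cnj (w1 t)"] 1(3)[of t] 2(3)[of t]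
      by simp
    also have "\<dots> \<le> C * S\<^sup>2"
      using \<Omega> C unfolding distrib_left[symmetric] by (intro mult_left_mono) (auto simp: power2_eq_square algebra_simps)
    finally show ?thesis .
  qed
  have e2: "norm (e t) \<le> S / 2" for t
  proof -
    have "C * S * S \<le> 1 / 2 * S" using C(2) \<Omega>(4) by (intro mult_right_mono) auto
    then have "C * S\<^sup>2 \<le> S / 2" by (simp add: power2_eq_square mult.assoc)
    with e[of t] show ?thesis by linarith
  qed
  have d_ge: "norm (d t) \<ge> S / 2" for t
    using norm_triangle_ineq2[of "\<i> * of_real S" "- e t"] e2[of t] \<Omega>(4) by (simp add: d_def norm_mult)
  have dnz: "d t \<noteq> 0" for t using d_ge[of t] \<Omega>(4) by auto
  \<comment> \<open>Dividing by the dominant part of \<open>d\<close> keeps the argument in the disc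
    of radius 1/2 around 1, where the principal branch is holomorphic and bounded.\<close>
  define L where "L t = Ln (d t / (\<i> * of_real S))" for t
  have near1: "d t / (\<i> * of_real S) \<in> cball 1 (1/2)" for t
  proof -
    have "d t / (\<i> * of_real S) - 1 = e t / (\<i> * of_real S)"
      using \<Omega>(4) by (simp add: d_def field_simps)
    then have "norm (d t / (\<i> * of_real S) - 1) = norm (e t) / S"
      using \<Omega>(4) by (simp add: norm_divide norm_mult)
    also have "\<dots> \<le> 1/2" using e2[of t] \<Omega>(4) by (simp add: field_simps)
    finally show ?thesis by (simp add: dist_norm norm_minus_commute)
  qed
  have cb: "z \<notin> \<real>\<^sub>\<le>\<^sub>0" if "z \<in> cball 1 (1/2)" for z :: complex
  proof -
    have "\<bar>Re (1 - z)\<bar> \<le> 1/2" using that abs_Re_le_cmod[of "1 - z"] by (simp add: dist_norm)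
    then show ?thesis by (auto simp: complex_nonpos_Reals_iff)
  qed
  have "compact (Ln ` cball (1::complex) (1/2))"
    by (intro compact_continuous_image continuous_on_Ln continuous_intros) (use cb in auto)
  then have bL: "bounded (range L)"
    using near1 by (intro bounded_subset[OF compact_imp_bounded]) (auto simp: L_def)
  have d': "(d has_vector_derivative - (\<i> * (\<Omega>2 - \<Omega>1) + w2 t + cnj (w1 t)) * d t - \<Delta> * a t) (at t)" for t
  proof -
    have "(d has_vector_derivative 0 + (- (2 * \<i> * \<Omega>2 * w2 t + (w2 t)\<^sup>2 + \<epsilon>2 * a t - \<Omega>2\<^sup>2) -
        cnj (- (2 * \<i> * \<Omega>1 * w1 t + (w1 t)\<^sup>2 + \<epsilon>1 * a t - \<Omega>1\<^sup>2)))) (at t)"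
      unfolding d_def e_def
      by (intro has_vector_derivative_add has_vector_derivative_const has_vector_derivative_diff 2(4)
            has_vector_derivative_cnj 1(4))
    moreover have "0 + (- (2 * \<i> * \<Omega>2 * w2 t + (w2 t)\<^sup>2 + \<epsilon>2 * a t - \<Omega>2\<^sup>2) -
        cnj (- (2 * \<i> * \<Omega>1 * w1 t + (w1 t)\<^sup>2 + \<epsilon>1 * a t - \<Omega>1\<^sup>2))) =
        - (\<i> * (\<Omega>2 - \<Omega>1) + w2 t + cnj (w1 t)) * d t - \<Delta> * a t"
      by (simp add: d_def e_def \<Delta>_def \<Omega>(3) a(2) power2_eq_square algebra_simps)
    ultimately show ?thesis by (simp only:)
  qed
  have L': "(L has_vector_derivative - (\<i> * (\<Omega>2 - \<Omega>1) + w2 t + cnj (w1 t)) - \<Delta> * a t / d t) (at t)" for t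
  proof -
    have "((\<lambda>t. d t / (\<i> * of_real S)) has_vector_derivative
        (- (\<i> * (\<Omega>2 - \<Omega>1) + w2 t + cnj (w1 t)) * d t - \<Delta> * a t) / (\<i> * of_real S)) (at t)"
      by (rule has_vector_derivative_divide[OF d'])
    from field_vector_diff_chain_at[OF this has_field_derivative_Ln[OF cb[OF near1]]]
    have "(L has_vector_derivative (- (\<i> * (\<Omega>2 - \<Omega>1) + w2 t + cnj (w1 t)) * d t - \<Delta> * a t) / (\<i> * of_real S) *
        inverse (d t / (\<i> * of_real S))) (at t)"
      by (simp add: L_def[abs_def] o_def)
    moreover have "(- (\<i> * (\<Omega>2 - \<Omega>1) + w2 t + cnj (w1 t)) * d t - \<Delta> * a t) / (\<i> * of_real S) *
        inverse (d t / (\<i> * of_real S)) = - (\<i> * (\<Omega>2 - \<Omega>1) + w2 t + cnj (w1 t)) - \<Delta> * a t / d t"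
      using dnz[of t] \<Omega>(4) by (simp add: field_simps)
    ultimately show ?thesis by (simp only:)
  qed
  \<comment> \<open>The added bounded terms cancel \<open>w2\<close> and \<open>cnj w1\<close> and
    replace \<open>a / (i * S)\<close> by its mean. What remains of the derivative is the constant
    \<open>c\<close> and an error containing \<open>1 / d - 1 / (i * S)\<close>, which is at most
    \<open>2 * C\<close> in modulus.\<close>
  define Y where "Y t = L t + U2 t + cnj (U1 t) + \<Delta> / (\<i> * of_real S) * p t" for t
  have bY: "bounded (range Y)"
  proof -
    have "bounded (range (\<lambda>t. cnj (U1 t)))" using 1(1) by (simp add: bounded_iff)
    then show ?thesis unfolding Y_def
      by (intro bounded_plus_comp bounded_range_cmult bL 2(1) p(1))
  qed
  define c where "c = - (\<i> * (\<Omega>2 - \<Omega>1)) - \<Delta> * of_real abar / (\<i> * of_real S)"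
  define Y' where "Y' t = c - \<Delta> * a t * (1 / d t - 1 / (\<i> * of_real S))" for t
  have Y': "(Y has_vector_derivative Y' t) (at t)" for t
  proof -
    have "(Y has_vector_derivative - (\<i> * (\<Omega>2 - \<Omega>1) + w2 t + cnj (w1 t)) - \<Delta> * a t / d t + w2 t + cnj (w1 t)
        + \<Delta> / (\<i> * of_real S) * (a t - of_real abar)) (at t)"
      unfolding Y_def
      by (intro has_vector_derivative_add L' 2(2) has_vector_derivative_cnj 1(2) has_vector_derivative_mult_right p(2))
    moreover have "- (\<i> * (\<Omega>2 - \<Omega>1) + w2 t + cnj (w1 t)) - \<Delta> * a t / d t + w2 t + cnj (w1 t)
        + \<Delta> / (\<i> * of_real S) * (a t - of_real abar) = Y' t"
      by (simp add: Y'_def c_def algebra_simps diff_divide_distrib)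
    ultimately show ?thesis by (simp only:)
  qed
  have "norm c \<le> norm \<Delta> * A * (2 * C)"
  proof (rule bounded_primitive_norm_le[OF bY Y'])
    fix t
    have "1 / d t - 1 / (\<i> * of_real S) = - e t / (d t * (\<i> * of_real S))"
      using dnz[of t] \<Omega>(4) by (simp add: d_def field_simps)
    then have "norm (1 / d t - 1 / (\<i> * of_real S)) = norm (e t) / (norm (d t) * S)"
      using \<Omega>(4) by (simp add: norm_divide norm_mult)
    also have "\<dots> \<le> (C * S\<^sup>2) / (S / 2 * S)"
      using e[of t] d_ge[of t] \<Omega>(4) C(1) by (intro frac_le mult_right_mono) auto
    also have "\<dots> = 2 * C" using \<Omega>(4) by (simp add: power2_eq_square field_simps)
    finally have "norm (\<Delta> * a t * (1 / d t - 1 / (\<i> * of_real S))) \<le> norm \<Delta> * A * (2 * C)"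
      using a(1)[of t] order_trans[OF norm_ge_zero a(1)] unfolding norm_mult by (intro mult_mono) auto
    then show "norm (Y' t - c) \<le> norm \<Delta> * A * (2 * C)" by (simp add: Y'_def)
  qed
  \<comment> \<open>Multiplication by \<open>i * S\<close> turns
    \<open>\<Omega>2 - \<Omega>1\<close> into the difference of squares and supplies the factor
    \<open>S\<close> that makes the error small.\<close>
  then have "S * norm c \<le> S * (norm \<Delta> * A * (2 * C))" using \<Omega>(4) by (intro mult_left_mono) auto
  moreover have "S * norm c = norm (\<i> * of_real S * c)" using \<Omega>(4) by (simp add: norm_mult)
  moreover have "\<i> * of_real S * c = of_real (\<Omega>2\<^sup>2 - \<Omega>1\<^sup>2) - \<Delta> * of_real abar"
  proof -
    have "\<i> * of_real S * (\<Delta> * of_real abar / (\<i> * of_real S)) = \<Delta> * of_real abar"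
      using \<Omega>(4) by simp
    moreover have "\<i> * of_real S * - (\<i> * (\<Omega>2 - \<Omega>1)) = of_real (\<Omega>2\<^sup>2 - \<Omega>1\<^sup>2)"
      by (simp add: \<Omega>(3) algebra_simps power2_eq_square)
    ultimately show ?thesis unfolding c_def right_diff_distrib by simp
  qed
  ultimately show ?thesis by (simp add: \<Delta>_def mult_ac)
qed

text \<open>The trivial solution anchors the map
  \<open>\<Omega>\<^sup>2 \<mapsto> \<epsilon>\<close> at the origin: comparison with it shows that
  \<epsilon> is positive and comparable to \<open>\<Omega>\<^sup>2\<close>.\<close>

lemma floquet_zero: "floquet C a 0 0"
  unfolding floquet_def by (intro exI[of _ "\<lambda>t. 0"]) auto

text \<open>For a real solution \<open>x\<close>, the Wronskian \<open>X (x' - z x)\<close> with the complex solution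
  \<open>X = exp (i\<Omega>t + U)\<close> is constant and controls both \<open>x\<close> and \<open>x'\<close>, as \<open>Im z\<close> is bounded below.\<close>

lemma floquet_imp_lyapunov_stable:
  assumes F: "floquet C (\<lambda>t. of_real (a t)) \<Omega> (of_real \<epsilon>)" and \<Omega>: "\<Omega> > 0" "C * \<Omega> \<le> 1/2"
  shows "lyapunov_stable (hill_field \<epsilon> a) (0, 0)"
proof -
  from F obtain U w where U: "bounded (range U)" "\<And>t. (U has_vector_derivative w t) (at t)"
    and w: "\<And>t. norm (w t) \<le> C * \<Omega>\<^sup>2"
    "\<And>t. (w has_vector_derivative - (2 * \<i> * \<Omega> * w t + (w t)\<^sup>2 + \<epsilon> * a t - \<Omega>\<^sup>2)) (at t)"
    unfolding floquet_def by auto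
  obtain B where B: "\<And>t. norm (U t) \<le> B" using U(1) by (auto simp: bounded_iff)
  define z where "z t = \<i> * of_real \<Omega> + w t" for t
  define X where "X t = exp (\<i> * of_real \<Omega> * of_real t + U t)" for t
  have w2: "norm (w t) \<le> \<Omega> / 2" for t
  proof -
    have "C * \<Omega> * \<Omega> \<le> 1 / 2 * \<Omega>" using \<Omega> by (intro mult_right_mono) auto
    then have "C * \<Omega>\<^sup>2 \<le> \<Omega> / 2" by (simp add: power2_eq_square mult.assoc)
    with w(1)[of t] show ?thesis by linarith
  qed
  have zIm: "Im (z t) \<ge> \<Omega> / 2" for t
    using w2[of t] abs_Im_le_cmod[of "w t"] by (simp add: z_def)
  have znorm: "norm (z t) \<le> 2 * \<Omega>" for t
    using norm_triangle_ineq[of "\<i> * of_real \<Omega>" "w t"] w2[of t] \<Omega>(1) by (simp add: z_def norm_mult)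
  have Xnorm: "norm (X t) \<le> exp B" "norm (X t) \<ge> exp (- B)" for t
    using B[of t] abs_Re_le_cmod[of "U t"] by (auto simp: X_def)
  have X': "(X has_vector_derivative z t * X t) (at t)" for t
  proof -
    have "((\<lambda>t. \<i> * of_real \<Omega> * of_real t + U t) has_vector_derivative z t) (at t)"
      unfolding z_def by (auto intro!: derivative_eq_intros U(2))
    from field_vector_diff_chain_at[OF this DERIV_exp] show ?thesis
      by (simp add: X_def[abs_def] o_def)
  qed
  have z': "(z has_vector_derivative - ((z t)\<^sup>2 + \<epsilon> * a t)) (at t)" for t
  proof -
    have "(z has_vector_derivative 0 + - (2 * \<i> * \<Omega> * w t + (w t)\<^sup>2 + \<epsilon> * a t - \<Omega>\<^sup>2)) (at t)"
      unfolding z_def by (intro has_vector_derivative_add has_vector_derivative_const w(2))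
    moreover have "0 + - (2 * \<i> * \<Omega> * w t + (w t)\<^sup>2 + \<epsilon> * a t - \<Omega>\<^sup>2) = - ((z t)\<^sup>2 + \<epsilon> * a t)"
      by (simp add: z_def power2_eq_square algebra_simps)
    ultimately show ?thesis by (simp only:)
  qed
  \<comment> \<open>With \<open>g = v - x * z\<close>, the position is at most
    \<open>2 / \<Omega>\<close> times \<open>norm g\<close>, and the velocity at most
    \<open>1 + (2 / \<Omega>) * (2 * \<Omega>) = 5\<close> times. The factor
    \<open>exp (2 * B)\<close> bounds the ratio of two values of \<open>norm X\<close>, and
    \<open>1 + 2 * \<Omega>\<close> bounds the initial \<open>norm g\<close> by the initial
    state.\<close>
  define K where "K = (2 / \<Omega> + 5) * (exp (2 * B) * (1 + 2 * \<Omega>))"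
  have K: "K > 0" using \<Omega>(1) by (auto simp: K_def intro!: mult_pos_pos add_pos_pos)
  show ?thesis
    unfolding lyapunov_stable_def
  proof (intro conjI allI impI)
    show "hill_field \<epsilon> a t (0, 0) = 0" for t by (simp add: hill_field_def zero_prod_def)
    fix t0 \<eta> :: real
    assume \<eta>: "\<eta> > 0"
    show "\<exists>\<delta>>0. \<forall>T\<ge>t0. \<forall>y. (\<forall>t\<in>{t0..T}. (y has_vector_derivative hill_field \<epsilon> a t (y t)) (at t within {t0..T})) \<longrightarrow>
        dist (y t0) (0, 0) < \<delta> \<longrightarrow> (\<forall>t\<in>{t0..T}. dist (y t) (0, 0) < \<eta>)"
    proof (intro exI[of _ "\<eta> / K"] conjI allI impI ballI)
      show "\<eta> / K > 0" using \<eta> K by simp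
      fix T y t
      assume T: "T \<ge> t0" and y: "\<forall>t\<in>{t0..T}. (y has_vector_derivative hill_field \<epsilon> a t (y t)) (at t within {t0..T})"
        and y0: "dist (y t0) (0, 0) < \<eta> / K" and t: "t \<in> {t0..T}"
      define x v where "x s = fst (y s)" and "v s = snd (y s)" for s
      have hf: "hill_field \<epsilon> a s (y s) = (v s, - (\<epsilon> * a s * x s))" for s
        by (simp add: hill_field_def x_def v_def case_prod_unfold)
      define g where "g s = of_real (v s) - of_real (x s) * z s" for s
      have x': "((\<lambda>s. of_real (x s) :: complex) has_vector_derivative of_real (v s)) (at s within {t0..T})"
        if "s \<in> {t0..T}" for s
        using bounded_linear.has_vector_derivative[OF bounded_linear_fst bspec[OF y that]]
        by (intro has_vector_derivative_of_real) (simp add: hf x_def[abs_def] has_real_derivative_iff_has_vector_derivative)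
      have v': "((\<lambda>s. of_real (v s) :: complex) has_vector_derivative of_real (- (\<epsilon> * a s * x s))) (at s within {t0..T})"
        if "s \<in> {t0..T}" for s
        using bounded_linear.has_vector_derivative[OF bounded_linear_snd bspec[OF y that]]
        by (intro has_vector_derivative_of_real) (simp add: hf v_def[abs_def] has_real_derivative_iff_has_vector_derivative)
      have "((\<lambda>s. X s * g s) has_vector_derivative 0) (at s within {t0..T})" if s: "s \<in> {t0..T}" for s
      proof -
        have "((\<lambda>s. X s * g s) has_vector_derivative
          X s * (of_real (- (\<epsilon> * a s * x s)) - (of_real (x s) * - ((z s)\<^sup>2 + \<epsilon> * a s) + of_real (v s) * z s)) + z s * X s * g s)
          (at s within {t0..T})"
          unfolding g_def
          by (intro has_vector_derivative_mult has_vector_derivative_diff v'[OF s] x'[OF s]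
              has_vector_derivative_at_within[OF z'] has_vector_derivative_at_within[OF X'])
        moreover have "X s * (of_real (- (\<epsilon> * a s * x s)) - (of_real (x s) * - ((z s)\<^sup>2 + \<epsilon> * a s) + of_real (v s) * z s)) + z s * X s * g s = 0"
          by (simp add: g_def algebra_simps power2_eq_square)
        ultimately show ?thesis by (simp only:)
      qed
      then obtain c where c: "\<And>s. s \<in> {t0..T} \<Longrightarrow> X s * g s = c"
        using has_vector_derivative_zero_constant[of "{t0..T}" "\<lambda>s. X s * g s"] by auto
      have "X t * g t = X t0 * g t0" using c[OF t] c[of t0] T by simp
      then have "norm (X t) * norm (g t) = norm (X t0) * norm (g t0)" by (simp flip: norm_mult)
      then have "exp (- B) * norm (g t) \<le> exp B * norm (g t0)"
        using mult_right_mono[OF Xnorm(2)[of t], of "norm (g t)"] mult_right_mono[OF Xnorm(1)[of t0], of "norm (g t0)"]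
        by simp
      then have "exp B * (exp (- B) * norm (g t)) \<le> exp B * (exp B * norm (g t0))" by (intro mult_left_mono) auto
      then have gt: "norm (g t) \<le> exp (2 * B) * norm (g t0)"
        by (simp add: mult_exp_exp flip: mult.assoc)
      have xn: "\<bar>x t0\<bar> \<le> norm (y t0)" "\<bar>v t0\<bar> \<le> norm (y t0)"
        using norm_fst_le[of "fst (y t0)" "snd (y t0)"] norm_snd_le[of "snd (y t0)" "fst (y t0)"] by (auto simp: x_def v_def)
      have "norm (g t0) \<le> \<bar>v t0\<bar> + \<bar>x t0\<bar> * norm (z t0)"
        unfolding g_def by (rule order_trans[OF norm_triangle_ineq4]) (simp add: norm_mult)
      also have "\<dots> \<le> norm (y t0) + norm (y t0) * (2 * \<Omega>)"
        using xn znorm by (intro add_mono mult_mono) auto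
      finally have g0: "norm (g t0) \<le> (1 + 2 * \<Omega>) * norm (y t0)" by (simp add: algebra_simps)
      have xt: "\<bar>x t\<bar> \<le> 2 / \<Omega> * norm (g t)"
      proof -
        \<comment> \<open>Since \<open>x\<close> and \<open>v\<close> are real, the imaginary part
          of \<open>g\<close> is \<open>- x * Im z\<close>; it alone determines the
          position.\<close>
        have "\<bar>x t\<bar> * (\<Omega> / 2) \<le> \<bar>x t\<bar> * \<bar>Im (z t)\<bar>" using zIm[of t] by (intro mult_left_mono) auto
        also have "\<dots> = \<bar>Im (g t)\<bar>" by (simp add: g_def abs_mult)
        also have "\<dots> \<le> norm (g t)" by (rule abs_Im_le_cmod)
        finally show ?thesis using \<Omega>(1) by (simp add: field_simps)
      qed
      have vt: "\<bar>v t\<bar> \<le> 5 * norm (g t)"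
      proof -
        have "of_real (v t) = g t + of_real (x t) * z t" by (simp add: g_def)
        then have "\<bar>v t\<bar> \<le> norm (g t) + \<bar>x t\<bar> * norm (z t)"
          by (metis norm_mult norm_of_real norm_triangle_ineq)
        also have "\<dots> \<le> norm (g t) + (2 / \<Omega> * norm (g t)) * (2 * \<Omega>)"
          using xt znorm \<Omega>(1) by (intro add_mono mult_mono) auto
        finally show ?thesis using \<Omega>(1) by simp
      qed
      have "norm (y t) \<le> \<bar>x t\<bar> + \<bar>v t\<bar>"
        using norm_Pair_le[of "x t" "v t"] by (simp add: x_def v_def)
      also have "\<dots> \<le> (2 / \<Omega> + 5) * norm (g t)" using xt vt by (simp add: algebra_simps)
      also have "\<dots> \<le> (2 / \<Omega> + 5) * (exp (2 * B) * ((1 + 2 * \<Omega>) * norm (y t0)))"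
        using \<Omega>(1) by (intro mult_left_mono order_trans[OF gt] g0) auto
      also have "\<dots> = K * norm (y t0)" by (simp add: K_def)
      also have "\<dots> < \<eta>"
        using y0 K by (simp add: dist_norm zero_prod_def[symmetric] field_simps)
      finally show "dist (y t) (0, 0) < \<eta>" by (simp add: dist_norm zero_prod_def[symmetric])
    qed
  qed
qed

subsection \<open>Transfer of measure\<close>

text \<open>McShane's extension, wanted because the intermediate value theorem needs an interval
  while \<open>T\<close> may be full of holes. The lower bound survives since
  \<open>l \<le> L\<close>: the cone with slope \<open>L\<close> at \<open>y\<close> starts above
  the line \<open>l * s\<close> and rises at least as fast.\<close>

lemma lipschitz_extension_real:
  fixes e :: "real \<Rightarrow> real"
  assumes T: "0 \<in> T" "T \<subseteq> {0..}" and e0: "e 0 = 0"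
    and lip: "\<And>s t. s \<in> T \<Longrightarrow> t \<in> T \<Longrightarrow> \<bar>e s - e t\<bar> \<le> L * \<bar>s - t\<bar>"
    and l: "0 < l" "l \<le> L" "\<And>s. s \<in> T \<Longrightarrow> l * s \<le> e s"
  obtains g where "\<And>s. s \<in> T \<Longrightarrow> g s = e s" "\<And>s t. \<bar>g s - g t\<bar> \<le> L * \<bar>s - t\<bar>" "\<And>s. l * s \<le> g s"
proof -
  define g where "g s = (INF y\<in>T. e y + L * \<bar>s - y\<bar>)" for s
  have lower: "l * s \<le> e y + L * \<bar>s - y\<bar>" if "y \<in> T" for s y
  proof -
    have "l * s \<le> l * y + l * \<bar>s - y\<bar>"
      using l(1) by (simp flip: distrib_left)
    also have "\<dots> \<le> e y + L * \<bar>s - y\<bar>"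
      using l that by (intro add_mono mult_right_mono) auto
    finally show ?thesis .
  qed
  have bdd: "bdd_below ((\<lambda>y. e y + L * \<bar>s - y\<bar>) ` T)" for s
    using lower by (intro bdd_belowI2)
  have up: "g s \<le> e y + L * \<bar>s - y\<bar>" if "y \<in> T" for s y
    unfolding g_def by (rule cINF_lower[OF bdd that])
  have L: "L \<ge> 0" using l by simp
  have half: "g s \<le> g t + L * \<bar>s - t\<bar>" for s t
  proof -
    have "g s - L * \<bar>s - t\<bar> \<le> e y + L * \<bar>t - y\<bar>" if "y \<in> T" for y
    proof -
      have "L * \<bar>s - y\<bar> \<le> L * (\<bar>s - t\<bar> + \<bar>t - y\<bar>)" using L by (intro mult_left_mono) auto
      with up[OF that, of s] show ?thesis by (simp add: distrib_left)
    qed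
    then have "g s - L * \<bar>s - t\<bar> \<le> g t" unfolding g_def[of t] using T(1) by (intro cINF_greatest) auto
    then show ?thesis by simp
  qed
  show ?thesis
  proof (rule that)
    show "g s = e s" if "s \<in> T" for s
    proof (rule antisym)
      show "g s \<le> e s" using up[OF that, of s] by simp
      show "e s \<le> g s" unfolding g_def
      proof (rule cINF_greatest)
        show "T \<noteq> {}" using T by auto
        show "e s \<le> e y + L * \<bar>s - y\<bar>" if "y \<in> T" for y
          using lip[OF \<open>s \<in> T\<close> that] by linarith
      qed
    qed
    show "\<bar>g s - g t\<bar> \<le> L * \<bar>s - t\<bar>" for s t
      using half[of s t] half[of t s] by (auto simp: abs_le_iff abs_minus_commute)
    show "l * s \<le> g s" for s
      unfolding g_def using T lower by (intro cINF_greatest) auto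
  qed
qed

lemma measure_UN_intervals_le:
  fixes J :: "nat \<Rightarrow> real set"
  assumes J: "\<And>n. \<exists>a. J n = {} \<or> J n = {a - \<beta> n..a + \<beta> n}" and \<beta>: "\<And>n. \<beta> n \<ge> 0" "\<beta> sums S"
  shows "(\<Union>n. J n) \<in> lmeasurable" "measure lebesgue (\<Union>n. J n) \<le> 2 * S"
proof -
  have Js: "J n \<in> sets lebesgue" for n
    using J[of n] by auto
  have em: "emeasure lebesgue (J n) \<le> ennreal (2 * \<beta> n)" for n
    using J[of n] \<beta>(1)[of n] by auto
  have "emeasure lebesgue (\<Union>n. J n) \<le> (\<Sum>n. emeasure lebesgue (J n))"
    by (rule emeasure_subadditive_countably) (use Js in auto)
  also have "\<dots> \<le> (\<Sum>n. ennreal (2 * \<beta> n))" by (intro suminf_le em) auto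
  also have "\<dots> = ennreal (2 * S)"
    using \<beta> by (intro suminf_ennreal_eq sums_mult) auto
  finally have *: "emeasure lebesgue (\<Union>n. J n) \<le> ennreal (2 * S)" .
  show "(\<Union>n. J n) \<in> lmeasurable"
    using Js * by (intro fmeasurableI) (auto simp: less_top[symmetric] top_unique)
  have "S \<ge> 0" using \<beta> suminf_nonneg[of \<beta>] by (auto simp: sums_iff)
  with * show "measure lebesgue (\<Union>n. J n) \<le> 2 * S"
    unfolding measure_def by (intro enn2real_leI) auto
qed

text \<open>Here \<open>s\<close> plays the role of the squared rotation number and \<open>e s\<close> that of the
  corresponding value of \<open>\<epsilon>\<close>.\<close>

lemma for_most_small_of_cover:
  fixes e :: "real \<Rightarrow> real"
  assumes T: "T \<subseteq> {0<..}" and e0: "e 0 = 0"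
    and lip: "\<And>s t. s \<in> insert 0 T \<Longrightarrow> t \<in> insert 0 T \<Longrightarrow> \<bar>e s - e t\<bar> \<le> L * \<bar>s - t\<bar>"
    and l: "0 < l" "l \<le> L" "\<And>s. s \<in> T \<Longrightarrow> l * s \<le> e s"
    and P: "\<And>s. s \<in> T \<Longrightarrow> P (e s)"
    and sm: "sm > 0"
    and cover: "\<And>s0. 0 < s0 \<Longrightarrow> s0 \<le> sm \<Longrightarrow> \<exists>(B :: nat \<Rightarrow> real set) \<beta> S. {0<..s0} - T \<subseteq> (\<Union>n. B n) \<and>
       (\<forall>n. \<forall>x\<in>B n. \<forall>y\<in>B n. \<bar>x - y\<bar> \<le> \<beta> n) \<and> (\<forall>n. \<beta> n \<ge> 0) \<and> \<beta> sums S \<and> S \<le> D * (s0 * sqrt s0)"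
  shows "for_most_small P"
proof -
  have T': "0 \<in> insert 0 T" "insert 0 T \<subseteq> {0..}" using T by auto
  have l': "l * s \<le> e s" if "s \<in> insert 0 T" for s using that l(3) e0 by auto
  obtain g where g: "\<And>s. s \<in> insert 0 T \<Longrightarrow> g s = e s"
    "\<And>s t. \<bar>g s - g t\<bar> \<le> L * \<bar>s - t\<bar>" "\<And>s. l * s \<le> g s"
    by (rule lipschitz_extension_real[OF T' e0 lip l(1,2) l']) (assumption | rule that)+
  have L: "L > 0" using l by simp
  have g0: "g 0 = 0" using g(1)[of 0] e0 by simp
  have "continuous_on {0..sm} g"
    by (rule lipschitz_on_continuous_on[of L]) (use g(2) L in \<open>auto simp: lipschitz_on_def dist_real_def\<close>)
  note cont = this
  \<comment> \<open>The covering intervals have radius \<open>L * \<beta> n\<close>, so their total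
    length is at most \<open>2 * L * D * (s0 * sqrt s0)\<close>; substituting
    \<open>s0 = \<epsilon>0 / l\<close> leaves this factor of
    \<open>\<epsilon>0 * sqrt \<epsilon>0\<close>.\<close>
  define \<kappa> where "\<kappa> = 2 * L * D * (1 / l) * sqrt (1 / l)"
  have ex: "\<exists>E. E \<in> sets lebesgue \<and> E \<subseteq> {0<..<\<epsilon>0} \<and> (\<forall>\<epsilon>\<in>E. P \<epsilon>) \<and> \<epsilon>0 - \<kappa> * (\<epsilon>0 * sqrt \<epsilon>0) \<le> measure lebesgue E"
    if \<epsilon>0: "0 < \<epsilon>0" "\<epsilon>0 \<le> l * sm" for \<epsilon>0
  proof -
    \<comment> \<open>By \<open>l * s \<le> g s\<close>, every preimage of a value below
      \<open>\<epsilon>0\<close> lies below this \<open>s0\<close>.\<close>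
    define s0 where "s0 = \<epsilon>0 / l"
    have s0: "0 < s0" "s0 \<le> sm" using \<epsilon>0 l by (auto simp: s0_def field_simps)
    from cover[OF s0] obtain B :: "nat \<Rightarrow> real set" and \<beta> S where B: "{0<..s0} - T \<subseteq> (\<Union>n. B n)"
      "\<And>n x y. x \<in> B n \<Longrightarrow> y \<in> B n \<Longrightarrow> \<bar>x - y\<bar> \<le> \<beta> n" and \<beta>: "\<And>n. \<beta> n \<ge> 0" "\<beta> sums S" "S \<le> D * (s0 * sqrt s0)"
      by blast
    \<comment> \<open>The sets \<open>B n\<close> are not assumed measurable. Their images under
      \<open>g\<close> are enclosed in closed intervals around the image of an arbitrary point of
      \<open>B n\<close>, which makes the set \<open>E\<close> below measurable.\<close>
    define x where "x n = (SOME x. x \<in> B n)" for n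
    define J where "J n = (if B n = {} then {} else {g (x n) - L * \<beta> n .. g (x n) + L * \<beta> n})" for n
    have x: "x n \<in> B n" if "y \<in> B n" for n y unfolding x_def using that by (rule someI)
    have J: "g y \<in> J n" if "y \<in> B n" for n y
    proof -
      have "L * \<bar>y - x n\<bar> \<le> L * \<beta> n" using B(2)[OF that x[OF that]] L by (intro mult_left_mono) auto
      with g(2)[of y "x n"] have "\<bar>g y - g (x n)\<bar> \<le> L * \<beta> n" by linarith
      then show ?thesis using that by (auto simp: J_def)
    qed
    have J': "\<exists>a. J n = {} \<or> J n = {a - L * \<beta> n..a + L * \<beta> n}" for n by (auto simp: J_def)
    have L\<beta>: "L * \<beta> n \<ge> 0" for n using L \<beta>(1) by simp
    note mJ = measure_UN_intervals_le[OF J' L\<beta> sums_mult[OF \<beta>(2)]]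
    define E where "E = {0<..<\<epsilon>0} - (\<Union>n. J n)"
    have Em: "E \<in> lmeasurable" unfolding E_def using mJ(1) by (intro fmeasurable.Diff) auto
    have "P \<epsilon>" if "\<epsilon> \<in> E" for \<epsilon>
    proof -
      have \<epsilon>: "0 < \<epsilon>" "\<epsilon> < \<epsilon>0" "\<epsilon> \<notin> (\<Union>n. J n)" using that by (auto simp: E_def)
      have "g 0 \<le> \<epsilon>" "\<epsilon> \<le> g sm" using g0 g(3)[of sm] \<epsilon> \<epsilon>0 by auto
      \<comment> \<open>The preimage need not be unique. One outside \<open>T\<close> would lie in
        some \<open>B n\<close>, and \<epsilon> would then fall into the excluded interval
        \<open>J n\<close>.\<close>
      from IVT'[OF this _ cont] sm obtain s where s: "0 \<le> s" "s \<le> sm" "g s = \<epsilon>" by auto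
      have "s \<noteq> 0" using s(3) g0 \<epsilon> by auto
      have "l * s \<le> \<epsilon>0" using g(3)[of s] s(3) \<epsilon> by simp
      then have "s \<le> s0" using l(1) by (simp add: s0_def field_simps)
      have "s \<in> T"
      proof (rule ccontr)
        assume "s \<notin> T"
        then have "s \<in> {0<..s0} - T" using \<open>s \<noteq> 0\<close> s(1) \<open>s \<le> s0\<close> by auto
        then have "s \<in> (\<Union>n. B n)" using B(1) by blast
        then have "\<epsilon> \<in> (\<Union>n. J n)" using J s(3) by auto
        with \<epsilon> show False by simp
      qed
      with P[of s] g(1)[of s] s(3) show ?thesis by simp
    qed
    moreover have "\<epsilon>0 - \<kappa> * (\<epsilon>0 * sqrt \<epsilon>0) \<le> measure lebesgue E"
    proof -
      have "\<epsilon>0 = measure lebesgue {0<..<\<epsilon>0}" using \<epsilon>0 by simp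
      also have "\<dots> \<le> measure lebesgue (E \<union> (\<Union>n. J n))"
        using Em mJ(1) by (intro measure_mono_fmeasurable fmeasurable.Un) (auto simp: E_def)
      also have "\<dots> \<le> measure lebesgue E + measure lebesgue (\<Union>n. J n)"
        using Em mJ(1) by (intro measure_Un_le) (auto dest: fmeasurableD)
      also have "\<dots> \<le> measure lebesgue E + 2 * (L * (D * (s0 * sqrt s0)))"
        using mJ(2) \<beta>(3) L by (smt (verit) mult_left_mono)
      also have "2 * (L * (D * (s0 * sqrt s0))) = \<kappa> * (\<epsilon>0 * sqrt \<epsilon>0)"
      proof -
        have "sqrt s0 = sqrt (1 / l) * sqrt \<epsilon>0" by (simp add: s0_def real_sqrt_divide)
        then show ?thesis by (simp add: \<kappa>_def s0_def)
      qed
      finally show ?thesis by simp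
    qed
    ultimately show ?thesis using Em by (intro exI[of _ E]) (auto simp: E_def)
  qed
  define E where "E \<epsilon>0 = (SOME E. E \<in> sets lebesgue \<and> E \<subseteq> {0<..<\<epsilon>0} \<and> (\<forall>\<epsilon>\<in>E. P \<epsilon>) \<and>
      \<epsilon>0 - \<kappa> * (\<epsilon>0 * sqrt \<epsilon>0) \<le> measure lebesgue E)" for \<epsilon>0
  have E: "E \<epsilon>0 \<in> sets lebesgue" "E \<epsilon>0 \<subseteq> {0<..<\<epsilon>0}" "\<forall>\<epsilon>\<in>E \<epsilon>0. P \<epsilon>" "\<epsilon>0 - \<kappa> * (\<epsilon>0 * sqrt \<epsilon>0) \<le> measure lebesgue (E \<epsilon>0)"
    if "0 < \<epsilon>0" "\<epsilon>0 \<le> l * sm" for \<epsilon>0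
    using someI_ex[OF ex[OF that]] unfolding E_def by blast+
  have ev: "\<forall>\<^sub>F \<epsilon>0 in at_right 0. 0 < \<epsilon>0 \<and> \<epsilon>0 \<le> l * sm"
    by (rule eventually_at_rightI[of 0 "l * sm"]) (use l sm in auto)
  have lim: "((\<lambda>\<epsilon>0. measure lebesgue (E \<epsilon>0) / \<epsilon>0) \<longlongrightarrow> 1) (at_right 0)"
  proof (rule tendsto_sandwich)
    show "\<forall>\<^sub>F \<epsilon>0 in at_right 0. 1 - \<kappa> * sqrt \<epsilon>0 \<le> measure lebesgue (E \<epsilon>0) / \<epsilon>0"
      using ev
    proof eventually_elim
      case (elim \<epsilon>0)
      then show ?case using E(4)[of \<epsilon>0] by (simp add: le_divide_eq algebra_simps)
    qed
    show "\<forall>\<^sub>F \<epsilon>0 in at_right 0. measure lebesgue (E \<epsilon>0) / \<epsilon>0 \<le> 1"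
      using ev
    proof eventually_elim
      case (elim \<epsilon>0)
      have "measure lebesgue (E \<epsilon>0) \<le> measure lebesgue {0<..<\<epsilon>0}"
        using E(1,2)[of \<epsilon>0] elim by (intro measure_mono_fmeasurable) auto
      then show ?case using elim by simp
    qed
    have "((\<lambda>\<epsilon>0. 1 - \<kappa> * sqrt \<epsilon>0) \<longlongrightarrow> 1 - \<kappa> * sqrt 0) (at_right 0)"
      by (intro tendsto_intros)
    then show "((\<lambda>\<epsilon>0. 1 - \<kappa> * sqrt \<epsilon>0) \<longlongrightarrow> 1) (at_right 0)" by simp
  qed auto
  have pos: "\<forall>\<^sub>F \<epsilon>0 in at_right 0. measure lebesgue (E \<epsilon>0) > 0"
    using order_tendstoD(1)[OF lim zero_less_one] ev
    by eventually_elim (auto simp: zero_less_divide_iff)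
  show ?thesis
    unfolding for_most_small_def
  proof (intro exI[of _ E] conjI lim)
    show "\<forall>\<^sub>F \<epsilon>0 in at_right 0. E \<epsilon>0 \<in> sets lebesgue \<and> E \<epsilon>0 \<subseteq> {0<..<\<epsilon>0} \<and>
        0 < measure lebesgue (E \<epsilon>0) \<and> (\<forall>\<epsilon>\<in>E \<epsilon>0. P \<epsilon>)"
      using ev pos by eventually_elim (use E in auto)
  qed
qed

subsection \<open>Hill's equation for an absolutely convergent exponential series\<close>

context frequency_module
begin

text \<open>A resonance with \<open>\<Omega> \<le> sqrt s0\<close> together with
  \<open>c / \<l> k ^ n \<le> \<bar>\<phi> k\<bar>\<close> forces
  \<open>c / \<l> k ^ n \<le> 4 * sqrt s0\<close>. Hence \<open>2 * n\<close> of the powers of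
  \<open>1 / \<l> k\<close> in the width of the resonance are worth a factor \<open>s0\<close>,
  while \<open>p\<close> powers remain for summation over \<open>k\<close>. Passing from \<Omega> to
  \<open>\<Omega>\<^sup>2\<close> contributes another \<open>sqrt s0\<close>.\<close>

lemma resonances_small:
  fixes w :: "'k \<Rightarrow> real"
  assumes dio: "c > 0" "\<And>k. k \<noteq> 0 \<Longrightarrow> \<bar>\<phi> k\<bar> \<ge> c / \<l> k ^ n"
    and s0: "s0 > 0" and k: "k \<noteq> 0"
    and st: "s \<in> {0<..s0}" "t \<in> {0<..s0}" "\<bar>\<phi> k + 2 * sqrt s\<bar> < c / 2 / \<l> k ^ (2 * n + p + 1)"
      "\<bar>\<phi> k + 2 * sqrt t\<bar> < c / 2 / \<l> k ^ (2 * n + p + 1)"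
  shows "\<bar>s - t\<bar> \<le> 16 / c * (s0 * sqrt s0) * (1 / \<l> k ^ p)"
proof -
  let ?l = "\<l> k"
  have l1: "?l \<ge> 1" using weight_ge_1[OF k] .
  have pw: "?l ^ m > 0" "?l ^ m \<ge> 1" for m using l1 by auto
  have "c / 2 / ?l ^ (2 * n + p + 1) \<le> c / 2 / ?l ^ n"
    using dio(1) l1 by (intro divide_left_mono power_increasing mult_pos_pos) auto
  moreover have "sqrt s \<le> sqrt s0" "sqrt t \<le> sqrt s0" "0 < sqrt s" "0 < sqrt t" using st by auto
  ultimately have "c / ?l ^ n \<le> c / 2 / ?l ^ n + 2 * sqrt s0"
    using dio(2)[OF k] st(3) by linarith
  then have "c * (1 / ?l ^ n) \<le> 4 * sqrt s0" by simp
  then have "1 / ?l ^ n \<le> 4 * sqrt s0 / c" using dio(1) by (simp add: field_simps)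
  then have "(1 / ?l ^ n)\<^sup>2 \<le> (4 * sqrt s0 / c)\<^sup>2" using l1 by (intro power_mono) auto
  also have "\<dots> = 16 * s0 / c\<^sup>2" using s0 by (simp add: power_divide power_mult_distrib)
  finally have sq: "(1 / ?l ^ n)\<^sup>2 \<le> 16 * s0 / c\<^sup>2" .
  have "1 / ?l ^ (2 * n + p + 1) \<le> (1 / ?l ^ n)\<^sup>2 * (1 / ?l ^ p)"
  proof -
    have "?l ^ (2 * n + p) \<le> ?l ^ (2 * n + p + 1)" using l1 by (intro power_increasing) auto
    then have "1 / ?l ^ (2 * n + p + 1) \<le> 1 / ?l ^ (2 * n + p)"
      using pw by (intro divide_left_mono) auto
    also have "\<dots> = (1 / ?l ^ n)\<^sup>2 * (1 / ?l ^ p)"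
      by (simp add: power_add power_divide mult.commute[of 2] power_mult)
    finally show ?thesis .
  qed
  also have "\<dots> \<le> 16 * s0 / c\<^sup>2 * (1 / ?l ^ p)" using sq pw by (intro mult_right_mono) (auto intro: less_imp_le)
  finally have lN: "1 / ?l ^ (2 * n + p + 1) \<le> 16 * s0 / c\<^sup>2 * (1 / ?l ^ p)" .
  have "\<bar>sqrt s - sqrt t\<bar> \<le> c / 2 * (1 / ?l ^ (2 * n + p + 1))"
    using st(3,4) by (simp add: abs_less_iff abs_le_iff)
  also have "\<dots> \<le> c / 2 * (16 * s0 / c\<^sup>2 * (1 / ?l ^ p))" using dio(1) lN by (intro mult_left_mono) auto
  finally have diff: "\<bar>sqrt s - sqrt t\<bar> \<le> c / 2 * (16 * s0 / c\<^sup>2 * (1 / ?l ^ p))" .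
  have "\<bar>sqrt s + sqrt t\<bar> \<le> 2 * sqrt s0"
    using \<open>sqrt s \<le> sqrt s0\<close> \<open>sqrt t \<le> sqrt s0\<close> \<open>0 < sqrt s\<close> \<open>0 < sqrt t\<close> by linarith
  with diff have "\<bar>sqrt s - sqrt t\<bar> * \<bar>sqrt s + sqrt t\<bar> \<le> c / 2 * (16 * s0 / c\<^sup>2 * (1 / ?l ^ p)) * (2 * sqrt s0)"
    using dio(1) s0 l1 by (intro mult_mono) auto
  moreover have "\<bar>sqrt s - sqrt t\<bar> * \<bar>sqrt s + sqrt t\<bar> = \<bar>s - t\<bar>"
  proof -
    have "(sqrt s - sqrt t) * (sqrt s + sqrt t) = s - t" using st by (simp add: algebra_simps)
    then show ?thesis by (simp flip: abs_mult)
  qed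
  moreover have "c / 2 * (16 * s0 / c\<^sup>2 * (1 / ?l ^ p)) * (2 * sqrt s0) = 16 / c * (s0 * sqrt s0) * (1 / ?l ^ p)"
    using dio(1) by (simp add: power2_eq_square)
  ultimately show ?thesis by simp
qed

theorem stable_for_most_small:
  fixes f :: "real \<Rightarrow> real" and abar :: real and \<iota> :: "'k \<Rightarrow> nat"
  assumes s: "s > 0" and f: "qp s A (\<lambda>t. of_real (f t))" "mean (\<lambda>t. of_real (f t)) (of_real abar)" "abar > 0"
    and dio: "c > 0" "\<And>k. k \<noteq> 0 \<Longrightarrow> \<bar>\<phi> k\<bar> \<ge> c / \<l> k ^ n"
    and \<iota>: "inj \<iota>" and W: "((\<lambda>k. if k = 0 then 0 else 1 / \<l> k ^ p) has_sum W) UNIV"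
  shows "for_most_small (\<lambda>\<epsilon>. lyapunov_stable (hill_field \<epsilon> f) (0, 0))"
proof -
  \<comment> \<open>Here \<open>2 * n\<close> powers produce the factor \<open>s0\<close> in
    \<open>resonances_small\<close> and \<open>p\<close> powers make the sum over \<open>k\<close>
    converge; the last one ensures \<open>N \<ge> 1\<close>.\<close>
  define N where "N = 2 * n + p + 1"
  let ?a = "\<lambda>t. complex_of_real (f t)"
  have N: "N \<ge> 1" by (simp add: N_def)
  \<comment> \<open>The constant is halved so that a near resonance still forces
    \<open>2 * \<Omega>\<close> to be at least half of the Diophantine bound on
    \<open>\<bar>\<phi> k\<bar>\<close>.\<close>
  have c2: "c / 2 > 0" using dio by simp
  have sd: "c / 2 / \<l> k ^ N \<le> \<bar>\<phi> k\<bar>" if "k \<noteq> 0" for k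
  proof -
    have "c / 2 / \<l> k ^ N \<le> c / \<l> k ^ n"
      using dio(1) weight_ge_1[OF that] by (intro frac_le power_increasing) (auto simp: N_def)
    with dio(2)[OF that] show ?thesis by simp
  qed
  obtain C \<Omega>0 where C: "C \<ge> 0" and \<Omega>0: "\<Omega>0 > 0" and ex:
    "\<forall>\<Omega>. 0 < \<Omega> \<and> \<Omega> \<le> \<Omega>0 \<and> (\<forall>k. k \<noteq> 0 \<longrightarrow> \<bar>\<phi> k + 2 * \<Omega>\<bar> \<ge> c / 2 / \<l> k ^ N) \<longrightarrow>
      (\<exists>\<epsilon>. floquet C ?a \<Omega> \<epsilon>)"
    by (rule floquet_exists[OF c2 s N sd f]) (assumption | rule that)+
  have a_le: "norm (?a t) \<le> A" for t using qp_norm_le[OF f(1)] s by simp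
  have A: "A \<ge> 0" using qp_nonneg[OF f(1)] .
  \<comment> \<open>For sums \<open>S\<close> of two rotation numbers up to
    \<open>\<Omega>1\<close>, the second entry gives \<open>C * S \<le> 1/2\<close>, and the third
    makes the error in \<open>floquet_compare\<close> at most half of its main term.\<close>
  define \<Omega>1 where "\<Omega>1 = Min {\<Omega>0, 1 / (4 * (C + 1)), abar / (8 * (A + 1) * (C + 1))}"
  have \<Omega>1: "\<Omega>1 > 0" using \<Omega>0 C A f(3) by (auto simp: \<Omega>1_def add_nonneg_pos)
  have \<Omega>1_le: "\<Omega>1 \<le> \<Omega>0" "\<Omega>1 \<le> 1 / (4 * (C + 1))" "\<Omega>1 \<le> abar / (8 * (A + 1) * (C + 1))"
    unfolding \<Omega>1_def by (auto intro!: Min_le)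
  have small1: "C * S \<le> 1/2" if "0 \<le> S" "S \<le> 2 * \<Omega>1" for S
  proof -
    have "C * S \<le> (C + 1) * (2 * \<Omega>1)" using that C by (intro mult_mono) auto
    also have "\<dots> \<le> 1/2" using \<Omega>1_le(2) C by (simp add: le_divide_eq algebra_simps)
    finally show ?thesis .
  qed
  have small2: "2 * A * C * S \<le> abar / 2" if "0 \<le> S" "S \<le> 2 * \<Omega>1" for S
  proof -
    have "2 * A * C * S \<le> 2 * (A + 1) * (C + 1) * (2 * \<Omega>1)" using that C A by (intro mult_mono) auto
    also have "\<dots> \<le> abar / 2"
    proof -
      have "8 * (A + 1) * (C + 1) > 0" using A C by (intro mult_pos_pos) auto
      from \<Omega>1_le(3)[unfolded pos_le_divide_eq[OF this]] show ?thesis by (simp add: algebra_simps)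
    qed
    finally show ?thesis .
  qed
  have cmp: "norm (of_real (\<Omega>\<^sup>2 - \<Omega>'\<^sup>2) - (\<epsilon> - cnj \<epsilon>') * of_real abar) \<le> abar / 2 * norm (\<epsilon> - cnj \<epsilon>')"
    if "floquet C ?a \<Omega>' \<epsilon>'" "floquet C ?a \<Omega> \<epsilon>" "0 \<le> \<Omega>'" "\<Omega>' \<le> \<Omega>1" "0 \<le> \<Omega>" "\<Omega> \<le> \<Omega>1" "\<Omega>' + \<Omega> > 0"
    for \<Omega> \<Omega>' \<epsilon> \<epsilon>'
  proof -
    have S: "0 \<le> \<Omega>' + \<Omega>" "\<Omega>' + \<Omega> \<le> 2 * \<Omega>1" using that by auto
    have "norm (of_real (\<Omega>\<^sup>2 - \<Omega>'\<^sup>2) - (\<epsilon> - cnj \<epsilon>') * of_real abar) \<le> 2 * A * C * (\<Omega>' + \<Omega>) * norm (\<epsilon> - cnj \<epsilon>')"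
      by (rule floquet_compare[OF that(1,2) a_le _ f(2) that(3,5) refl that(7) C small1[OF S]]) simp
    also have "\<dots> \<le> abar / 2 * norm (\<epsilon> - cnj \<epsilon>')"
      using small2[OF S] by (rule mult_right_mono) auto
    finally show ?thesis .
  qed
  define good where "good \<Omega> \<longleftrightarrow> 0 < \<Omega> \<and> \<Omega> \<le> \<Omega>1 \<and> (\<forall>k. k \<noteq> 0 \<longrightarrow> \<bar>\<phi> k + 2 * \<Omega>\<bar> \<ge> c / 2 / \<l> k ^ N)" for \<Omega>
  have real_ex: "\<exists>e. floquet C ?a \<Omega> (of_real e)" if "good \<Omega>" for \<Omega>
  proof -
    have "\<Omega> \<le> \<Omega>0" using that \<Omega>1_le(1) unfolding good_def by linarith
    then have "\<exists>\<epsilon>. floquet C ?a \<Omega> \<epsilon>"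
      by (intro ex[rule_format]) (use that in \<open>auto simp: good_def\<close>)
    then obtain \<epsilon> where \<epsilon>: "floquet C ?a \<Omega> \<epsilon>" by blast
    have "norm (of_real (\<Omega>\<^sup>2 - \<Omega>\<^sup>2) - (\<epsilon> - cnj \<epsilon>) * of_real abar) \<le> abar / 2 * norm (\<epsilon> - cnj \<epsilon>)"
      by (rule cmp[OF \<epsilon> \<epsilon>]) (use that in \<open>auto simp: good_def\<close>)
    then have "norm (\<epsilon> - cnj \<epsilon>) = 0" using f(3) by (simp add: norm_mult mult_le_0_iff)
    then have "\<epsilon> = of_real (Re \<epsilon>)" by (auto simp: complex_eq_iff)
    with \<epsilon> show ?thesis by metis
  qed
  \<comment> \<open>Any choice will do, because the comparison holds for every pair of
    solutions.\<close>
  define e where "e x = (if x = 0 then 0 else (SOME e. floquet C ?a (sqrt x) (of_real e)))" for x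
  define T where "T = {x. 0 < x \<and> good (sqrt x)}"
  have e: "floquet C ?a (sqrt x) (of_real (e x))" if "x \<in> insert 0 T" for x
  proof (cases "x = 0")
    case False
    then have "good (sqrt x)" using that by (auto simp: T_def)
    from someI_ex[OF real_ex[OF this]] show ?thesis using False by (simp add: e_def)
  qed (use floquet_zero in \<open>simp add: e_def\<close>)
  have T_bds: "0 \<le> x" "sqrt x \<le> \<Omega>1" if "x \<in> insert 0 T" for x
    using that \<Omega>1 by (auto simp: T_def good_def)
  have ecmp: "\<bar>(x - y) - (e x - e y) * abar\<bar> \<le> abar / 2 * \<bar>e x - e y\<bar>" if "x \<in> insert 0 T" "y \<in> insert 0 T" for x y
  proof (cases "sqrt y + sqrt x > 0")
    case True
    have "norm (of_real ((sqrt x)\<^sup>2 - (sqrt y)\<^sup>2) - (of_real (e x) - cnj (of_real (e y))) * of_real abar)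
       \<le> abar / 2 * norm (of_real (e x) - cnj (of_real (e y)) :: complex)"
      by (rule cmp[OF e[OF that(2)] e[OF that(1)] _ T_bds(2)[OF that(2)] _ T_bds(2)[OF that(1)] True])
        (use T_bds(1) that in auto)
    moreover have "of_real ((sqrt x)\<^sup>2 - (sqrt y)\<^sup>2) - (of_real (e x) - cnj (of_real (e y))) * of_real abar =
        complex_of_real ((x - y) - (e x - e y) * abar)"
      using T_bds(1) that by simp
    moreover have "of_real (e x) - cnj (of_real (e y)) = complex_of_real (e x - e y)" by simp
    ultimately show ?thesis by (simp only: norm_of_real)
  next
    case False
    then have "x = 0" "y = 0" using T_bds(1)[OF that(1)] T_bds(1)[OF that(2)]
      by (auto simp: not_less add_nonneg_eq_0_iff dest: order_antisym[OF _ add_nonneg_nonneg])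
    then show ?thesis by simp
  qed
  show ?thesis
  \<comment> \<open>The constants are read off from \<open>ecmp\<close>: it places
    \<open>\<bar>x - y\<bar>\<close> between \<open>abar / 2\<close> and \<open>3 / 2 * abar\<close>
    times \<open>\<bar>e x - e y\<bar>\<close>.\<close>
  proof (rule for_most_small_of_cover[where T = T and e = e and L = "2 / abar" and l = "2 / (3 * abar)" and sm = "\<Omega>1\<^sup>2"])
    show "T \<subseteq> {0<..}" by (auto simp: T_def)
    show "e 0 = 0" by (simp add: e_def)
    show "0 < 2 / (3 * abar)" "2 / (3 * abar) \<le> 2 / abar" "0 < \<Omega>1\<^sup>2" using f(3) \<Omega>1 by (auto simp: field_simps)
    show "\<bar>e x - e y\<bar> \<le> 2 / abar * \<bar>x - y\<bar>" if "x \<in> insert 0 T" "y \<in> insert 0 T" for x y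
    proof -
      have "\<bar>(e x - e y) * abar\<bar> \<le> \<bar>x - y\<bar> + abar / 2 * \<bar>e x - e y\<bar>"
        using ecmp[OF that] by linarith
      moreover have "\<bar>(e x - e y) * abar\<bar> = abar * \<bar>e x - e y\<bar>" using f(3) by (simp add: abs_mult)
      ultimately have "abar / 2 * \<bar>e x - e y\<bar> \<le> \<bar>x - y\<bar>" by simp
      then show ?thesis using f(3) by (simp add: field_simps)
    qed
    show "2 / (3 * abar) * x \<le> e x" if "x \<in> T" for x
    proof -
      have x: "x > 0" using that by (auto simp: T_def)
      have *: "\<bar>x - e x * abar\<bar> \<le> abar / 2 * \<bar>e x\<bar>" using ecmp[of x 0] that by (simp add: e_def)
      have "e x \<ge> 0"
      proof (rule ccontr)
        assume "\<not> e x \<ge> 0"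
        then have n: "abar * e x < 0" using f(3) by (simp add: mult_less_0_iff)
        have "x - e x * abar \<le> abar / 2 * - e x" using * \<open>\<not> e x \<ge> 0\<close> by (simp add: abs_le_iff)
        then show False using n x by (simp add: algebra_simps)
      qed
      then have "x \<le> 3 / 2 * (abar * e x)" using abs_le_D1[OF *] by (simp add: algebra_simps)
      then show ?thesis using f(3) by (simp add: field_simps)
    qed
    show "lyapunov_stable (hill_field (e x) f) (0, 0)" if "x \<in> T" for x
    proof (rule floquet_imp_lyapunov_stable)
      show "floquet C ?a (sqrt x) (of_real (e x))" using e that by simp
      show "0 < sqrt x" using that by (simp add: T_def)
      show "C * sqrt x \<le> 1/2"
        by (rule small1) (use that \<Omega>1 in \<open>auto simp: T_def good_def\<close>)
    qed
    fix s0 :: real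
    assume s0: "0 < s0" "s0 \<le> \<Omega>1\<^sup>2"
    define w where "w k = (if k = 0 then 0 else 1 / \<l> k ^ p)" for k
    define B where "B k = {x \<in> {0<..s0}. k \<noteq> 0 \<and> \<bar>\<phi> k + 2 * sqrt x\<bar> < c / 2 / \<l> k ^ N}" for k
    define D where "D = 16 / c * (s0 * sqrt s0)"
    have D: "D \<ge> 0" using dio s0 by (simp add: D_def)
    \<comment> \<open>The resonances are reindexed by natural numbers along \<open>\<iota>\<close>;
      numbers outside its range receive the empty set and length 0.\<close>
    define B' where "B' m = (if m \<in> range \<iota> then B (inv \<iota> m) else {})" for m
    define \<beta> where "\<beta> m = (if m \<in> range \<iota> then D * w (inv \<iota> m) else 0)" for m
    have w0: "w k \<ge> 0" for k by (simp add: w_def)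
    have "((\<lambda>k. D * w k) has_sum D * W) UNIV"
      using W unfolding w_def by (rule has_sum_cmult_right)
    moreover have "(\<lambda>k. D * w k) = \<beta> \<circ> \<iota>" using \<iota> by (auto simp: \<beta>_def)
    ultimately have "(\<beta> has_sum D * W) (range \<iota>)" using \<iota> by (simp add: has_sum_reindex)
    then have "(\<beta> has_sum D * W) UNIV"
      by (rule has_sum_cong_neutral[THEN iffD1, rotated -1]) (auto simp: \<beta>_def)
    then have \<beta>s: "\<beta> sums (D * W)" by (rule has_sum_imp_sums)
    have cov: "{0<..s0} - T \<subseteq> (\<Union>m. B' m)"
    proof
      fix x assume x: "x \<in> {0<..s0} - T"
      have "sqrt x \<le> sqrt (\<Omega>1\<^sup>2)" using x s0 by (intro real_sqrt_le_mono) auto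
      then have "sqrt x \<le> \<Omega>1" using \<Omega>1 by simp
      with x obtain k where "k \<noteq> 0" "\<not> \<bar>\<phi> k + 2 * sqrt x\<bar> \<ge> c / 2 / \<l> k ^ N"
        by (auto simp: T_def good_def)
      then have "x \<in> B k" using x by (auto simp: B_def)
      then have "x \<in> B' (\<iota> k)" using \<iota> by (simp add: B'_def)
      then show "x \<in> (\<Union>m. B' m)" by blast
    qed
    have diam: "\<bar>x - y\<bar> \<le> \<beta> m" if "x \<in> B' m" "y \<in> B' m" for m x y
    proof -
      have "m \<in> range \<iota>" using that by (metis B'_def empty_iff)
      then obtain k where k: "m = \<iota> k" by blast
      with that \<iota> have "x \<in> B k" "y \<in> B k" by (auto simp: B'_def)
      then have "\<bar>x - y\<bar> \<le> D * (1 / \<l> k ^ p)" "k \<noteq> 0" unfolding D_def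
        using resonances_small[OF dio s0(1), of k x y p] by (auto simp: B_def N_def)
      then show ?thesis using k \<iota> by (simp add: \<beta>_def w_def)
    qed
    have "D * W \<le> 16 / c * W * (s0 * sqrt s0)" by (simp add: D_def mult_ac)
    moreover have "\<beta> m \<ge> 0" for m using D w0 by (simp add: \<beta>_def)
    ultimately show "\<exists>(B :: nat \<Rightarrow> real set) \<beta> S. {0<..s0} - T \<subseteq> (\<Union>n. B n) \<and>
       (\<forall>n. \<forall>x\<in>B n. \<forall>y\<in>B n. \<bar>x - y\<bar> \<le> \<beta> n) \<and> (\<forall>n. \<beta> n \<ge> 0) \<and> \<beta> sums S \<and> S \<le> 16 / c * W * (s0 * sqrt s0)"
      using cov diam \<beta>s by blast
  qed
qed

end

subsection \<open>Fourier series of periodic holomorphic functions\<close>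

lemma open_Im_strip: "open {s. \<bar>Im s\<bar> < \<rho>}"
  by (intro open_Collect_less continuous_intros)

lemma convex_Im_strip: "convex {s. \<bar>Im s\<bar> < \<rho>}"
proof -
  have "{s. \<bar>Im s\<bar> < \<rho>} = {s. Im s < \<rho>} \<inter> {s. Im s > - \<rho>}" by auto
  then show ?thesis by (simp add: convex_Int convex_halfspace_Im_lt convex_halfspace_Im_gt)
qed

lemma closed_segment_Im_strip:
  assumes "\<bar>Im a\<bar> < \<rho>" "\<bar>Im b\<bar> < \<rho>"
  shows "closed_segment a b \<subseteq> {s. \<bar>Im s\<bar> < \<rho>}"
  using assms by (intro closed_segment_subset convex_Im_strip) auto

text \<open>A primitive \<open>H\<close> exists on the convex strip, and the integral over one
  period is \<open>H (s + 2 * pi) - H s\<close>. By periodicity of \<open>f\<close> this difference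
  has derivative 0.\<close>

lemma periodic_contour_shift:
  assumes f: "f holomorphic_on {s. \<bar>Im s\<bar> < \<rho>}" and per: "\<And>s. \<bar>Im s\<bar> < \<rho> \<Longrightarrow> f (s + 2 * pi) = f s"
    and st: "\<bar>Im s\<bar> < \<rho>" "\<bar>Im t\<bar> < \<rho>"
  shows "contour_integral (linepath s (s + 2 * pi)) f = contour_integral (linepath t (t + 2 * pi)) f"
proof -
  let ?S = "{s. \<bar>Im s\<bar> < \<rho>}"
  obtain H where H: "\<And>x. x \<in> ?S \<Longrightarrow> (H has_field_derivative f x) (at x within ?S)"
    using holomorphic_convex_primitive'[OF convex_Im_strip open_Im_strip f] by blast
  have H': "(H has_field_derivative f x) (at x)" if "x \<in> ?S" for x
    using H[OF that] at_within_open[OF that open_Im_strip] by simp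
  have I: "contour_integral (linepath x (x + 2 * pi)) f = H (x + 2 * pi) - H x" if "x \<in> ?S" for x
  proof -
    have "path_image (linepath x (x + 2 * pi)) \<subseteq> ?S"
      using that closed_segment_Im_strip[of x \<rho> "x + 2 * pi"] by auto
    from contour_integral_primitive[OF H valid_path_linepath this] show ?thesis
      by (auto dest: contour_integral_unique)
  qed
  have "((\<lambda>x. H (x + 2 * pi) - H x) has_field_derivative 0) (at x within ?S)" if "x \<in> ?S" for x
  proof -
    have "((\<lambda>x. H (x + 2 * pi)) has_field_derivative f (x + 2 * pi) * 1) (at x)"
      by (rule DERIV_chain2[OF H']) (use that in \<open>auto intro!: derivative_eq_intros\<close>)
    from DERIV_diff[OF this H'[OF that]] have "((\<lambda>x. H (x + 2 * pi) - H x) has_field_derivative 0) (at x)"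
      using per that by simp
    then show ?thesis by (rule has_field_derivative_at_within)
  qed
  from has_field_derivative_zero_constant[OF convex_Im_strip this] obtain c where
    "\<And>x. x \<in> ?S \<Longrightarrow> H (x + 2 * pi) - H x = c" by blast
  with I st show ?thesis by simp
qed

text \<open>Integration by parts: on the real segment the exponential has modulus 1, and its
  primitive gains the factor 1/n. This weak decay is enough to remove the end terms of the
  telescoping Fourier sums.\<close>

lemma contour_integral_exp_decay:
  assumes h: "h holomorphic_on U" "open U" and seg: "closed_segment (of_real x) (of_real y) \<subseteq> U"
  shows "\<exists>C. \<forall>n::int. n \<noteq> 0 \<longrightarrow>
    norm (contour_integral (linepath (of_real x) (of_real y)) (\<lambda>s. h s * exp (- \<i> * of_int n * s))) \<le> C / \<bar>n\<bar>"
proof -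
  let ?seg = "closed_segment (complex_of_real x) (of_real y)"
  have ch: "continuous_on ?seg h"
    using holomorphic_on_imp_continuous_on[OF h(1)] continuous_on_subset seg by blast
  have cdh: "continuous_on ?seg (deriv h)"
    using holomorphic_on_imp_continuous_on[OF holomorphic_deriv[OF h]] continuous_on_subset seg by blast
  obtain B where B: "\<And>s. s \<in> ?seg \<Longrightarrow> norm (h s) \<le> B"
    using compact_imp_bounded[OF compact_continuous_image[OF ch]] by (auto simp: bounded_iff)
  obtain B' where B': "\<And>s. s \<in> ?seg \<Longrightarrow> norm (deriv h s) \<le> B'"
    using compact_imp_bounded[OF compact_continuous_image[OF cdh]] by (auto simp: bounded_iff)
  have nexp: "norm (exp (- \<i> * of_int n * s)) = 1" if "s \<in> ?seg" for n :: int and s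
  proof -
    have "Im s = 0" using that by (auto simp: closed_segment_def)
    then show ?thesis by (simp add: norm_exp_eq_Re)
  qed
  have B0: "0 \<le> B'" using order_trans[OF norm_ge_zero B'[of "of_real x"]] by simp
  show ?thesis
  proof (intro exI[of _ "B' * norm (of_real y - of_real x :: complex) + 2 * B"] allI impI)
    fix n :: int
    assume n: "n \<noteq> 0"
    let ?e = "\<lambda>s. exp (- \<i> * of_int n * s)" and ?p = "linepath (complex_of_real x) (of_real y)"
    have "((\<lambda>s. deriv h s * ?e s + h s * (?e s * (- \<i> * of_int n))) has_contour_integral
        h (pathfinish ?p) * ?e (pathfinish ?p) - h (pathstart ?p) * ?e (pathstart ?p)) ?p"
    proof (rule contour_integral_primitive)
      show "((\<lambda>s. h s * ?e s) has_field_derivative deriv h s * ?e s + h s * (?e s * (- \<i> * of_int n))) (at s within U)" if "s \<in> U" for s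
      proof -
        have "(?e has_field_derivative ?e s * (- \<i> * of_int n)) (at s within U)"
          by (auto intro!: derivative_eq_intros)
        from DERIV_mult[OF has_field_derivative_at_within[OF holomorphic_derivI[OF h that]] this]
        show ?thesis by (simp add: mult_ac)
      qed
    qed (use seg in auto)
    then have eq1: "contour_integral ?p (\<lambda>s. deriv h s * ?e s + - \<i> * of_int n * (h s * ?e s)) =
        h (of_real y) * ?e (of_real y) - h (of_real x) * ?e (of_real x)"
      by (intro contour_integral_unique) (simp add: mult_ac)
    have i1: "(\<lambda>s. deriv h s * ?e s) contour_integrable_on ?p"
      by (intro contour_integrable_continuous_linepath continuous_intros cdh)
    have i2: "(\<lambda>s. h s * ?e s) contour_integrable_on ?p"
      by (intro contour_integrable_continuous_linepath continuous_intros ch)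
    have eq2: "contour_integral ?p (\<lambda>s. deriv h s * ?e s + - \<i> * of_int n * (h s * ?e s)) =
        contour_integral ?p (\<lambda>s. deriv h s * ?e s) + - \<i> * of_int n * contour_integral ?p (\<lambda>s. h s * ?e s)"
      by (simp only: contour_integral_add[OF i1 contour_integrable_lmul[OF i2]] contour_integral_lmul[OF i2])
    have "- \<i> * of_int n * contour_integral ?p (\<lambda>s. h s * ?e s) =
        (h (of_real y) * ?e (of_real y) - h (of_real x) * ?e (of_real x)) - contour_integral ?p (\<lambda>s. deriv h s * ?e s)"
      by (rule iffD2[OF eq_diff_eq trans[OF add.commute trans[OF sym[OF eq2] eq1]]])
    then have "norm (- \<i> * of_int n * contour_integral ?p (\<lambda>s. h s * ?e s)) \<le>
        norm (h (of_real y) * ?e (of_real y) - h (of_real x) * ?e (of_real x)) + norm (contour_integral ?p (\<lambda>s. deriv h s * ?e s))"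
      by (simp add: norm_triangle_ineq4)
    also have "\<dots> \<le> (B + B) + B' * norm (of_real y - of_real x :: complex)"
    proof (intro add_mono order_trans[OF norm_triangle_ineq4])
      show "norm (contour_integral ?p (\<lambda>s. deriv h s * ?e s)) \<le> B' * norm (of_real y - of_real x :: complex)"
        by (rule contour_integral_bound_linepath[OF i1 B0]) (simp only: norm_mult nexp B' mult_1_right)
    qed (simp_all only: norm_mult nexp B mult_1_right ends_in_segment)
    finally have "\<bar>of_int n\<bar> * norm (contour_integral ?p (\<lambda>s. h s * ?e s)) \<le> B' * norm (of_real y - of_real x :: complex) + 2 * B"
      by (simp add: norm_mult)
    then show "norm (contour_integral ?p (\<lambda>s. h s * ?e s)) \<le> (B' * norm (of_real y - of_real x :: complex) + 2 * B) / \<bar>n\<bar>"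
      using n by (simp add: le_divide_eq mult.commute)
  qed
qed

text \<open>Written as a contour integral so that the path can be moved within the strip of
  holomorphy.\<close>

definition fourier_coeff :: "(complex \<Rightarrow> complex) \<Rightarrow> int \<Rightarrow> complex" where
  "fourier_coeff g n = contour_integral (linepath 0 (of_real (2 * pi))) (\<lambda>s. g s * exp (- \<i> * of_int n * s)) / (2 * pi)"

lemma exp_of_int_periodic:
  fixes s :: complex
  shows "exp (- \<i> * of_int n * (s + 2 * pi)) = exp (- \<i> * of_int n * s)"
proof -
  have "exp (- \<i> * of_int n * (s + 2 * pi)) = exp (- \<i> * of_int n * s + of_int (- n) * (of_real (2 * pi) * \<i>))"
    by (rule arg_cong[of _ _ exp]) (simp add: algebra_simps)
  also have "\<dots> = exp (- \<i> * of_int n * s)"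
    by (subst exp_plus_2pin[symmetric, of "- \<i> * of_int n * s" "- n"]) (simp add: mult_ac)
  finally show ?thesis .
qed

context
  fixes g :: "complex \<Rightarrow> complex" and \<rho> :: real
  assumes \<rho>: "\<rho> > 0" and g: "g holomorphic_on {s. \<bar>Im s\<bar> < \<rho>}"
    and per: "\<And>s. \<bar>Im s\<bar> < \<rho> \<Longrightarrow> g (s + 2 * pi) = g s"
begin

lemma fourier_coeff_shift:
  assumes "\<bar>Im s\<bar> < \<rho>"
  shows "fourier_coeff g n = contour_integral (linepath s (s + 2 * pi)) (\<lambda>s. g s * exp (- \<i> * of_int n * s)) / (2 * pi)"
proof -
  have "contour_integral (linepath 0 (0 + of_real (2 * pi))) (\<lambda>s. g s * exp (- \<i> * of_int n * s)) =
      contour_integral (linepath s (s + 2 * pi)) (\<lambda>s. g s * exp (- \<i> * of_int n * s))"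
    using assms \<rho> per exp_of_int_periodic
    by (intro periodic_contour_shift[where \<rho> = \<rho>] holomorphic_intros g) auto
  then show ?thesis by (simp add: fourier_coeff_def)
qed

text \<open>The path is moved to height \<open>- \<sigma> * sgn n\<close>, where the exponential has
  modulus \<open>exp (- \<sigma> * \<bar>n\<bar>)\<close>; its length \<open>2 * pi\<close> cancels
  the normalization.\<close>

lemma fourier_coeff_le:
  assumes \<sigma>: "0 \<le> \<sigma>" "\<sigma> < \<rho>" and M: "\<And>s. \<bar>Im s\<bar> < \<rho> \<Longrightarrow> norm (g s) \<le> M"
  shows "norm (fourier_coeff g n) \<le> M * exp (- \<sigma> * real_of_int \<bar>n\<bar>)"
proof -
  define s0 where "s0 = - \<i> * of_real (\<sigma> * sgn n)"
  have Ims0: "Im s0 = - (\<sigma> * sgn n)" by (simp add: s0_def)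
  have s0: "\<bar>Im s0\<bar> < \<rho>" using \<sigma> \<rho> by (auto simp: Ims0 abs_mult sgn_if)
  have M0: "M \<ge> 0" using order_trans[OF norm_ge_zero M[of 0]] \<rho> by simp
  have "norm (contour_integral (linepath s0 (s0 + 2 * pi)) (\<lambda>s. g s * exp (- \<i> * of_int n * s)))
      \<le> M * exp (- \<sigma> * real_of_int \<bar>n\<bar>) * norm ((s0 + 2 * pi) - s0)"
  proof (rule contour_integral_bound_linepath)
    have sub: "closed_segment s0 (s0 + 2 * pi) \<subseteq> {s. \<bar>Im s\<bar> < \<rho>}"
      using s0 by (intro closed_segment_Im_strip) auto
    then show "(\<lambda>s. g s * exp (- \<i> * of_int n * s)) contour_integrable_on linepath s0 (s0 + 2 * pi)"
      using holomorphic_on_imp_continuous_on[OF g]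
      by (intro contour_integrable_continuous_linepath continuous_intros) (blast intro: continuous_on_subset)
    show "norm (g s * exp (- \<i> * of_int n * s)) \<le> M * exp (- \<sigma> * real_of_int \<bar>n\<bar>)" if s: "s \<in> closed_segment s0 (s0 + 2 * pi)" for s
    proof -
      obtain u where "s = (1 - u) *\<^sub>R s0 + u *\<^sub>R (s0 + 2 * pi)"
        using s by (auto simp: closed_segment_def)
      then have "Im s = Im s0" by (simp add: algebra_simps)
      then have "n * Im s = - \<sigma> * \<bar>n\<bar>" by (simp add: Ims0 abs_sgn mult_ac)
      then have "norm (exp (- \<i> * of_int n * s)) = exp (- \<sigma> * real_of_int \<bar>n\<bar>)" by (simp add: norm_exp_eq_Re)
      moreover have "norm (g s) \<le> M" using s sub by (intro M) auto
      ultimately show ?thesis by (simp add: norm_mult)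
    qed
  qed (use M0 in auto)
  then show ?thesis
    unfolding fourier_coeff_shift[OF s0] by (simp add: norm_divide norm_mult field_simps)
qed

text \<open>Chernoff's argument: \<open>g - g t\<close> is divisible by \<open>exp (i (s - t)) - 1\<close>, and the Fourier
  sums of a multiple of that function telescope.\<close>

lemma fourier_partial_sums:
  fixes t :: real
  shows "(\<lambda>N. \<Sum>n\<in>{-int N..int N}. fourier_coeff g n * exp (\<i> * of_int n * t)) \<longlonglongrightarrow> g t"
proof -
  \<comment> \<open>Wide enough to contain the period segment centred at \<open>t\<close>, yet
    narrow enough that \<open>t\<close> is the only zero of \<open>E - 1\<close> in it.\<close>
  define U where "U = {s. \<bar>Im s\<bar> < \<rho>} \<inter> {s. \<bar>Re s - t\<bar> < 2 * pi}"
  have U: "open U" unfolding U_def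
    by (intro open_Int open_Im_strip open_Collect_less continuous_intros)
  have gU: "g holomorphic_on U" using g by (rule holomorphic_on_subset) (auto simp: U_def)
  define E where "E s = exp (\<i> * (s - t))" for s :: complex
  have EU: "E holomorphic_on U" unfolding E_def by (intro holomorphic_intros)
  \<comment> \<open>Both difference quotients extend holomorphically over \<open>t\<close>, and
    \<open>DE\<close> has no zero on \<open>U\<close>, so their quotient \<open>h\<close> is the
    holomorphic cofactor of \<open>E - 1\<close> in \<open>g - g t\<close>.\<close>
  define Dg where "Dg s = (if s = t then deriv g t else (g s - g t) / (s - t))" for s :: complex
  define DE where "DE s = (if s = t then deriv E t else (E s - E t) / (s - t))" for s :: complex
  have Dg: "Dg holomorphic_on U" unfolding Dg_def by (rule pole_lemma_open[OF gU U])
  have DE: "DE holomorphic_on U" unfolding DE_def by (rule pole_lemma_open[OF EU U])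
  have Et: "E t = 1" by (simp add: E_def)
  have DEnz: "DE s \<noteq> 0" if "s \<in> U" for s
  proof (cases "s = t")
    case True
    have "(E has_field_derivative \<i>) (at (complex_of_real t))"
      unfolding E_def by (auto intro!: derivative_eq_intros)
    then have "deriv E t = \<i>" by (rule DERIV_imp_deriv)
    with True show ?thesis by (simp add: DE_def)
  next
    case False
    have "E s \<noteq> 1"
    proof
      assume "E s = 1"
      then obtain m :: int where m: "Im s = 0" "Re s - t = of_int (2 * m) * pi"
        unfolding E_def exp_eq_1 by auto
      have "\<bar>Re s - t\<bar> < 2 * pi" using that by (auto simp: U_def)
      then have "\<bar>of_int m\<bar> < (1::real)" unfolding m(2) by (simp add: abs_mult)
      then have "m = 0" by linarith
      with m have "s = t" by (auto simp: complex_eq_iff)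
      with False show False by simp
    qed
    with False Et show ?thesis by (simp add: DE_def)
  qed
  define h where "h s = Dg s / DE s" for s
  have h: "h holomorphic_on U" unfolding h_def
    by (intro holomorphic_on_divide Dg DE DEnz)
  have gh: "g s = g t + h s * (E s - 1)" if "s \<in> U" for s
    using DEnz[OF that] Et by (auto simp: h_def Dg_def DE_def split: if_splits)
  let ?a = "complex_of_real (t - pi)" and ?b = "complex_of_real (t + pi)"
  have ab: "?b = ?a + 2 * pi" by simp
  have seg: "closed_segment ?a ?b \<subseteq> U"
  proof
    fix s assume s: "s \<in> closed_segment ?a ?b"
    then obtain x where x: "s = of_real x" "x \<in> {t - pi..t + pi}"
      using closed_segment_of_real[of "t - pi" "t + pi", where 'a = complex]
      by (auto simp: closed_segment_eq_real_ivl)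
    have "\<bar>x - t\<bar> < 2 * pi" using x(2) pi_gt_zero unfolding atLeastAtMost_iff abs_less_iff by linarith
    with x(1) \<rho> show "s \<in> U" by (simp add: U_def)
  qed
  define I where "I f n = contour_integral (linepath ?a ?b) (\<lambda>s. f s * exp (- \<i> * of_int n * s))"
    for f :: "complex \<Rightarrow> complex" and n :: int
  have int: "(\<lambda>s. f s * exp (- \<i> * of_int n * s)) contour_integrable_on linepath ?a ?b"
    if "continuous_on U f" for f :: "complex \<Rightarrow> complex" and n
    using continuous_on_subset[OF that seg] by (intro contour_integrable_continuous_linepath continuous_intros)
  have ch: "continuous_on U h" using h by (rule holomorphic_on_imp_continuous_on)
  note int1 = int[OF continuous_on_const[of U 1]]
  note inth = int[OF ch]
  have I1: "I (\<lambda>s. 1) n = (if n = 0 then 2 * pi else 0)" for n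
  proof (cases "n = 0")
    case True
    then show ?thesis by (simp add: I_def)
  next
    case False
    have "((\<lambda>s. 1 * exp (- \<i> * of_int n * s)) has_contour_integral
      exp (- \<i> * of_int n * pathfinish (linepath ?a ?b)) / (- \<i> * of_int n) -
      exp (- \<i> * of_int n * pathstart (linepath ?a ?b)) / (- \<i> * of_int n)) (linepath ?a ?b)"
      by (rule contour_integral_primitive[where S = UNIV]) (use False in \<open>auto intro!: derivative_eq_intros\<close>)
    moreover have "exp (- \<i> * of_int n * ?b) = exp (- \<i> * of_int n * ?a)"
      unfolding ab by (rule exp_of_int_periodic)
    ultimately have "I (\<lambda>s. 1) n = 0" unfolding I_def
      by (intro contour_integral_unique) simp
    with False show ?thesis by simp
  qed
  \<comment> \<open>The n-th Fourier term of \<open>h\<close> at \<open>t\<close>. Multiplying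
    \<open>h\<close> by \<open>E\<close> shifts these terms by one index, whence the difference
    \<open>a (n - 1) - a n\<close>.\<close>
  define a where "a n = exp (\<i> * of_int n * t) * I h n / (2 * pi)" for n
  have Ig: "fourier_coeff g n * exp (\<i> * of_int n * t) = (if n = 0 then g t else 0) + (a (n - 1) - a n)" for n
  proof -
    have "fourier_coeff g n = I g n / (2 * pi)"
      unfolding I_def ab by (rule fourier_coeff_shift) (use \<rho> in simp)
    then have "2 * pi * fourier_coeff g n = I g n" by simp
    also have "I g n = contour_integral (linepath ?a ?b)
       (\<lambda>s. g t * (1 * exp (- \<i> * of_int n * s)) + (exp (- \<i> * t) * (h s * exp (- \<i> * of_int (n - 1) * s)) - h s * exp (- \<i> * of_int n * s)))"
      unfolding I_def
    proof (rule contour_integral_eq)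
      fix s assume "s \<in> path_image (linepath ?a ?b)"
      then have "s \<in> U" using seg by auto
      have "exp (- \<i> * t) * exp (- \<i> * of_int (n - 1) * s) = E s * exp (- \<i> * of_int n * s)"
        unfolding E_def exp_add[symmetric] by (rule arg_cong[of _ _ exp]) (simp add: algebra_simps)
      then have "exp (- \<i> * t) * (h s * exp (- \<i> * of_int (n - 1) * s)) = h s * E s * exp (- \<i> * of_int n * s)"
        by (simp add: mult_ac)
      then show "g s * exp (- \<i> * of_int n * s) = g t * (1 * exp (- \<i> * of_int n * s)) +
          (exp (- \<i> * t) * (h s * exp (- \<i> * of_int (n - 1) * s)) - h s * exp (- \<i> * of_int n * s))"
        using gh[OF \<open>s \<in> U\<close>] by (simp only:) (simp add: algebra_simps)
    qed
    also have "\<dots> = g t * I (\<lambda>s. 1) n + (exp (- \<i> * t) * I h (n - 1) - I h n)"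
      unfolding I_def
      by (simp only: contour_integral_add[OF contour_integrable_lmul[OF int1] contour_integrable_diff[OF contour_integrable_lmul[OF inth] inth]]
          contour_integral_diff[OF contour_integrable_lmul[OF inth] inth] contour_integral_lmul[OF int1] contour_integral_lmul[OF inth])
    finally have eq: "2 * pi * fourier_coeff g n = g t * I (\<lambda>s. 1) n + (exp (- \<i> * t) * I h (n - 1) - I h n)" .
    have "2 * pi * (fourier_coeff g n * exp (\<i> * of_int n * t)) =
        (g t * I (\<lambda>s. 1) n + (exp (- \<i> * t) * I h (n - 1) - I h n)) * exp (\<i> * of_int n * t)"
      by (simp only: mult.assoc[symmetric] eq)
    also have "\<dots> = g t * I (\<lambda>s. 1) n * exp (\<i> * of_int n * t) +
        ((exp (- \<i> * t) * exp (\<i> * of_int n * t)) * I h (n - 1) - exp (\<i> * of_int n * t) * I h n)"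
      by (simp only: algebra_simps)
    also have "exp (- \<i> * t) * exp (\<i> * of_int n * t) = exp (\<i> * of_int (n - 1) * t)"
      unfolding exp_add[symmetric] by (rule arg_cong[of _ _ exp]) (simp add: algebra_simps)
    also have "g t * I (\<lambda>s. 1) n * exp (\<i> * of_int n * t) + (exp (\<i> * of_int (n - 1) * t) * I h (n - 1) - exp (\<i> * of_int n * t) * I h n) =
        2 * pi * ((if n = 0 then g t else 0) + (a (n - 1) - a n))"
      by (cases "n = 0") (simp_all add: a_def I1 right_diff_distrib distrib_left)
    finally have "2 * pi * (fourier_coeff g n * exp (\<i> * of_int n * t)) = 2 * pi * ((if n = 0 then g t else 0) + (a (n - 1) - a n))" .
    then show ?thesis by (simp only: mult_cancel_left) simp
  qed
  have part: "(\<Sum>n\<in>{-int N..int N}. fourier_coeff g n * exp (\<i> * of_int n * t)) = g t + (a (- int N - 1) - a (int N))" for N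
  proof (induction N)
    case 0
    show ?case using Ig[of 0] by simp
  next
    case (Suc N)
    have eq: "- int N - 1 = - 1 - int N" by simp
    have "{-int (Suc N)..int (Suc N)} = insert (- int (Suc N)) (insert (int (Suc N)) {-int N..int N})"
      by auto
    then have "(\<Sum>n\<in>{-int (Suc N)..int (Suc N)}. fourier_coeff g n * exp (\<i> * of_int n * t)) =
       fourier_coeff g (- int (Suc N)) * exp (\<i> * of_int (- int (Suc N)) * t) +
       (fourier_coeff g (int (Suc N)) * exp (\<i> * of_int (int (Suc N)) * t) +
       (\<Sum>n\<in>{-int N..int N}. fourier_coeff g n * exp (\<i> * of_int n * t)))"
      by (simp only:) (subst sum.insert; auto)+
    also have "\<dots> = g t + (a (- int (Suc N) - 1) - a (int (Suc N)))"
      unfolding Suc Ig[of "- int (Suc N)"] Ig[of "int (Suc N)"] by (simp add: eq algebra_simps)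
    finally show ?case .
  qed
  obtain C where C: "\<And>n::int. n \<noteq> 0 \<Longrightarrow> norm (I h n) \<le> C / \<bar>n\<bar>"
    unfolding I_def using contour_integral_exp_decay[OF h U seg] by blast
  have a_le: "norm (a n) \<le> C / (2 * pi) / \<bar>n\<bar>" if "n \<noteq> 0" for n
    using divide_right_mono[OF C[OF that], of "2 * pi"]
    by (simp add: a_def norm_divide norm_mult norm_exp_eq_Re mult_ac)
  have lim1: "(\<lambda>N. a (int N)) \<longlonglongrightarrow> 0"
  proof (rule Lim_null_comparison)
    show "\<forall>\<^sub>F N in sequentially. norm (a (int N)) \<le> C / (2 * pi) / real N"
      using eventually_gt_at_top[of 0] by eventually_elim (use a_le[of "int n" for n] in simp)
    show "(\<lambda>N. C / (2 * pi) / real N) \<longlonglongrightarrow> 0" by real_asymp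
  qed
  have lim2: "(\<lambda>N. a (- int N - 1)) \<longlonglongrightarrow> 0"
  proof (rule Lim_null_comparison)
    have "norm (a (- int N - 1)) \<le> C / (2 * pi) / (real N + 1)" for N
      using a_le[of "- int N - 1"] by (simp add: abs_if algebra_simps)
    then show "\<forall>\<^sub>F N in sequentially. norm (a (- int N - 1)) \<le> C / (2 * pi) / (real N + 1)" by simp
    show "(\<lambda>N. C / (2 * pi) / (real N + 1)) \<longlonglongrightarrow> 0" by real_asymp
  qed
  have "(\<lambda>N. g t + (a (- int N - 1) - a (int N))) \<longlonglongrightarrow> g t + (0 - 0)"
    by (intro tendsto_intros lim1 lim2)
  then show ?thesis by (simp add: part)
qed

end

section \<open>Unconditional convergence of the Fourier series\<close>

lemma summable_on_int:
  fixes f :: "int \<Rightarrow> real"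
  assumes "(\<lambda>n. f (int n)) summable_on UNIV" "(\<lambda>n. f (- int n)) summable_on UNIV"
  shows "f summable_on UNIV"
proof -
  have 1: "f summable_on range int"
    using assms(1) by (subst summable_on_reindex) (auto simp: o_def inj_on_def)
  have 2: "f summable_on range (\<lambda>n. - int n)"
    using assms(2) by (subst summable_on_reindex) (auto simp: o_def inj_on_def)
  have "x \<in> range int \<union> range (\<lambda>n. - int n)" for x
    by (cases x rule: int_cases2) auto
  then have "range int \<union> range (\<lambda>n. - int n) = UNIV" by blast
  with summable_on_union[OF 1 2] show ?thesis by simp
qed

lemma summable_on_exp_int:
  assumes "\<sigma> > 0"
  shows "(\<lambda>n::int. exp (- \<sigma> * real_of_int \<bar>n\<bar>)) summable_on UNIV"
proof -
  have "summable (\<lambda>n. exp (- \<sigma>) ^ n)" using assms by (intro summable_geometric) auto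
  then have "(\<lambda>n. exp (- \<sigma>) ^ n) summable_on UNIV"
    by (intro summable_nonneg_imp_summable_on) auto
  moreover have "exp (- \<sigma>) ^ n = exp (- \<sigma> * real n)" for n
    by (simp add: exp_of_nat_mult[symmetric] mult.commute)
  ultimately show ?thesis by (intro summable_on_int) auto
qed

lemma filterlim_int_intervals: "filterlim (\<lambda>N. {- int N..int N}) (finite_subsets_at_top UNIV) sequentially"
  unfolding filterlim_finite_subsets_at_top
proof (intro allI impI)
  fix X :: "int set"
  assume X: "finite X \<and> X \<subseteq> UNIV"
  have "\<forall>\<^sub>F N in sequentially. \<forall>x\<in>X. x \<in> {- int N..int N}"
  proof (subst eventually_ball_finite_distrib, use X in blast, intro ballI)
    fix x assume "x \<in> X"
    show "\<forall>\<^sub>F N in sequentially. x \<in> {- int N..int N}"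
      using eventually_ge_at_top[of "nat \<bar>x\<bar>"] by eventually_elim auto
  qed
  then show "\<forall>\<^sub>F N in sequentially. finite {- int N..int N} \<and> X \<subseteq> {- int N..int N} \<and> {- int N..int N} \<subseteq> UNIV"
    by eventually_elim auto
qed

text \<open>Exponential decay of the coefficients gives an unconditional sum; its value is
  identified along the symmetric partial sums, whose limit is known.\<close>

lemma fourier_has_sum:
  fixes t :: real
  assumes g: "g holomorphic_on {s. \<bar>Im s\<bar> < \<rho>}" "\<And>s. \<bar>Im s\<bar> < \<rho> \<Longrightarrow> g (s + 2 * pi) = g s"
    and \<sigma>: "0 < \<sigma>" "\<sigma> < \<rho>" and M: "\<And>s. \<bar>Im s\<bar> < \<rho> \<Longrightarrow> norm (g s) \<le> M"
  shows "((\<lambda>n. fourier_coeff g n * exp (\<i> * of_int n * t)) has_sum g t) UNIV"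
proof -
  have \<rho>: "\<rho> > 0" using \<sigma> by simp
  let ?f = "\<lambda>n. fourier_coeff g n * exp (\<i> * of_int n * t)"
  have le: "norm (?f n) \<le> M * exp (- \<sigma> * real_of_int \<bar>n\<bar>)" for n
    using fourier_coeff_le[OF \<rho> g less_imp_le[OF \<sigma>(1)] \<sigma>(2) M, of n] by (simp add: norm_mult norm_exp_eq_Re)
  have s: "(\<lambda>n::int. M * exp (- \<sigma> * real_of_int \<bar>n\<bar>)) summable_on UNIV"
    by (intro summable_on_cmult_right summable_on_exp_int \<sigma>)
  have "(\<lambda>n. norm (?f n)) summable_on UNIV"
    by (rule summable_on_comparison_test[OF s le norm_ge_zero])
  then have hs: "(?f has_sum infsum ?f UNIV) UNIV"
    by (intro has_sum_infsum) (rule abs_summable_summable)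
  then have "(\<lambda>N. sum ?f {- int N..int N}) \<longlonglongrightarrow> infsum ?f UNIV"
    unfolding has_sum_def by (rule filterlim_compose[OF _ filterlim_int_intervals])
  then have "infsum ?f UNIV = g t"
    using fourier_partial_sums[OF \<rho> g] by (rule LIMSEQ_unique)
  with hs show ?thesis by simp
qed

section \<open>Contour integrals depending on a parameter\<close>

lemma continuous_on_contour_integral_linepath:
  assumes "continuous_on (X \<times> closed_segment a b) (\<lambda>(x, s). f x s)"
  shows "continuous_on X (\<lambda>x. contour_integral (linepath a b) (f x))"
proof -
  have "continuous_on (X \<times> cbox 0 1) (\<lambda>(x, u). f x (linepath a b u) * (b - a))"
  proof -
    have "continuous_on (X \<times> cbox 0 1) (\<lambda>p. (\<lambda>(x, s). f x s) (fst p, linepath a b (snd p)) * (b - a))"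
      by (intro continuous_intros continuous_on_compose2[OF assms])
        (auto simp: linepath_def closed_segment_def intro!: continuous_intros)
    then show ?thesis by (simp add: case_prod_unfold)
  qed
  from integral_continuous_on_param[OF this] show ?thesis
    by (simp add: contour_integral_integral)
qed

text \<open>Morera's theorem: along a triangle in the parameter the two integrations can be
  interchanged, and the inner integral then vanishes by Cauchy's theorem.\<close>

lemma holomorphic_on_contour_integral_linepath:
  assumes S: "open S" and cont: "continuous_on (S \<times> closed_segment c d) (\<lambda>(s, r). G s r)"
    and holo: "\<And>r. r \<in> closed_segment c d \<Longrightarrow> (\<lambda>s. G s r) holomorphic_on S"
  shows "(\<lambda>s. contour_integral (linepath c d) (G s)) holomorphic_on S"
proof -
  have "(\<lambda>s. contour_integral (linepath c d) (G s)) analytic_on S"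
  proof (rule Morera_triangle[OF continuous_on_contour_integral_linepath[OF cont] S], intro impI)
    fix x y z assume sub: "convex hull {x, y, z} \<subseteq> S"
    have seg: "closed_segment x y \<subseteq> S" "closed_segment y z \<subseteq> S" "closed_segment z x \<subseteq> S"
      unfolding segment_convex_hull by (rule order_trans[OF hull_mono sub], blast)+
    have sw: "contour_integral (linepath a b) (\<lambda>s. contour_integral (linepath c d) (G s)) =
        contour_integral (linepath c d) (\<lambda>r. contour_integral (linepath a b) (\<lambda>s. G s r))"
      and ci: "(\<lambda>r. contour_integral (linepath a b) (\<lambda>s. G s r)) contour_integrable_on linepath c d"
      if ab: "closed_segment a b \<subseteq> S" for a b
    proof -
      have c1: "continuous_on (closed_segment a b \<times> closed_segment c d) (\<lambda>(s, r). G s r)"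
        by (rule continuous_on_subset[OF cont]) (use ab in auto)
      then show "contour_integral (linepath a b) (\<lambda>s. contour_integral (linepath c d) (G s)) =
        contour_integral (linepath c d) (\<lambda>r. contour_integral (linepath a b) (\<lambda>s. G s r))"
        by (intro contour_integral_swap) auto
      have "continuous_on (closed_segment c d \<times> closed_segment a b) (\<lambda>p. (\<lambda>(s, r). G s r) (snd p, fst p))"
        by (intro continuous_on_compose2[OF c1] continuous_intros) auto
      then show "(\<lambda>r. contour_integral (linepath a b) (\<lambda>s. G s r)) contour_integrable_on linepath c d"
        by (intro contour_integrable_continuous_linepath continuous_on_contour_integral_linepath)
          (simp add: case_prod_unfold)
    qed
    have tri: "contour_integral (linepath x y) (\<lambda>s. G s r) + contour_integral (linepath y z) (\<lambda>s. G s r) +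
        contour_integral (linepath z x) (\<lambda>s. G s r) = 0" if r: "r \<in> closed_segment c d" for r
    proof -
      have h: "(\<lambda>s. G s r) holomorphic_on convex hull {x, y, z}"
        using holomorphic_on_subset[OF holo[OF r] sub] .
      have i: "(\<lambda>s. G s r) contour_integrable_on linepath a b" if "closed_segment a b \<subseteq> S" for a b
        using holomorphic_on_imp_continuous_on[OF holo[OF r]] that
        by (intro contour_integrable_continuous_linepath) (blast intro: continuous_on_subset)
      from contour_integral_unique[OF Cauchy_theorem_triangle[OF h]] show ?thesis
        by (simp add: i seg add.assoc)
    qed
    have "contour_integral (linepath c d) (\<lambda>r. contour_integral (linepath x y) (\<lambda>s. G s r) + contour_integral (linepath y z) (\<lambda>s. G s r) +
        contour_integral (linepath z x) (\<lambda>s. G s r)) = contour_integral (linepath c d) (\<lambda>r. 0)"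
      by (rule contour_integral_eq) (use tri in auto)
    then show "contour_integral (linepath x y) (\<lambda>s. contour_integral (linepath c d) (G s)) +
        contour_integral (linepath y z) (\<lambda>s. contour_integral (linepath c d) (G s)) +
        contour_integral (linepath z x) (\<lambda>s. contour_integral (linepath c d) (G s)) = 0"
      unfolding sw[OF seg(1)] sw[OF seg(2)] sw[OF seg(3)]
      by (simp add: contour_integral_add contour_integrable_add ci seg)
  qed
  then show ?thesis by (rule analytic_imp_holomorphic)
qed

subsection \<open>Functions on a strip in several variables\<close>

definition upd :: "complex ^ 'r \<Rightarrow> 'r \<Rightarrow> complex \<Rightarrow> complex ^ 'r::finite" where
  "upd \<theta> j s = (\<chi> i. if i = j then s else \<theta> $ i)"

lemma upd_nth [simp]: "upd \<theta> j s $ i = (if i = j then s else \<theta> $ i)"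
  by (simp add: upd_def)

lemma upd_same [simp]: "upd \<theta> j (\<theta> $ j) = \<theta>"
  by (simp add: vec_eq_iff)

lemma upd_upd [simp]: "upd (upd \<theta> j s) j r = upd \<theta> j r"
  by (simp add: vec_eq_iff)

lemma upd_commute: "i \<noteq> j \<Longrightarrow> upd (upd \<theta> i s) j r = upd (upd \<theta> j r) i s"
  by (simp add: vec_eq_iff)

lemma upd_in_strip: "\<theta> \<in> strip \<rho> \<Longrightarrow> \<bar>Im s\<bar> \<le> \<rho> \<Longrightarrow> upd \<theta> j s \<in> strip \<rho>"
  by (simp add: strip_def)

lemma strip_Im: "\<theta> \<in> strip \<rho> \<Longrightarrow> \<bar>Im (\<theta> $ j)\<bar> \<le> \<rho>"
  by (simp add: strip_def)

lemma continuous_on_upd [continuous_intros]: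
  assumes "continuous_on X f" "continuous_on X g"
  shows "continuous_on X (\<lambda>x. upd (f x) j (g x))"
  unfolding upd_def
proof (rule continuous_on_vec_lambda)
  show "continuous_on X (\<lambda>x. if i = j then g x else f x $ i)" for i
    by (cases "i = j") (auto intro!: continuous_intros assms)
qed

text \<open>Joint continuity with holomorphy in each variable separately suits a coordinatewise
  expansion: one-variable Fourier theory applies, and the class is preserved by taking Fourier
  coefficients in one variable. While one variable moves in the open strip, the others may lie
  anywhere in the closed one.\<close>

definition periodic_holomorphic :: "real \<Rightarrow> real \<Rightarrow> (complex ^ 'r::finite \<Rightarrow> complex) \<Rightarrow> bool" where
  "periodic_holomorphic \<rho> M F \<longleftrightarrow> continuous_on (strip \<rho>) F \<and>
     (\<forall>\<theta>\<in>strip \<rho>. norm (F \<theta>) \<le> M \<and> (\<forall>j. F (upd \<theta> j (\<theta> $ j + of_real (2 * pi))) = F \<theta>) \<and>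
        (\<forall>j. (\<lambda>s. F (upd \<theta> j s)) holomorphic_on {s. \<bar>Im s\<bar> < \<rho>}))"

lemma closed_segment_2pi_Im: "s \<in> closed_segment 0 (of_real (2 * pi)) \<Longrightarrow> Im s = 0"
  by (auto simp: closed_segment_def)

text \<open>The step of the induction on the number of variables. Holomorphy in the other variables
  passes through the contour integral; in the variable \<open>j\<close> itself the coefficient is
  constant.\<close>

lemma periodic_holomorphic_fourier_coeff:
  assumes F: "periodic_holomorphic \<rho> M F" and \<sigma>: "0 < \<sigma>" "\<sigma> < \<rho>"
  shows "periodic_holomorphic \<rho> (M * exp (- \<sigma> * real_of_int \<bar>n\<bar>)) (\<lambda>\<theta>. fourier_coeff (\<lambda>s. F (upd \<theta> j s)) n)"
proof -
  have \<rho>: "\<rho> > 0" using \<sigma> by simp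
  have cF: "continuous_on (strip \<rho>) F" and FM: "\<And>\<theta>. \<theta> \<in> strip \<rho> \<Longrightarrow> norm (F \<theta>) \<le> M"
    and Fp: "\<And>\<theta> j. \<theta> \<in> strip \<rho> \<Longrightarrow> F (upd \<theta> j (\<theta> $ j + of_real (2 * pi))) = F \<theta>"
    and Fh: "\<And>\<theta> j. \<theta> \<in> strip \<rho> \<Longrightarrow> (\<lambda>s. F (upd \<theta> j s)) holomorphic_on {s. \<bar>Im s\<bar> < \<rho>}"
    using F unfolding periodic_holomorphic_def by blast+
  have per: "F (upd \<theta> j (s + 2 * pi)) = F (upd \<theta> j s)" if "\<theta> \<in> strip \<rho>" "\<bar>Im s\<bar> < \<rho>" for \<theta> s
    using Fp[OF upd_in_strip[OF that(1), of s j], of j] that(2) by simp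
  have cont: "continuous_on (strip \<rho>) (\<lambda>\<theta>. fourier_coeff (\<lambda>s. F (upd \<theta> j s)) n)"
    unfolding fourier_coeff_def
  proof (intro continuous_on_divide continuous_on_contour_integral_linepath continuous_on_const)
    have "continuous_on (strip \<rho> \<times> closed_segment 0 (of_real (2 * pi))) (\<lambda>p. F (upd (fst p) j (snd p)) * exp (- \<i> * of_int n * snd p))"
      using \<rho> by (intro continuous_intros continuous_on_compose2[OF cF])
        (auto intro!: upd_in_strip simp: closed_segment_2pi_Im)
    then show "continuous_on (strip \<rho> \<times> closed_segment 0 (of_real (2 * pi))) (\<lambda>(\<theta>, s). F (upd \<theta> j s) * exp (- \<i> * of_int n * s))"
      by (simp add: case_prod_unfold)
  qed simp
  have bound: "norm (fourier_coeff (\<lambda>s. F (upd \<theta> j s)) n) \<le> M * exp (- \<sigma> * real_of_int \<bar>n\<bar>)" if "\<theta> \<in> strip \<rho>" for \<theta>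
    by (rule fourier_coeff_le[OF \<rho> Fh[OF that] per[OF that]]) (use \<sigma> that in \<open>auto intro!: FM upd_in_strip\<close>)
  have periodic: "fourier_coeff (\<lambda>s. F (upd (upd \<theta> i (\<theta> $ i + of_real (2 * pi))) j s)) n = fourier_coeff (\<lambda>s. F (upd \<theta> j s)) n"
    if "\<theta> \<in> strip \<rho>" for \<theta> i
  proof (cases "i = j")
    case False
    have "F (upd (upd \<theta> i (\<theta> $ i + of_real (2 * pi))) j s) = F (upd \<theta> j s)" if "s \<in> closed_segment 0 (of_real (2 * pi))" for s
      using Fp[OF upd_in_strip[OF \<open>\<theta> \<in> strip \<rho>\<close>, of s j], of i] closed_segment_2pi_Im[OF that] \<rho> False
      by (simp add: upd_commute)
    then show ?thesis unfolding fourier_coeff_def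
      by (intro arg_cong2[of _ _ _ _ "(/)"] contour_integral_eq) auto
  qed simp
  have holo: "(\<lambda>s. fourier_coeff (\<lambda>r. F (upd (upd \<theta> i s) j r)) n) holomorphic_on {s. \<bar>Im s\<bar> < \<rho>}"
    if \<theta>: "\<theta> \<in> strip \<rho>" for \<theta> i
  proof (cases "i = j")
    case False
    show ?thesis unfolding fourier_coeff_def
    proof (intro holomorphic_on_divide holomorphic_on_const holomorphic_on_contour_integral_linepath open_Im_strip)
      have "continuous_on ({s. \<bar>Im s\<bar> < \<rho>} \<times> closed_segment 0 (of_real (2 * pi)))
        (\<lambda>p. F (upd (upd \<theta> i (fst p)) j (snd p)) * exp (- \<i> * of_int n * snd p))"
        using \<rho> \<theta> by (intro continuous_intros continuous_on_compose2[OF cF])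
          (auto intro!: upd_in_strip simp: closed_segment_2pi_Im)
      then show "continuous_on ({s. \<bar>Im s\<bar> < \<rho>} \<times> closed_segment 0 (of_real (2 * pi)))
        (\<lambda>(s, r). F (upd (upd \<theta> i s) j r) * exp (- \<i> * of_int n * r))"
        by (simp add: case_prod_unfold)
      show "(\<lambda>s. F (upd (upd \<theta> i s) j r) * exp (- \<i> * of_int n * r)) holomorphic_on {s. \<bar>Im s\<bar> < \<rho>}"
        if "r \<in> closed_segment 0 (of_real (2 * pi))" for r
        unfolding upd_commute[OF False] using \<rho> closed_segment_2pi_Im[OF that]
        by (intro holomorphic_intros Fh upd_in_strip[OF \<theta>]) auto
    qed simp
  qed simp
  show ?thesis
    unfolding periodic_holomorphic_def using cont bound periodic holo by simp
qed

section \<open>Integer vectors as frequency module\<close>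

definition freq :: "real ^ 'r \<Rightarrow> int ^ 'r::finite \<Rightarrow> real" where
  "freq \<omega> k = (\<Sum>j\<in>UNIV. of_int (k $ j) * \<omega> $ j)"

definition l1norm :: "int ^ 'r::finite \<Rightarrow> real" where
  "l1norm k = of_int (\<Sum>j\<in>UNIV. \<bar>k $ j\<bar>)"

lemma component_le_l1norm: "of_int \<bar>k $ j\<bar> \<le> l1norm k"
  unfolding l1norm_def of_int_le_iff by (rule member_le_sum) auto

lemma frequency_module_freq: "frequency_module (freq \<omega>) l1norm"
proof
  show "freq \<omega> (k + l) = freq \<omega> k + freq \<omega> l" for k l
    by (simp add: freq_def algebra_simps sum.distrib)
  show "l1norm (k + l) \<le> l1norm k + l1norm l" for k l :: "int ^ 'a"
    unfolding l1norm_def of_int_add[symmetric] of_int_le_iff sum.distrib[symmetric]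
    by (intro sum_mono) auto
  show "l1norm (0 :: int ^ 'a) = 0" by (simp add: l1norm_def)
  show "1 \<le> l1norm k" if "k \<noteq> 0" for k :: "int ^ 'a"
  proof -
    obtain j where "k $ j \<noteq> 0" using \<open>k \<noteq> 0\<close> by (auto simp: vec_eq_iff)
    then have "1 \<le> real_of_int \<bar>k $ j\<bar>" by linarith
    with component_le_l1norm[of k j] show ?thesis by linarith
  qed
qed

lemma freq_axis: "freq \<omega> (axis j n) = of_int n * \<omega> $ j"
proof -
  have "freq \<omega> (axis j n) = (\<Sum>i\<in>UNIV. if i = j then of_int n * \<omega> $ j else 0)"
    unfolding freq_def by (rule sum.cong) (auto simp: axis_def)
  then show ?thesis by simp
qed

lemma l1norm_axis: "l1norm (axis j n) = \<bar>of_int n\<bar>"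
proof -
  have "l1norm (axis j n) = of_int (\<Sum>i\<in>UNIV. if i = j then \<bar>n\<bar> else 0)"
    unfolding l1norm_def by (intro arg_cong[of _ _ of_int] sum.cong) (auto simp: axis_def)
  then show ?thesis by simp
qed

definition line :: "real ^ 'r \<Rightarrow> real \<Rightarrow> complex ^ 'r::finite" where
  "line \<omega> t = (\<chi> j. of_real (\<omega> $ j * t))"

lemma line_in_strip: "0 \<le> \<rho> \<Longrightarrow> line \<omega> t \<in> strip \<rho>"
  by (simp add: line_def strip_def)

text \<open>Expand in one coordinate at a time; the coefficients are functions of the same kind.\<close>

lemma qp_periodic_holomorphic:
  fixes F :: "complex ^ 'r::finite \<Rightarrow> complex"
  assumes "finite X" and \<sigma>: "0 < \<sigma>'" "\<sigma>' < \<sigma>" "\<sigma> < \<rho>"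
    and Q: "((\<lambda>n::int. exp (- (\<sigma> - \<sigma>') * real_of_int \<bar>n\<bar>)) has_sum Q) UNIV"
    and "periodic_holomorphic \<rho> M F"
    and "\<And>\<theta> \<theta>'. (\<And>j. j \<in> X \<Longrightarrow> \<theta> $ j = \<theta>' $ j) \<Longrightarrow> F \<theta> = F \<theta>'"
  shows "frequency_module.qp (freq \<omega>) l1norm \<sigma>' (M * Q ^ card X) (\<lambda>t. F (line \<omega> t))"
proof -
  interpret frequency_module "freq \<omega>" l1norm by (rule frequency_module_freq)
  show ?thesis
    using assms(1) assms(6-)
  proof (induction X arbitrary: F M rule: finite_induct)
    case empty
    \<comment> \<open>A function that depends on no coordinate is constant, hence a single
      exponential with exponent 0.\<close>
    have "(\<lambda>t. F (line \<omega> t)) = (\<lambda>t. F (line \<omega> 0))" by (intro ext empty(2)) auto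
    moreover have "norm (F (line \<omega> 0)) \<le> M"
      using empty(1) line_in_strip[of \<rho> \<omega> 0] \<sigma> by (auto simp: periodic_holomorphic_def)
    ultimately show ?case
      using qp_mono[OF qp_const order_refl, of "F (line \<omega> 0)" M \<sigma>'] by (simp only: card.empty power_0 mult_1_right)
  next
    case (insert j X)
    have \<rho>: "0 < \<sigma>" "\<rho> > 0" using \<sigma> by auto
    define G where "G n \<theta> = fourier_coeff (\<lambda>s. F (upd \<theta> j s)) n" for n \<theta>
    have G: "periodic_holomorphic \<rho> (M * exp (- \<sigma> * real_of_int \<bar>n\<bar>)) (G n)" for n
      unfolding G_def by (rule periodic_holomorphic_fourier_coeff[OF insert.prems(1) \<rho>(1) \<sigma>(3)])
    have dep: "G n \<theta> = G n \<theta>'" if "\<And>i. i \<in> X \<Longrightarrow> \<theta> $ i = \<theta>' $ i" for n \<theta> \<theta>'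
    proof -
      have "F (upd \<theta> j s) = F (upd \<theta>' j s)" for s by (rule insert.prems(2)) (use that in auto)
      then show ?thesis by (simp add: G_def)
    qed
    have qG: "qp \<sigma>' (M * exp (- \<sigma> * real_of_int \<bar>n\<bar>) * Q ^ card X) (\<lambda>t. G n (line \<omega> t))" for n
      by (rule insert.IH[OF G dep])
    define c where "c n = exp (- (\<sigma> - \<sigma>') * real_of_int \<bar>n\<bar>)" for n :: int
    have qn: "qp \<sigma>' (c n * (M * Q ^ card X)) (\<lambda>t. cis (freq \<omega> (axis j n) * t) * G n (line \<omega> t))" for n
    proof -
      \<comment> \<open>The weight of the new mode is beaten by the decay of its coefficient; the
        remaining factors \<open>c n\<close> sum to \<open>Q\<close>, so each variable costs one
        factor \<open>Q\<close>.\<close>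
      have "exp (\<sigma>' * \<bar>of_int n\<bar>) * exp (- \<sigma> * real_of_int \<bar>n\<bar>) = c n"
        unfolding c_def exp_add[symmetric] by (simp add: algebra_simps)
      then have eq: "norm (1::complex) * exp (\<sigma>' * l1norm (axis j n :: int ^ 'r)) * (M * exp (- \<sigma> * real_of_int \<bar>n\<bar>) * Q ^ card X) = c n * (M * Q ^ card X)"
        by (simp add: l1norm_axis mult_ac)
      show ?thesis
        using qp_monom_mult[OF qG less_imp_le[OF \<sigma>(1)], of 1 "axis j n" n] unfolding eq by simp
    qed
    have hF: "((\<lambda>n. cis (freq \<omega> (axis j n) * t) * G n (line \<omega> t)) has_sum F (line \<omega> t)) UNIV" for t
    proof -
      let ?g = "\<lambda>s. F (upd (line \<omega> t) j s)"
      have l: "line \<omega> t \<in> strip \<rho>" using \<rho> by (intro line_in_strip) auto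
      have "((\<lambda>n. fourier_coeff ?g n * exp (\<i> * of_int n * of_real (\<omega> $ j * t))) has_sum ?g (of_real (\<omega> $ j * t))) UNIV"
      proof (rule fourier_has_sum[OF _ _ \<rho>(1) \<sigma>(3)])
        show "?g holomorphic_on {s. \<bar>Im s\<bar> < \<rho>}"
          using insert.prems(1) l by (auto simp: periodic_holomorphic_def)
        fix s assume s: "\<bar>Im s\<bar> < \<rho>"
        then have u: "upd (line \<omega> t) j s \<in> strip \<rho>" by (intro upd_in_strip l) auto
        then show "norm (?g s) \<le> M"
          using insert.prems(1) by (auto simp: periodic_holomorphic_def)
        have "F (upd (upd (line \<omega> t) j s) j (upd (line \<omega> t) j s $ j + of_real (2 * pi))) = F (upd (line \<omega> t) j s)"
          using insert.prems(1) u unfolding periodic_holomorphic_def by blast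
        then show "?g (s + 2 * pi) = ?g s" by simp
      qed
      moreover have "upd (line \<omega> t) j (of_real (\<omega> $ j * t)) = line \<omega> t"
        by (simp add: vec_eq_iff line_def)
      moreover have "exp (\<i> * of_int n * of_real (\<omega> $ j * t)) = cis (freq \<omega> (axis j n) * t)" for n
        by (simp add: cis_conv_exp freq_axis mult_ac)
      ultimately show ?thesis by (simp add: G_def mult.commute)
    qed
    have bij: "bij_betw int_decode UNIV UNIV" by (rule bij_int_decode)
    show ?case
    proof (rule qp_sums)
      show "qp \<sigma>' (c (int_decode m) * (M * Q ^ card X)) (\<lambda>t. cis (freq \<omega> (axis j (int_decode m)) * t) * G (int_decode m) (line \<omega> t))" for m
        by (rule qn)
      have "((\<lambda>m. c (int_decode m)) has_sum Q) UNIV"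
        using Q unfolding c_def[symmetric] has_sum_reindex_bij_betw[OF bij] .
      from sums_mult2[OF has_sum_imp_sums[OF this], of "M * Q ^ card X"]
      show "(\<lambda>m. c (int_decode m) * (M * Q ^ card X)) sums (M * Q ^ card (insert j X))"
        using insert.hyps by (simp add: mult_ac)
      show "(\<lambda>m. cis (freq \<omega> (axis j (int_decode m)) * t) * G (int_decode m) (line \<omega> t)) sums F (line \<omega> t)" for t
        using hF[of t] unfolding has_sum_reindex_bij_betw[OF bij, of "\<lambda>n. cis (freq \<omega> (axis j n) * t) * G n (line \<omega> t)", symmetric]
        by (rule has_sum_imp_sums)
    qed (use \<sigma> in simp)
  qed
qed

text \<open>Every finite set of integer vectors lies in a box \<open>B\<close> to the power
  \<open>'r\<close>, over which the sum of products is the product of the sums.\<close>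

lemma summable_on_prod_vec:
  fixes h :: "int \<Rightarrow> real"
  assumes h: "\<And>n. h n \<ge> 0" "h summable_on UNIV"
  shows "(\<lambda>k :: int ^ 'r::finite. \<Prod>j\<in>UNIV. h (k $ j)) summable_on UNIV"
proof (rule nonneg_bdd_above_summable_on)
  show "bdd_above (sum (\<lambda>k :: int ^ 'r. \<Prod>j\<in>UNIV. h (k $ j)) ` {F. F \<subseteq> UNIV \<and> finite F})"
  proof (rule bdd_aboveI2)
    fix F :: "(int ^ 'r) set"
    assume "F \<in> {F. F \<subseteq> UNIV \<and> finite F}"
    then have F: "finite F" by simp
    define B where "B = (\<Union>j. (\<lambda>k. k $ j) ` F)"
    have B: "finite B" using F by (simp add: B_def)
    let ?P = "PiE (UNIV :: 'r set) (\<lambda>_. B)"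
    have "F \<subseteq> vec_lambda ` ?P"
    proof
      fix k assume "k \<in> F"
      then have "vec_nth k \<in> ?P" by (auto simp: B_def)
      then show "k \<in> vec_lambda ` ?P" by (metis image_eqI vec_nth_inverse)
    qed
    then have "(\<Sum>k\<in>F. \<Prod>j\<in>UNIV. h (k $ j)) \<le> (\<Sum>k\<in>vec_lambda ` ?P. \<Prod>j\<in>UNIV. h (k $ j))"
      using B h by (intro sum_mono2 finite_imageI finite_PiE prod_nonneg) auto
    also have "\<dots> = (\<Sum>g\<in>?P. \<Prod>j\<in>UNIV. h (g j))"
      by (subst sum.reindex) (auto simp: inj_on_def vec_lambda_inject)
    also have "\<dots> = (\<Prod>j\<in>(UNIV :: 'r set). \<Sum>y\<in>B. h y)"
      using B by (subst prod_sum_PiE) auto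
    also have "\<dots> \<le> (\<Prod>j\<in>(UNIV :: 'r set). infsum h UNIV)"
      using B h by (intro prod_mono conjI sum_nonneg finite_sum_le_infsum) auto
    finally show "(\<Sum>k\<in>F. \<Prod>j\<in>UNIV. h (k $ j)) \<le> (\<Prod>j\<in>(UNIV :: 'r set). infsum h UNIV)" .
  qed
qed (use h in \<open>auto intro: prod_nonneg\<close>)

text \<open>The exponent is generous so that \<open>1 / l1norm k\<close> to this power splits into
  one factor \<open>1 / (l1norm k)\<^sup>2\<close> per coordinate. For \<open>k \<noteq> 0\<close>
  one has \<open>1 + \<bar>k $ j\<bar> \<le> 2 * l1norm k\<close>, which is where the 4 in
  \<open>h\<close> comes from. A large exponent does no harm, since
  \<open>stable_for_most_small\<close> accepts any \<open>p\<close>.\<close>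

lemma summable_on_l1norm_power:
  "(\<lambda>k :: int ^ 'r::finite. if k = 0 then 0 else 1 / l1norm k ^ (2 * CARD('r))) summable_on UNIV"
proof -
  define h where "h n = 4 / (1 + real_of_int \<bar>n\<bar>)\<^sup>2" for n
  have "summable (\<lambda>n. 4 / (1 + real n)\<^sup>2)"
  proof -
    have "summable (\<lambda>n. inverse (real n ^ 2))" by (rule inverse_power_summable) auto
    then have "summable (\<lambda>n. 4 * inverse (real (Suc n) ^ 2))"
      by (intro summable_mult) (subst summable_Suc_iff)
    then show ?thesis by (simp add: divide_inverse add_ac)
  qed
  then have "(\<lambda>n. 4 / (1 + real n)\<^sup>2) summable_on UNIV"
    by (intro summable_nonneg_imp_summable_on) auto
  then have "h summable_on UNIV" by (intro summable_on_int) (simp_all add: h_def)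
  moreover have "h n \<ge> 0" for n by (simp add: h_def)
  ultimately have s: "(\<lambda>k :: int ^ 'r. \<Prod>j\<in>UNIV. h (k $ j)) summable_on UNIV"
    by (intro summable_on_prod_vec)
  show ?thesis
  proof (rule summable_on_comparison_test[OF s])
    fix k :: "int ^ 'r"
    show "(if k = 0 then 0 else 1 / l1norm k ^ (2 * CARD('r))) \<le> (\<Prod>j\<in>UNIV. h (k $ j))"
    proof (cases "k = 0")
      case False
      interpret frequency_module "freq (0 :: real ^ 'r)" l1norm by (rule frequency_module_freq)
      have l: "l1norm k \<ge> 1" by (rule weight_ge_1[OF False])
      have "1 / (l1norm k)\<^sup>2 \<le> h (k $ j)" for j
      proof -
        have "1 + real_of_int \<bar>k $ j\<bar> \<le> 2 * l1norm k" using component_le_l1norm[of k j] l by linarith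
        then have "(1 + real_of_int \<bar>k $ j\<bar>)\<^sup>2 \<le> (2 * l1norm k)\<^sup>2" by (intro power_mono) auto
        then show ?thesis using l by (simp add: h_def field_simps)
      qed
      then have "(\<Prod>j\<in>(UNIV :: 'r set). 1 / (l1norm k)\<^sup>2) \<le> (\<Prod>j\<in>UNIV. h (k $ j))"
        by (intro prod_mono) auto
      then show ?thesis using False by (simp add: power_mult power_divide)
    qed (auto intro!: prod_nonneg simp: h_def)
    show "0 \<le> (if k = 0 then 0 else 1 / l1norm k ^ (2 * CARD('r)))"
      by (simp add: l1norm_def sum_nonneg)
  qed
qed

section \<open>From analytic functions on the strip to periodic holomorphic ones\<close>

lemma periodic_upd_of_int:
  assumes per: "\<And>\<theta> j. \<theta> \<in> strip \<rho> \<Longrightarrow> F (\<theta> + axis j (2 * of_real pi)) = F \<theta>" and \<theta>: "\<theta> \<in> strip \<rho>"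
  shows "F (upd \<theta> j (\<theta> $ j + of_int m * of_real (2 * pi))) = F \<theta>"
proof -
  have up: "upd \<theta>' j (\<theta>' $ j + of_real (2 * pi)) = \<theta>' + axis j (2 * of_real pi)" for \<theta>' :: "complex ^ 'a"
    by (simp add: vec_eq_iff axis_def)
  have nat: "F (upd \<theta>' j (\<theta>' $ j + of_nat n * of_real (2 * pi))) = F \<theta>'" if \<theta>': "\<theta>' \<in> strip \<rho>" for n \<theta>'
  proof (induction n)
    case (Suc n)
    let ?u = "upd \<theta>' j (\<theta>' $ j + of_nat n * of_real (2 * pi))"
    have u: "?u \<in> strip \<rho>" using strip_Im[OF \<theta>', of j] by (intro upd_in_strip \<theta>') simp
    have "upd \<theta>' j (\<theta>' $ j + of_nat (Suc n) * of_real (2 * pi)) = upd ?u j (?u $ j + of_real (2 * pi))"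
      by (simp add: algebra_simps)
    also have "F \<dots> = F ?u" unfolding up by (rule per[OF u])
    finally show ?case using Suc by simp
  qed simp
  show ?thesis
  proof (cases m rule: int_cases2)
    case (nonneg n)
    then show ?thesis using nat[OF \<theta>, of n] by simp
  next
    case (nonpos n)
    let ?u = "upd \<theta> j (\<theta> $ j + of_int m * of_real (2 * pi))"
    have u: "?u \<in> strip \<rho>" using strip_Im[OF \<theta>, of j] by (intro upd_in_strip \<theta>) simp
    have "upd ?u j (?u $ j + of_nat n * of_real (2 * pi)) = \<theta>"
      using nonpos by (simp add: vec_eq_iff)
    with nat[OF u, of n] show ?thesis by simp
  qed
qed

text \<open>The strip is unbounded in the real directions, but periodicity brings the real parts
  into \<open>{0..2 * pi}\<close>, one coordinate at a time, and the part of the strip over this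
  cube is compact.\<close>

lemma periodic_bounded_on_strip:
  fixes F :: "complex ^ 'r::finite \<Rightarrow> complex"
  assumes cont: "continuous_on (strip \<rho>) F"
    and per: "\<And>\<theta> j. \<theta> \<in> strip \<rho> \<Longrightarrow> F (\<theta> + axis j (2 * of_real pi)) = F \<theta>"
  obtains M where "\<And>\<theta>. \<theta> \<in> strip \<rho> \<Longrightarrow> norm (F \<theta>) \<le> M"
proof -
  define K where "K = strip \<rho> \<inter> {\<theta> :: complex ^ 'r. \<forall>j. 0 \<le> Re (\<theta> $ j) \<and> Re (\<theta> $ j) \<le> 2 * pi}"
  have "closed K"
  proof -
    have "K = (\<Inter>j. {\<theta>. \<bar>Im (\<theta> $ j)\<bar> \<le> \<rho>} \<inter> ({\<theta>. 0 \<le> Re (\<theta> $ j)} \<inter> {\<theta>. Re (\<theta> $ j) \<le> 2 * pi}))"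
      by (auto simp: K_def strip_def)
    then show ?thesis
      by (simp only:) (intro closed_INT ballI closed_Int closed_Collect_le continuous_intros)
  qed
  moreover have "bounded K"
  proof -
    have "norm \<theta> \<le> (\<Sum>j\<in>(UNIV :: 'r set). 2 * pi + \<bar>\<rho>\<bar>)" if "\<theta> \<in> K" for \<theta>
    proof -
      have "norm \<theta> \<le> (\<Sum>j\<in>UNIV. norm (\<theta> $ j))" unfolding norm_vec_def by (rule L2_set_le_sum) auto
      also have "\<dots> \<le> (\<Sum>j\<in>(UNIV :: 'r set). 2 * pi + \<bar>\<rho>\<bar>)"
      proof (rule sum_mono)
        fix j
        have "norm (\<theta> $ j) \<le> \<bar>Re (\<theta> $ j)\<bar> + \<bar>Im (\<theta> $ j)\<bar>" by (rule cmod_le)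
        also have "\<dots> \<le> 2 * pi + \<bar>\<rho>\<bar>" using that by (intro add_mono) (auto simp: K_def strip_def intro: order_trans)
        finally show "norm (\<theta> $ j) \<le> 2 * pi + \<bar>\<rho>\<bar>" .
      qed
      finally show ?thesis .
    qed
    then show "bounded K" by (auto simp: bounded_iff)
  qed
  ultimately have "compact K" by (simp add: compact_eq_bounded_closed)
  moreover have "continuous_on K F" using cont by (rule continuous_on_subset) (auto simp: K_def)
  ultimately have "bounded (F ` K)" by (intro compact_imp_bounded compact_continuous_image)
  then obtain M where M: "\<And>\<theta>. \<theta> \<in> K \<Longrightarrow> norm (F \<theta>) \<le> M"
    by (auto simp: bounded_iff)
  have red: "\<exists>\<theta>'\<in>strip \<rho>. F \<theta>' = F \<theta> \<and> (\<forall>j\<in>X. 0 \<le> Re (\<theta>' $ j) \<and> Re (\<theta>' $ j) \<le> 2 * pi)"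
    if \<theta>: "\<theta> \<in> strip \<rho>" and X: "finite X" for \<theta> X
    using X
  proof (induction X rule: finite_induct)
    case empty
    then show ?case using \<theta> by auto
  next
    case (insert j X)
    then obtain \<theta>' where \<theta>': "\<theta>' \<in> strip \<rho>" "F \<theta>' = F \<theta>" "\<forall>j\<in>X. 0 \<le> Re (\<theta>' $ j) \<and> Re (\<theta>' $ j) \<le> 2 * pi"
      by blast
    define m where "m = - \<lfloor>Re (\<theta>' $ j) / (2 * pi)\<rfloor>"
    let ?u = "upd \<theta>' j (\<theta>' $ j + of_int m * of_real (2 * pi))"
    have u: "?u \<in> strip \<rho>" using strip_Im[OF \<theta>'(1), of j] by (intro upd_in_strip \<theta>') simp
    have "real_of_int \<lfloor>Re (\<theta>' $ j) / (2 * pi)\<rfloor> * (2 * pi) \<le> Re (\<theta>' $ j) / (2 * pi) * (2 * pi)"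
      by (intro mult_right_mono) auto
    moreover have "Re (\<theta>' $ j) / (2 * pi) * (2 * pi) \<le> (real_of_int \<lfloor>Re (\<theta>' $ j) / (2 * pi)\<rfloor> + 1) * (2 * pi)"
      by (intro mult_right_mono) auto
    ultimately have "0 \<le> Re (?u $ j)" "Re (?u $ j) \<le> 2 * pi"
      by (simp_all add: m_def algebra_simps)
    moreover have "F ?u = F \<theta>" using periodic_upd_of_int[OF per \<theta>'(1), of j m] \<theta>'(2) by simp
    ultimately show ?case using u \<theta>'(3) by (intro bexI[of _ ?u]) auto
  qed
  show ?thesis
  proof (rule that)
    fix \<theta> :: "complex ^ 'r"
    assume "\<theta> \<in> strip \<rho>"
    from red[OF this finite_class.finite_UNIV] obtain \<theta>' where "\<theta>' \<in> K" "F \<theta>' = F \<theta>" by (auto simp: K_def)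
    with M[of \<theta>'] show "norm (F \<theta>) \<le> M" by simp
  qed
qed

text \<open>Along a coordinate line a complex-linear derivative is multiplication by the number
  \<open>F' (axis j 1)\<close>, which gives holomorphy in each variable.\<close>

lemma multi_analytic_imp_periodic_holomorphic:
  fixes F :: "complex ^ 'r::finite \<Rightarrow> complex"
  assumes F: "multi_analytic_on F (strip \<rho>)"
    and per: "\<And>\<theta> j. \<theta> \<in> strip \<rho> \<Longrightarrow> F (\<theta> + axis j (2 * of_real pi)) = F \<theta>"
  obtains M where "periodic_holomorphic \<rho> M F"
proof -
  have D: "\<exists>F'. (F has_derivative F') (at \<theta>) \<and> (\<forall>c v. F' (c *s v) = c * F' v)" if "\<theta> \<in> strip \<rho>" for \<theta>
    using F that unfolding multi_analytic_on_def by (metis centre_in_ball)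
  have cont: "continuous_on (strip \<rho>) F"
    using D by (meson continuous_at_imp_continuous_on has_derivative_continuous)
  obtain M where M: "\<And>\<theta>. \<theta> \<in> strip \<rho> \<Longrightarrow> norm (F \<theta>) \<le> M"
    by (rule periodic_bounded_on_strip[OF cont per]) (assumption | rule that)+
  have "(\<lambda>s. F (upd \<theta> j s)) holomorphic_on {s. \<bar>Im s\<bar> < \<rho>}" if \<theta>: "\<theta> \<in> strip \<rho>" for \<theta> j
  proof (rule holomorphic_onI)
    fix s assume "s \<in> {s. \<bar>Im s\<bar> < \<rho>}"
    then have u: "upd \<theta> j s \<in> strip \<rho>" by (intro upd_in_strip \<theta>) auto
    from D[OF u] obtain F' where F': "(F has_derivative F') (at (upd \<theta> j s))" "\<And>c v. F' (c *s v) = c * F' v"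
      by blast
    have up: "upd \<theta> j r = upd \<theta> j 0 + axis j r" for r
      by (simp add: vec_eq_iff axis_def)
    have ax: "axis j h = h *s axis j (1::complex)" for h
      by (simp add: vec_eq_iff axis_def)
    have "bounded_linear (\<lambda>h :: complex. axis j h :: complex ^ 'r)"
      by (rule bounded_linearI'[where 'a = complex]) (auto simp: vec_eq_iff axis_def)
    then have "((\<lambda>r. upd \<theta> j 0 + axis j r) has_derivative (\<lambda>h. axis j h)) (at s)"
      by (auto intro!: derivative_eq_intros bounded_linear_imp_has_derivative)
    then have "(upd \<theta> j has_derivative (\<lambda>h. axis j h)) (at s)" by (simp add: up[symmetric])
    from has_derivative_compose[OF this F'(1)] have "((\<lambda>r. F (upd \<theta> j r)) has_derivative (\<lambda>h. F' (axis j h))) (at s)" .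
    moreover have "(\<lambda>h. F' (axis j h)) = (*) (F' (axis j 1))"
      by (subst ax) (auto simp: F'(2) mult.commute)
    ultimately have "((\<lambda>r. F (upd \<theta> j r)) has_field_derivative F' (axis j 1)) (at s)"
      by (simp add: has_field_derivative_def)
    then show "(\<lambda>s. F (upd \<theta> j s)) field_differentiable at s within {s. \<bar>Im s\<bar> < \<rho>}"
      by (auto simp: field_differentiable_def intro: has_field_derivative_at_within)
  qed
  moreover have "F (upd \<theta> j (\<theta> $ j + of_real (2 * pi))) = F \<theta>" if "\<theta> \<in> strip \<rho>" for \<theta> j
    using periodic_upd_of_int[OF per that, of j 1] by simp
  ultimately have "periodic_holomorphic \<rho> M F"
    using cont M by (auto simp: periodic_holomorphic_def)
  then show ?thesis by (rule that)
qed

text \<open>Links the limit in the hypothesis to the bounded primitives used throughout: over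
  \<open>{-T..T}\<close> such a primitive contributes at most \<open>2 * B\<close>, which disappears
  after division by \<open>2 * T\<close>.\<close>

lemma mean_of_average:
  assumes m: "mean (\<lambda>t. of_real (a t)) m" and avg: "has_average a abar"
  shows "m = of_real abar"
proof -
  from m obtain q where q: "bounded (range q)" "\<And>t. (q has_vector_derivative of_real (a t) - m) (at t)"
    unfolding mean_def by blast
  obtain B where B: "\<And>t. norm (q t) \<le> B" using q(1) by (auto simp: bounded_iff)
  have int: "((\<lambda>t. of_real (a t)) has_integral (q T - q (- T) + (2 * T) *\<^sub>R m)) {- T..T}" if T: "T > 0" for T
  proof -
    have "((\<lambda>t. of_real (a t) - m) has_integral (q T - q (- T))) {- T..T}"
      by (rule fundamental_theorem_of_calculus[OF _ has_vector_derivative_at_within[OF q(2)]]) (use T in simp)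
    moreover have "((\<lambda>t. m) has_integral (2 * T) *\<^sub>R m) {- T..T}"
      using has_integral_const_real[of m "- T" T] T by simp
    ultimately have "((\<lambda>t. of_real (a t) - m + m) has_integral (q T - q (- T) + (2 * T) *\<^sub>R m)) {- T..T}"
      by (rule has_integral_add)
    then show ?thesis by (simp only: diff_add_cancel)
  qed
  have lim: "((\<lambda>T. (1 / (2 * T)) *\<^sub>R (q T - q (- T) + (2 * T) *\<^sub>R m)) \<longlongrightarrow> m) at_top"
  proof -
    have "((\<lambda>T. (1 / (2 * T)) *\<^sub>R (q T - q (- T))) \<longlongrightarrow> 0) at_top"
    proof (rule Lim_null_comparison)
      show "\<forall>\<^sub>F T in at_top. norm ((1 / (2 * T)) *\<^sub>R (q T - q (- T))) \<le> B / T"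
        using eventually_gt_at_top[of 0]
      proof eventually_elim
        case (elim T)
        have "norm (q T - q (- T)) \<le> 2 * B" using norm_triangle_ineq4[of "q T" "q (- T)"] B[of T] B[of "- T"] by linarith
        then have "norm (q T - q (- T)) / (2 * T) \<le> 2 * B / (2 * T)"
          using elim by (intro divide_right_mono) auto
        moreover have "norm ((1 / (2 * T)) *\<^sub>R (q T - q (- T))) = norm (q T - q (- T)) / (2 * T)"
          using elim unfolding norm_scaleR by simp
        ultimately show ?case by (simp only: mult_divide_mult_cancel_left_if) simp
      qed
      show "((\<lambda>T. B / T) \<longlongrightarrow> 0) at_top" by real_asymp
    qed
    then have "((\<lambda>T. (1 / (2 * T)) *\<^sub>R (q T - q (- T)) + m) \<longlongrightarrow> 0 + m) at_top"
      by (intro tendsto_intros)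
    moreover have "\<forall>\<^sub>F T in at_top. (1 / (2 * T)) *\<^sub>R (q T - q (- T)) + m = (1 / (2 * T)) *\<^sub>R (q T - q (- T) + (2 * T) *\<^sub>R m)"
      using eventually_gt_at_top[of 0] by eventually_elim (simp add: scaleR_add_right)
    ultimately show ?thesis by (simp add: filterlim_cong[OF refl refl])
  qed
  have "\<forall>\<^sub>F T in at_top. of_real (1 / (2 * T) * integral {- T..T} a) = (1 / (2 * T)) *\<^sub>R (q T - q (- T) + (2 * T) *\<^sub>R m)"
    using eventually_gt_at_top[of 0]
  proof eventually_elim
    case (elim T)
    let ?I = "q T - q (- T) + (2 * T) *\<^sub>R m"
    have 1: "(a has_integral Re ?I) {- T..T}"
      using has_integral_linear[OF int[OF elim] bounded_linear_Re] by (simp add: o_def)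
    \<comment> \<open>The primitive \<open>q\<close> and the value \<open>m\<close> are complex a
      priori; the integrand is real, so the imaginary part of the integral is 0.\<close>
    have "((\<lambda>t. 0) has_integral Im ?I) {- T..T}"
      using has_integral_linear[OF int[OF elim] bounded_linear_Im] by (simp add: o_def)
    then have "Im ?I = 0" by (metis has_integral_0 has_integral_unique)
    then have "of_real (Re ?I) = ?I" by (simp only: complex_eq_iff Re_complex_of_real Im_complex_of_real)
    with integral_unique[OF 1] show ?case
      by (metis of_real_mult scaleR_conv_of_real)
  qed
  with lim have "((\<lambda>T. of_real (1 / (2 * T) * integral {- T..T} a)) \<longlongrightarrow> m) at_top"
    by (simp add: filterlim_cong[OF refl refl])
  moreover have "((\<lambda>T. of_real (1 / (2 * T) * integral {- T..T} a) :: complex) \<longlongrightarrow> of_real abar) at_top"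
    using avg unfolding has_average_def by (rule tendsto_of_real)
  ultimately show ?thesis by (intro tendsto_unique[OF trivial_limit_at_top_linorder])
qed

theorem theorem4p3:
  fixes a :: "real \<Rightarrow> real" and \<omega> :: "real ^ 'r::finite" and \<rho> \<alpha> \<tau> abar :: real
  assumes "\<rho> > 0"
    and "real_analytic_quasi_periodic \<rho> \<omega> a"
    and "has_average a abar" and "abar > 0"
    and "\<alpha> > 0" and "\<tau> > real CARD('r) - 1"
    and "diophantine \<alpha> \<tau> \<omega>"
  shows "for_most_small (\<lambda>\<epsilon>. lyapunov_stable (hill_field \<epsilon> a) (0, 0))"
proof -
  interpret frequency_module "freq \<omega>" l1norm by (rule frequency_module_freq)
  from assms(2) obtain F :: "complex ^ 'r \<Rightarrow> complex" where F: "multi_analytic_on F (strip \<rho>)"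
    "\<And>\<theta> j. \<theta> \<in> strip \<rho> \<Longrightarrow> F (\<theta> + axis j (2 * of_real pi)) = F \<theta>"
    and a: "\<And>t. of_real (a t) = F (line \<omega> t)"
    unfolding real_analytic_quasi_periodic_def line_def by blast
  obtain M where M: "periodic_holomorphic \<rho> M F"
    by (rule multi_analytic_imp_periodic_holomorphic[OF F]) (assumption | rule that)+
  \<comment> \<open>Two reductions of the width: contours are shifted to height
    \<open>\<rho> / 2\<close>, strictly inside the strip, and the gap down to
    \<open>\<rho> / 4\<close> makes the series \<open>Q\<close> converge.\<close>
  have "(\<lambda>n::int. exp (- (\<rho> / 2 - \<rho> / 4) * real_of_int \<bar>n\<bar>)) summable_on UNIV"
    using \<open>\<rho> > 0\<close> by (intro summable_on_exp_int) simp
  then obtain Q where Q: "((\<lambda>n::int. exp (- (\<rho> / 2 - \<rho> / 4) * real_of_int \<bar>n\<bar>)) has_sum Q) UNIV"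
    by (auto simp: summable_on_def)
  have "qp (\<rho> / 4) (M * Q ^ card (UNIV :: 'r set)) (\<lambda>t. F (line \<omega> t))"
  proof (rule qp_periodic_holomorphic[OF finite_class.finite_UNIV _ _ _ Q M])
    show "F \<theta> = F \<theta>'" if "\<And>j. j \<in> UNIV \<Longrightarrow> \<theta> $ j = \<theta>' $ j"
      for \<theta> \<theta>' :: "complex ^ 'r"
      using that by (auto intro: arg_cong[of _ _ F] simp: vec_eq_iff)
  qed (use \<open>\<rho> > 0\<close> in auto)
  then have qa: "qp (\<rho> / 4) (M * Q ^ card (UNIV :: 'r set)) (\<lambda>t. of_real (a t))"
    by (simp only: a)
  \<comment> \<open>Weights of nonzero \<open>k\<close> are at least 1, so rounding the exponent up
    to a natural number only weakens the Diophantine condition.\<close>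
  define n where "n = nat \<lceil>\<tau>\<rceil>"
  have dio: "\<alpha> / l1norm k ^ n \<le> \<bar>freq \<omega> k\<bar>" if "k \<noteq> 0" for k
  proof -
    have "\<alpha> / l1norm k powr \<tau> \<le> \<bar>freq \<omega> k\<bar>"
      using assms(7) that unfolding diophantine_def freq_def l1norm_def by blast
    moreover have "l1norm k powr \<tau> \<le> l1norm k ^ n"
    proof -
      have "\<tau> \<le> real n" unfolding n_def by linarith
      then have "l1norm k powr \<tau> \<le> l1norm k powr real n" using weight_ge_1[OF that] by (intro powr_mono) auto
      then show ?thesis using weight_ge_1[OF that] by (simp add: powr_realpow)
    qed
    then have "\<alpha> / l1norm k ^ n \<le> \<alpha> / l1norm k powr \<tau>"
      using weight_ge_1[OF that] \<open>\<alpha> > 0\<close> by (intro divide_left_mono) auto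
    ultimately show ?thesis by simp
  qed
  have \<rho>4: "\<rho> / 4 > 0" using \<open>\<rho> > 0\<close> by simp
  \<comment> \<open>The Diophantine condition supplies a bounded primitive of \<open>a - m\<close>
    for some \<open>m\<close>; the given average then forces \<open>m = abar\<close>.\<close>
  obtain m where "mean (\<lambda>t. of_real (a t)) m"
    by (rule qp_primitive[OF qa \<rho>4 \<open>\<alpha> > 0\<close> dio]) (assumption | rule that)+
  with mean_of_average[OF this assms(3)] have mean: "mean (\<lambda>t. of_real (a t)) (of_real abar)" by simp
  show ?thesis
    by (rule stable_for_most_small[OF \<rho>4 qa mean \<open>abar > 0\<close> \<open>\<alpha> > 0\<close> dio inj_to_nat has_sum_infsum[OF summable_on_l1norm_power]])
qed

end
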